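(* Let $X$ be an Asplund space, let $\varphi_1,\varphi_2\colon X\to\mathbb{R}_\infty$ be lower semicontinuous and $\bar x\in\operatorname{dom}\varphi_1\cap\operatorname{dom}\varphi_2$. Suppose that one of the following conditions is satisfied: (i) the pair $(\varphi_1,\varphi_2)$ is firmly quasiuniformly lower semicontinuous near $\bar x$; (ii) $X$ is reflexive and $\varphi_1$ and $\varphi_2$ are weakly sequentially lower semicontinuous; (iii) $\dim X<+\infty$. Then, for any $x^*\in\partial(\varphi_1+\varphi_2)(\bar x)$ and $\varepsilon>0$, there exist points $x_1,x_2\in X$ such that $$\|x_i-\bar x\|<\varepsilon,\quad|\varphi_i(x_i)-\varphi_i(\bar x)|<\varepsilon\quad(i=1,2),\qquad \operatorname{dist}\bigl(x^*,\partial\varphi_1(x_1)+\partial\varphi_2(x_2)\bigr)<\varepsilon.$$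
   Context: $\mathbb{R}_\infty:=\mathbb{R}\cup\{+\infty\}$, $\operatorname{dom}\varphi:=\{x\mid\varphi(x)<+\infty\}$; $B_\delta(x)$, $\overline B_\delta(x)$ are the open and closed balls. A Banach space is Asplund if every continuous convex function on an open convex set is Fréchet differentiable on a dense subset. The Fréchet subdifferential of $\varphi$ at $x\in\operatorname{dom}\varphi$ is $$\partial\varphi(x):=\Bigl\{x^*\in X^*\Bigm|\liminf_{u\to x,\,u\ne x}\frac{\varphi(u)-\varphi(x)-\langle x^*,u-x\rangle}{\|u-x\|}\ge0\Bigr\}$$ (empty outside the domain), and $\operatorname{dist}(x^*,\emptyset)=+\infty$. Firm quasiuniform lower semicontinuity: $V\subset X$ is an essentially interior subset of $U\subset X$ if $\bigcup_{x\in V}B_\rho(x)\subset U$ for some $\rho>0$; $EI(U)$ is the collection of all such $V$. With $d(x,y)=\|x-y\|$, for $x_1\in\operatorname{dom}\varphi_1$, $x_2\in\operatorname{dom}\varphi_2$ put $$(\varphi_1\diamondsuit\varphi_2)_U(x_1,x_2):=\inf_{x\in U}\max\{d(x,x_1),\,d(x,x_2),\,(\varphi_1+\varphi_2)(x)-\varphi_1(x_1)-\varphi_2(x_2)\},$$ $$\Theta_U^\dagger(\varphi_1,\varphi_2):=\sup_{V\in EI(U)}\ \limsup_{\substack{d(x_1,x_2)\to0\\ x_1\in\operatorname{dom}\varphi_1\cap V,\,x_2\in\operatorname{dom}\varphi_2\cap V}}(\varphi_1\diamondsuit\varphi_2)_U(x_1,x_2),$$ where the limsup is $\lim_{\eta\downarrow0}$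 of the supremum over such pairs with $d(x_1,x_2)<\eta$, and the supremum over an empty set is $0$. The pair $(\varphi_1,\varphi_2)$ is firmly quasiuniformly lower semicontinuous on $U$ if $\Theta_U^\dagger(\varphi_1,\varphi_2)=0$, and firmly quasiuniformly lower semicontinuous near $\bar x\in\operatorname{dom}\varphi_1\cap\operatorname{dom}\varphi_2$ if it is so on $\overline B_\delta(\bar x)$ for all sufficiently small $\delta>0$. *)

theory Defs
  imports "HOL-Analysis.Analysis" "HOL-Library.Set_Algebras"
begin

text \<open>
  An extended real-valued function \<open>X \<rightarrow> \<real> \<union> {+\<infinity>}\<close> is a function into \<^typ>\<open>ereal\<close> that avoids
  \<open>-\<infinity>\<close>; that condition is stated where the functions are introduced.
  The dual \<open>X*\<close> is \<^typ>\<open>'a::real_normed_vector \<Rightarrow>\<^sub>L real\<close> with the operator norm.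
\<close>

definition edom :: "('a \<Rightarrow> ereal) \<Rightarrow> 'a set" where
  "edom \<phi> = {x. \<phi> x < \<infinity>}"

definition lsc :: "('a::topological_space \<Rightarrow> ereal) \<Rightarrow> bool" where
  "lsc \<phi> \<longleftrightarrow> (\<forall>x. \<phi> x \<le> Liminf (at x) \<phi>)"

definition weakly_converges :: "(nat \<Rightarrow> 'a::real_normed_vector) \<Rightarrow> 'a \<Rightarrow> bool" where
  "weakly_converges s x \<longleftrightarrow> (\<forall>f :: 'a \<Rightarrow>\<^sub>L real. (\<lambda>n. blinfun_apply f (s n)) \<longlonglongrightarrow> blinfun_apply f x)"

definition weakly_seq_lsc :: "('a::real_normed_vector \<Rightarrow> ereal) \<Rightarrow> bool" where
  "weakly_seq_lsc \<phi> \<longleftrightarrow>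
     (\<forall>s x. weakly_converges s x \<longrightarrow> \<phi> x \<le> liminf (\<lambda>n. \<phi> (s n)))"

text \<open>The predicate \<open>differentiable (at x)\<close> is Frechet differentiability, and \<^const>\<open>convex_on\<close>
  includes convexity of the set.\<close>

definition asplund_space :: "'a::banach itself \<Rightarrow> bool" where
  "asplund_space _ \<longleftrightarrow>
     (\<forall>(S :: 'a set) f :: 'a \<Rightarrow> real. open S \<and> convex_on S f \<and> continuous_on S f \<longrightarrow>
        S \<subseteq> closure {x \<in> S. f differentiable (at x)})"

text \<open>Surjectivity of the canonical embedding into the bidual.\<close>

definition reflexive_space :: "'a::banach itself \<Rightarrow> bool" where
  "reflexive_space _ \<longleftrightarrow>
     (\<forall>F :: ('a \<Rightarrow>\<^sub>L real) \<Rightarrow>\<^sub>L real. \<exists>x :: 'a. \<forall>f :: 'a \<Rightarrow>\<^sub>L real.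
        blinfun_apply F f = blinfun_apply f x)"

definition finite_dim_space :: "'a::real_vector itself \<Rightarrow> bool" where
  "finite_dim_space _ \<longleftrightarrow> (\<exists>B :: 'a set. finite B \<and> span B = UNIV)"

definition frechet_subdiff :: "('a::real_normed_vector \<Rightarrow> ereal) \<Rightarrow> 'a \<Rightarrow> ('a \<Rightarrow>\<^sub>L real) set" where
  "frechet_subdiff \<phi> x =
     {y. x \<in> edom \<phi> \<and>
         0 \<le> Liminf (at x) (\<lambda>u. (\<phi> u - \<phi> x - ereal (blinfun_apply y (u - x))) / ereal (norm (u - x)))}"

text \<open>Unlike \<^const>\<open>infdist\<close>, the distance to the empty set is \<open>+\<infinity>\<close>.\<close>

definition edist_set :: "'a::metric_space \<Rightarrow> 'a set \<Rightarrow> ereal" where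
  "edist_set x A = (INF y\<in>A. ereal (dist x y))"

definition EI :: "'a::metric_space set \<Rightarrow> 'a set set" where
  "EI U = {V. V \<subseteq> U \<and> (\<exists>\<rho>>0. (\<Union>x\<in>V. ball x \<rho>) \<subseteq> U)}"

definition diamond ::
  "('a::metric_space \<Rightarrow> ereal) \<Rightarrow> ('a \<Rightarrow> ereal) \<Rightarrow> 'a set \<Rightarrow> 'a \<Rightarrow> 'a \<Rightarrow> ereal" where
  "diamond \<phi>1 \<phi>2 U x1 x2 =
     (INF x\<in>U. Max {ereal (dist x x1), ereal (dist x x2), \<phi>1 x + \<phi>2 x - \<phi>1 x1 - \<phi>2 x2})"

text \<open>Supremum with the convention that the empty set has supremum \<open>0\<close> instead of \<open>-\<infinity>\<close>.\<close>

definition Sup0 :: "ereal set \<Rightarrow> ereal" where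
  "Sup0 A = (if A = {} then 0 else Sup A)"

definition diamond_sup ::
  "('a::metric_space \<Rightarrow> ereal) \<Rightarrow> ('a \<Rightarrow> ereal) \<Rightarrow> 'a set \<Rightarrow> 'a set \<Rightarrow> real \<Rightarrow> ereal" where
  "diamond_sup \<phi>1 \<phi>2 U V \<eta> =
     Sup0 {diamond \<phi>1 \<phi>2 U x1 x2 | x1 x2.
             x1 \<in> edom \<phi>1 \<inter> V \<and> x2 \<in> edom \<phi>2 \<inter> V \<and> dist x1 x2 < \<eta>}"

text \<open>The limit below always exists, see \<open>tendsto_diamond_sup\<close>.\<close>

definition Theta_dagger ::
  "('a::metric_space \<Rightarrow> ereal) \<Rightarrow> ('a \<Rightarrow> ereal) \<Rightarrow> 'a set \<Rightarrow> ereal" where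
  "Theta_dagger \<phi>1 \<phi>2 U = (SUP V\<in>EI U. Lim (at_right 0) (diamond_sup \<phi>1 \<phi>2 U V))"

lemma diamond_nonneg: "0 \<le> diamond \<phi>1 \<phi>2 U x1 x2"
  unfolding diamond_def by (intro INF_greatest) (simp add: le_max_iff_disj)

lemma Sup0_mono:
  assumes "A \<subseteq> B" and "\<And>b. b \<in> B \<Longrightarrow> 0 \<le> b"
  shows "Sup0 A \<le> Sup0 B"
proof (cases "A = {} \<and> B \<noteq> {}")
  case True
  then obtain b where "b \<in> B" by blast
  then show ?thesis using True assms(2)[of b] by (auto simp: Sup0_def intro: Sup_upper2)
next
  case False
  then show ?thesis using assms(1) by (auto simp: Sup0_def intro: Sup_subset_mono)
qed

lemma mono_diamond_sup: "mono (diamond_sup \<phi>1 \<phi>2 U V)"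
  unfolding mono_def diamond_sup_def
  by (intro allI impI Sup0_mono) (auto simp: diamond_nonneg dest: less_le_trans)

lemma tendsto_diamond_sup:
  "(diamond_sup \<phi>1 \<phi>2 U V \<longlongrightarrow> (INF \<eta>\<in>{0<..}. diamond_sup \<phi>1 \<phi>2 U V \<eta>)) (at_right 0)"
proof (rule order_tendstoI)
  fix a assume "a < (INF \<eta>\<in>{0<..}. diamond_sup \<phi>1 \<phi>2 U V \<eta>)"
  then have "a < diamond_sup \<phi>1 \<phi>2 U V \<eta>" if "\<eta> > 0" for \<eta>
    using that by (auto intro: less_le_trans INF_lower)
  then show "\<forall>\<^sub>F \<eta> in at_right 0. a < diamond_sup \<phi>1 \<phi>2 U V \<eta>"
    using eventually_at_right_less[of 0] by (auto elim: eventually_mono)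
next
  fix a assume "(INF \<eta>\<in>{0<..}. diamond_sup \<phi>1 \<phi>2 U V \<eta>) < a"
  then obtain \<eta>0 where "\<eta>0 > 0" "diamond_sup \<phi>1 \<phi>2 U V \<eta>0 < a"
    by (auto simp: INF_less_iff)
  then show "\<forall>\<^sub>F \<eta> in at_right 0. diamond_sup \<phi>1 \<phi>2 U V \<eta> < a"
    by (intro eventually_at_rightI[of 0 \<eta>0])
       (auto intro: le_less_trans[OF monoD[OF mono_diamond_sup]] less_imp_le)
qed

definition firmly_quasi_lsc_on ::
  "('a::metric_space \<Rightarrow> ereal) \<Rightarrow> ('a \<Rightarrow> ereal) \<Rightarrow> 'a set \<Rightarrow> bool" where
  "firmly_quasi_lsc_on \<phi>1 \<phi>2 U \<longleftrightarrow> Theta_dagger \<phi>1 \<phi>2 U = 0"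

definition firmly_quasi_lsc_near ::
  "('a::metric_space \<Rightarrow> ereal) \<Rightarrow> ('a \<Rightarrow> ereal) \<Rightarrow> 'a \<Rightarrow> bool" where
  "firmly_quasi_lsc_near \<phi>1 \<phi>2 x \<longleftrightarrow>
     (\<forall>\<^sub>F \<delta> in at_right 0. firmly_quasi_lsc_on \<phi>1 \<phi>2 (cball x \<delta>))"

end

theory Submission
  imports Defs "HOL-Library.Diagonal_Subsequence"
begin

text \<open>
A point \<open>xbar\<close> with \<open>xs \<in> \<partial>(\<phi>1 + \<phi>2)(xbar)\<close> is, up to a small multiple of the norm, a local minimizer of
\<open>\<phi>1 + \<phi>2 - xs\<close>. Decouple the variable: minimize \<open>\<phi>1(x1) + \<phi>2(x2) - xs(x2)\<close> plus a large penalty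
\<open>r * g(x1 - x2)\<close> over a small ball. Where the remaining terms are differentiable, a minimizer \<open>(x1, x2)\<close>
produces subgradients \<open>p1\<close>, \<open>p2\<close> of \<open>\<phi>1\<close>, \<open>\<phi>2\<close>; the two contributions \<open>- r g'\<close> and \<open>r g'\<close> of the penalty cancel
in \<open>p1 + p2\<close>, so that \<open>p1 + p2\<close> is close to \<open>xs\<close>. Four things have to be supplied.

\<^item> The minimizer has to be near \<open>xbar\<close>. This is the only place where the three alternative hypotheses
  enter: each of them prevents the infimum of the decoupled function over pairs with \<open>norm (x1 - x2) < \<eta>\<close>
  from dropping, in the limit \<open>\<eta> \<rightarrow> 0\<close>, below what the Frechet subgradient inequality for the sum allows
  (\<open>decoupled_bound_firm\<close>, \<open>decoupled_bound_weak\<close>). In the reflexive case the tool is a weakly convergent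
  subsequence of a bounded sequence (\<open>reflexive_weakly_convergent_subseq\<close>).

\<^item> The minimum has to be attained. The variational principle \<open>Borwein_Preiss\<close> adds a small series of
  translates of \<open>g\<close> and produces an exact minimizer.

\<^item> A differentiable \<open>g\<close> comparable to the square of the norm is needed. An Asplund space need not have an
  equivalent norm that is smooth, so \<open>g\<close> is only constructed along a separable closed subspace \<open>Y\<close>
  (\<open>smooth_gauge_exists\<close>). The Asplund property implies that countably many functionals \<open>c n\<close> are dense in
  the dual for the norm of uniform convergence on the unit ball of \<open>Y\<close>
  (\<open>Asplund_dual_separable_on_subspace\<close>). Then \<open>g\<close> is the convex conjugate of
  \<open>\<Theta>(f) = (norm f)^2 + \<Sum> 2^-n f(y n)^2 + \<Sum> 2^-n dist(f, C n)^2\<close>, where positive multiples of the points \<open>y n\<close>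
  are dense in \<open>Y\<close> and \<open>C n\<close> is the convex hull of \<open>0, c 0, \<dots>, c n\<close>: a maximizing sequence for \<open>sup (f(x) - \<Theta>(f))\<close> converges
  pointwise on \<open>Y\<close> by the second term, and the third one forces it to stay near a compact set, which
  upgrades this to norm convergence; and this is differentiability of \<open>g\<close>.

\<^item> Subgradients along \<open>Y\<close> have to be turned into subgradients on the whole space. By the Hahn-Banach theorem
  the existence of a pair of subgradients whose sum is near \<open>xs\<close> is equivalent to inequalities for
  convex combinations of finitely many secants of \<open>(\<phi>1, \<phi>2)\<close>. If one of them is violated somewhere, then
  it is violated, with rational parameters, at finitely many points; adding such points again and again
  gives a countable set \<open>D\<close> with the property that a violation implies one inside \<open>closure D\<close>
  (\<open>separable_determination\<close>). So \<open>Y = closure D\<close> is chosen first, and everything else happens in \<open>Y\<close>.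
\<close>

section \<open>Sublinear functionals and the Hahn-Banach theorem\<close>

definition sublinear :: "('a::real_vector \<Rightarrow> real) \<Rightarrow> bool" where
  "sublinear p \<longleftrightarrow> (\<forall>x y. p (x + y) \<le> p x + p y) \<and> (\<forall>t\<ge>0. \<forall>x. p (t *\<^sub>R x) = t * p x)"

lemma sublinearD:
  assumes "sublinear p"
  shows "p (x + y) \<le> p x + p y" "t \<ge> 0 \<Longrightarrow> p (t *\<^sub>R x) = t * p x" "p 0 = 0" "- p (- x) \<le> p x"
proof -
  show 1: "p (x + y) \<le> p x + p y" for x y using assms by (auto simp: sublinear_def)
  show 2: "t \<ge> 0 \<Longrightarrow> p (t *\<^sub>R x) = t * p x" for t x using assms by (auto simp: sublinear_def)
  show 3: "p 0 = 0" using 2[of 0 0] by simp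
  show "- p (- x) \<le> p x" using 1[of x "-x"] 3 by simp
qed

lemma sublinearI:
  assumes "\<And>x y. p (x + y) \<le> p x + p y"
    and "\<And>t x. t > 0 \<Longrightarrow> p (t *\<^sub>R x) \<le> t * p x" and "p 0 = 0"
  shows "sublinear p"
  unfolding sublinear_def
proof (intro conjI allI impI)
  show "p (x + y) \<le> p x + p y" for x y by fact
  fix t :: real and x assume "t \<ge> 0"
  show "p (t *\<^sub>R x) = t * p x"
  proof (cases "t = 0")
    case False
    then have t: "t > 0" using \<open>t \<ge> 0\<close> by simp
    have "p x = p ((1/t) *\<^sub>R (t *\<^sub>R x))" using t by simp
    also have "\<dots> \<le> (1/t) * p (t *\<^sub>R x)" using t by (intro assms(2)) simp
    finally have "t * p x \<le> p (t *\<^sub>R x)" using t by (simp add: field_simps)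
    then show ?thesis using assms(2)[OF t, of x] by simp
  qed (simp add: assms(3))
qed

text \<open>Zorn's lemma applies since the pointwise infimum of a chain stays finite, by \<open>p x \<ge> - p (- x) \<ge> - q (- x)\<close>, and
is again sublinear: of any two members one lies below the other. Prescribed values on \<open>Y\<close> are needed for
Asplund spaces; \<open>Y = {}\<close> gives the Hahn-Banach theorem.\<close>

lemma minimal_sublinear_exists:
  fixes q :: "'a::real_vector \<Rightarrow> real"
  assumes q: "sublinear q"
  obtains p where "sublinear p" "\<forall>x. p x \<le> q x" "\<forall>y\<in>Y. p y = q y"
    "\<forall>r. sublinear r \<longrightarrow> (\<forall>x. r x \<le> p x) \<longrightarrow> (\<forall>y\<in>Y. r y = q y) \<longrightarrow> r = p"
proof -
  define A where "A = {p. sublinear p \<and> (\<forall>x. p x \<le> q x) \<and> (\<forall>y\<in>Y. p y = q y)}"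
  let ?P = "\<lambda>p r :: 'a \<Rightarrow> real. \<forall>x. r x \<le> p x"
  have "\<exists>m\<in>A. \<forall>a\<in>A. ?P m a \<longrightarrow> a = m"
  proof (rule predicate_Zorn)
    show "partial_order_on A (relation_of ?P A)"
      by (intro partial_order_on_relation_ofI) (auto simp: fun_eq_iff intro: order_trans order_antisym)
  next
    fix C assume C: "C \<in> Chains (relation_of ?P A)"
    then have CA: "C \<subseteq> A" and ch: "\<And>a b. a \<in> C \<Longrightarrow> b \<in> C \<Longrightarrow> ?P a b \<or> ?P b a"
      by (auto simp: Chains_def relation_of_def)
    show "\<exists>u\<in>A. \<forall>a\<in>C. ?P a u"
    proof (cases "C = {}")
      case True
      then show ?thesis using q by (auto simp: A_def)
    next
      case False
      define u where "u x = (INF p\<in>C. p x)" for x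
      have bdd: "bdd_below ((\<lambda>p. p x) ` C)" for x
      proof (rule bdd_belowI2)
        fix p assume "p \<in> C"
        then have "p \<in> A" using CA by auto
        then have "- p (- x) \<le> p x" "p (-x) \<le> q (-x)" using sublinearD(4) by (auto simp: A_def)
        then show "- q (- x) \<le> p x" by linarith
      qed
      have ule: "u x \<le> p x" if "p \<in> C" for p x
        unfolding u_def by (rule cINF_lower[OF bdd that])
      have uge: "a \<le> u x" if "\<And>p. p \<in> C \<Longrightarrow> a \<le> p x" for a x
        unfolding u_def using that False by (intro cINF_greatest) auto
      have "sublinear u"
      proof (rule sublinearI)
        fix x y
        have *: "u (x + y) \<le> p x + r y" if pr: "p \<in> C" "r \<in> C" for p r
        proof -
          obtain s where s: "s \<in> C" "s x \<le> p x" "s y \<le> r y" using ch[OF pr] pr by auto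
          have "sublinear s" using s CA by (auto simp: A_def)
          then show ?thesis using ule[OF s(1), of "x+y"] sublinearD(1)[of s x y] s by linarith
        qed
        have "u (x + y) - r y \<le> u x" if "r \<in> C" for r
          by (rule uge) (use * that in \<open>simp add: diff_le_eq\<close>)
        then have "u (x + y) - u x \<le> u y" by (intro uge) (simp add: algebra_simps)
        then show "u (x + y) \<le> u x + u y" by simp
      next
        fix t :: real and x assume t: "t > 0"
        have "u (t *\<^sub>R x) / t \<le> u x"
        proof (rule uge)
          fix p assume p: "p \<in> C"
          then have "p (t *\<^sub>R x) = t * p x" using CA t sublinearD(2)[of p t x] by (auto simp: A_def)
          then show "u (t *\<^sub>R x) / t \<le> p x" using ule[OF p, of "t *\<^sub>R x"] t by (simp add: field_simps)
        qed
        then show "u (t *\<^sub>R x) \<le> t * u x" using t by (simp add: field_simps)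
      next
        have "p 0 = 0" if "p \<in> C" for p using that CA sublinearD(3)[of p] by (auto simp: A_def)
        then show "u 0 = 0" using uge[of 0 0] ule[of _ 0] False by fastforce
      qed
      moreover have "u x \<le> q x" for x
      proof -
        obtain p where p: "p \<in> C" using False by auto
        then have "p x \<le> q x" using CA by (auto simp: A_def)
        with ule[OF p, of x] show ?thesis by simp
      qed
      moreover have "u y = q y" if "y \<in> Y" for y
      proof -
        have "p y = q y" if "p \<in> C" for p using that CA \<open>y \<in> Y\<close> by (auto simp: A_def)
        then show ?thesis using uge[of "q y" y] ule[of _ y] False by fastforce
      qed
      ultimately have "u \<in> A" by (auto simp: A_def)
      then show ?thesis using ule by auto
    qed
  qed
  then obtain m where m: "m \<in> A" and min: "\<And>a. a \<in> A \<Longrightarrow> \<forall>x. a x \<le> m x \<Longrightarrow> a = m" by auto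
  show ?thesis
  proof
    show "sublinear m" "\<forall>x. m x \<le> q x" "\<forall>y\<in>Y. m y = q y" using m by (auto simp: A_def)
    have "r = m" if "sublinear r" "\<forall>x. r x \<le> m x" "\<forall>y\<in>Y. r y = q y" for r
      using min[of r] that m by (auto simp: A_def intro: order_trans)
    then show "\<forall>r. sublinear r \<longrightarrow> (\<forall>x. r x \<le> m x) \<longrightarrow> (\<forall>y\<in>Y. r y = q y) \<longrightarrow> r = m" by blast
  qed
qed

text \<open>Every linear \<open>f \<le> p\<close> with \<open>f w \<le> s\<close> for all \<open>(w, s)\<close> in the convex cone \<open>K\<close> lies below the infimal convolution
\<open>r\<close> of \<open>p\<close> with \<open>K\<close>, so that linear constraints can be traded for a smaller sublinear majorant. The last
assumption is what keeps \<open>r\<close> from being \<open>-\<infinity>\<close>.\<close>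

lemma constrained_minorant:
  fixes p :: "'a::real_vector \<Rightarrow> real" and K :: "('a \<times> real) set"
  assumes p: "sublinear p"
    and K0: "(0, 0) \<in> K" and Kadd: "\<And>a b. a \<in> K \<Longrightarrow> b \<in> K \<Longrightarrow> a + b \<in> K"
    and Kscale: "\<And>t a. t > 0 \<Longrightarrow> a \<in> K \<Longrightarrow> t *\<^sub>R a \<in> K"
    and low: "\<And>w s. (w, s) \<in> K \<Longrightarrow> 0 \<le> p (- w) + s"
  obtains r where "sublinear r" "\<And>x w s. (w, s) \<in> K \<Longrightarrow> r x \<le> p (x - w) + s"
    "\<And>x a. (\<And>w s. (w, s) \<in> K \<Longrightarrow> a \<le> p (x - w) + s) \<Longrightarrow> a \<le> r x"
proof -
  define r where "r x = (INF (w, s)\<in>K. p (x - w) + s)" for x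
  have bdd: "bdd_below ((\<lambda>(w, s). p (x - w) + s) ` K)" for x
  proof (rule bdd_belowI2, clarify)
    fix w s assume "(w, s) \<in> K"
    then have "0 \<le> p (- w) + s" by (rule low)
    moreover have "p (- w) \<le> p (x - w) + p (- x)" using sublinearD(1)[OF p, of "x - w" "- x"] by simp
    ultimately show "- p (- x) \<le> p (x - w) + s" by linarith
  qed
  have rle: "r x \<le> p (x - w) + s" if "(w, s) \<in> K" for x w s
    unfolding r_def using cINF_lower[OF bdd that, of x] by simp
  have rge: "a \<le> r x" if "\<And>w s. (w, s) \<in> K \<Longrightarrow> a \<le> p (x - w) + s" for x a
    unfolding r_def using K0 that by (intro cINF_greatest) auto
  have "sublinear r"
  proof (rule sublinearI)
    fix x y
    have *: "r (x + y) \<le> (p (x - w) + s) + (p (y - w') + s')" if "(w, s) \<in> K" "(w', s') \<in> K" for w s w' s'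
    proof -
      have "r (x + y) \<le> p ((x + y) - (w + w')) + (s + s')"
        using Kadd[OF that] by (intro rle) simp
      moreover have "p ((x + y) - (w + w')) \<le> p (x - w) + p (y - w')"
        using sublinearD(1)[OF p, of "x - w" "y - w'"] by (simp add: algebra_simps)
      ultimately show ?thesis by linarith
    qed
    have "r (x + y) - (p (y - w') + s') \<le> r x" if "(w', s') \<in> K" for w' s'
      by (rule rge) (use * that in \<open>simp add: diff_le_eq\<close>)
    then have "r (x + y) - r x \<le> r y" by (intro rge) (simp add: algebra_simps)
    then show "r (x + y) \<le> r x + r y" by simp
  next
    fix t :: real and x assume t: "t > 0"
    have "r (t *\<^sub>R x) / t \<le> r x"
    proof (rule rge)
      fix w s assume "(w, s) \<in> K"
      then have "r (t *\<^sub>R x) \<le> p (t *\<^sub>R x - t *\<^sub>R w) + t * s"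
        using Kscale[OF t] by (intro rle) force
      also have "p (t *\<^sub>R x - t *\<^sub>R w) = t * p (x - w)"
        using sublinearD(2)[OF p, of t "x - w"] t by (simp add: algebra_simps)
      finally show "r (t *\<^sub>R x) / t \<le> p (x - w) + s" using t by (simp add: field_simps)
    qed
    then show "r (t *\<^sub>R x) \<le> t * r x" using t by (simp add: field_simps)
  next
    show "r 0 = 0"
      using rle[OF K0, of 0] rge[of 0 0] low sublinearD(3)[OF p] by fastforce
  qed
  then show ?thesis using that rle rge by blast
qed

text \<open>The case of a single constraint.\<close>

lemma ray_constrained_minorant:
  fixes p :: "'a::real_vector \<Rightarrow> real"
  assumes p: "sublinear p" and low: "\<And>t. t \<ge> 0 \<Longrightarrow> 0 \<le> p (- t *\<^sub>R w) + t * s"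
  obtains r where "sublinear r" "\<forall>x. r x \<le> p x" "\<forall>x. r x \<le> p (x - w) + s"
    "\<forall>x a. (\<forall>t\<ge>0. a \<le> p (x - t *\<^sub>R w) + t * s) \<longrightarrow> a \<le> r x"
proof -
  define K where "K = {(t *\<^sub>R w, t * s) | t. t \<ge> 0}"
  obtain r where r: "sublinear r" and rle: "\<And>x v a. (v, a) \<in> K \<Longrightarrow> r x \<le> p (x - v) + a"
    and rge: "\<And>x a. (\<And>v b. (v, b) \<in> K \<Longrightarrow> a \<le> p (x - v) + b) \<Longrightarrow> a \<le> r x"
  proof (rule constrained_minorant[OF p, of K])
    show "(0, 0) \<in> K" by (force simp: K_def)
    show "a + b \<in> K" if ab: "a \<in> K" "b \<in> K" for a b
    proof -
      obtain t u where "a = (t *\<^sub>R w, t * s)" "t \<ge> 0" "b = (u *\<^sub>R w, u * s)" "u \<ge> 0"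
        using ab by (auto simp: K_def)
      then show ?thesis by (auto simp: K_def algebra_simps intro!: exI[of _ "t + u"])
    qed
    show "t *\<^sub>R a \<in> K" if "t > 0" "a \<in> K" for t a
    proof -
      obtain u where "a = (u *\<^sub>R w, u * s)" "u \<ge> 0" using \<open>a \<in> K\<close> by (auto simp: K_def)
      then show ?thesis using \<open>t > 0\<close> by (auto simp: K_def intro!: exI[of _ "t * u"])
    qed
    show "0 \<le> p (- v) + a" if "(v, a) \<in> K" for v a using that low by (auto simp: K_def)
  qed blast
  have K: "(0, 0) \<in> K" "(w, s) \<in> K" by (force simp: K_def intro: exI[of _ 1])+
  show ?thesis
  proof
    show "sublinear r" by fact
    show "\<forall>x. r x \<le> p x" using rle[OF K(1)] by simp
    show "\<forall>x. r x \<le> p (x - w) + s" using rle[OF K(2)] by simp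
    have "a \<le> r x" if "\<forall>t\<ge>0. a \<le> p (x - t *\<^sub>R w) + t * s" for x a
      by (rule rge) (use that in \<open>auto simp: K_def\<close>)
    then show "\<forall>x a. (\<forall>t\<ge>0. a \<le> p (x - t *\<^sub>R w) + t * s) \<longrightarrow> a \<le> r x" by blast
  qed
qed

text \<open>A minimal sublinear \<open>p\<close> is linear: by minimality, imposing the constraint \<open>f z \<le> - p (- z)\<close> does not lower \<open>p\<close>, hence
\<open>p z \<le> - p (- z)\<close>, that is, \<open>p (- z) = - p z\<close>.\<close>

lemma linear_minorant_exists:
  fixes q :: "'a::real_vector \<Rightarrow> real"
  assumes "sublinear q"
  obtains f where "linear f" "\<And>x. f x \<le> q x"
proof -
  obtain p where p: "sublinear p" "\<forall>x. p x \<le> q x"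
    and pmin: "\<forall>r. sublinear r \<longrightarrow> (\<forall>x. r x \<le> p x) \<longrightarrow> (\<forall>y\<in>{}. r y = q y) \<longrightarrow> r = p"
    by (rule minimal_sublinear_exists[OF assms, of "{}"])
  have min: "r = p" if "sublinear r" "\<And>x. r x \<le> p x" for r
    by (rule pmin[rule_format]) (use that in auto)
  have neg: "p (- z) = - p z" for z
  proof -
    obtain r where r: "sublinear r" "\<forall>x. r x \<le> p x" and rz: "\<forall>x. r x \<le> p (x - z) + (- p (- z))"
    proof (rule ray_constrained_minorant[OF p(1), of z "- p (- z)"])
      show "0 \<le> p (- t *\<^sub>R z) + t * (- p (- z))" if "t \<ge> 0" for t
        using sublinearD(2)[OF p(1) that, of "- z"] by simp
    qed
    have "r = p" using min r by blast
    then show ?thesis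
      using rz[rule_format, of z] sublinearD(3)[OF p(1)] sublinearD(4)[OF p(1), of z] by simp
  qed
  have add: "p (x + y) = p x + p y" for x y
    using sublinearD(1)[OF p(1), of x y] sublinearD(1)[OF p(1), of "x + y" "- y"] neg[of y] by simp
  have "p (t *\<^sub>R x) = t * p x" for t x
  proof (cases "t \<ge> 0")
    case False
    then show ?thesis using sublinearD(2)[OF p(1), of "-t" x] neg[of "t *\<^sub>R x"] by simp
  qed (use sublinearD(2)[OF p(1)] in blast)
  with add have "linear p" by (intro linearI) auto
  then show ?thesis using p(2) that by blast
qed

text \<open>The constraint \<open>f \<le> l\<close> on the subspace \<open>Y\<close> amounts to \<open>f = l\<close> there.\<close>

theorem Hahn_Banach_sublinear:
  fixes p :: "'a::real_vector \<Rightarrow> real"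
  assumes p: "sublinear p" and Y: "subspace Y"
    and add: "\<And>x y. x \<in> Y \<Longrightarrow> y \<in> Y \<Longrightarrow> l (x + y) = l x + l y"
    and scale: "\<And>t x. x \<in> Y \<Longrightarrow> l (t *\<^sub>R x) = t * l x"
    and le: "\<And>y. y \<in> Y \<Longrightarrow> l y \<le> p y"
  obtains f where "linear f" "\<And>x. f x \<le> p x" "\<And>y. y \<in> Y \<Longrightarrow> f y = l y"
proof -
  define K where "K = (\<lambda>y. (y, l y)) ` Y"
  have neg: "l (- y) = - l y" if "y \<in> Y" for y using scale[OF that, of "-1"] by simp
  obtain r where r: "sublinear r" and rle: "\<And>x w s. (w, s) \<in> K \<Longrightarrow> r x \<le> p (x - w) + s"
  proof (rule constrained_minorant[OF p, of K])
    show "(0, 0) \<in> K" using subspace_0[OF Y] scale[of 0 0] by (auto simp: K_def image_iff)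
    show "a + b \<in> K" if "a \<in> K" "b \<in> K" for a b
      using that Y add by (auto simp: K_def image_iff subspace_add)
    show "t *\<^sub>R a \<in> K" if "t > 0" "a \<in> K" for t a
      using that Y scale by (auto simp: K_def image_iff subspace_scale)
    show "0 \<le> p (- w) + s" if "(w, s) \<in> K" for w s
      using that le[of "- w"] neg[of w] Y by (auto simp: K_def subspace_neg)
  qed blast
  obtain f where f: "linear f" "\<And>x. f x \<le> r x" using linear_minorant_exists[OF r] by blast
  have "(0, 0) \<in> K" using subspace_0[OF Y] scale[of 0 0] by (auto simp: K_def image_iff)
  then have fp: "f x \<le> p x" for x using rle[of 0 0 x] f(2)[of x] by simp
  have fl: "f y \<le> l y" if "y \<in> Y" for y
    using that rle[of y "l y" y] f(2)[of y] sublinearD(3)[OF p] by (auto simp: K_def)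
  have "f y = l y" if "y \<in> Y" for y
    using fl[OF that] fl[of "- y"] neg[OF that] that Y linear_neg[OF f(1), of y] by (simp add: subspace_neg)
  with f(1) fp show ?thesis using that by blast
qed

lemma sublinear_scaled_norm: "c \<ge> 0 \<Longrightarrow> sublinear (\<lambda>x::'a::real_normed_vector. c * norm x)"
  by (auto simp: sublinear_def distrib_left[symmetric] intro!: mult_left_mono norm_triangle_ineq)

text \<open>A linear function below a multiple of the norm is bounded, since its value at \<open>- x\<close> is bounded as well.\<close>

lemma blinfun_of_norm_bounded:
  fixes f :: "'a::real_normed_vector \<Rightarrow> real"
  assumes "linear f" and c: "c \<ge> 0" "\<And>x. f x \<le> c * norm x"
  obtains F :: "'a \<Rightarrow>\<^sub>L real" where "blinfun_apply F = f" "norm F \<le> c"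
proof -
  have abs: "\<bar>f x\<bar> \<le> c * norm x" for x
    using c(2)[of x] c(2)[of "- x"] linear_neg[OF assms(1), of x] by auto
  then have bl: "bounded_linear f"
    using assms(1) by (intro bounded_linear.intro) (auto simp: bounded_linear_axioms_def mult.commute intro!: exI[of _ c])
  show ?thesis
  proof
    show "blinfun_apply (Blinfun f) = f" using bl by (rule bounded_linear_Blinfun_apply)
    then show "norm (Blinfun f) \<le> c" using abs c by (intro norm_blinfun_bound) auto
  qed
qed

corollary Hahn_Banach_norm:
  fixes l :: "'a::real_normed_vector \<Rightarrow> real"
  assumes Y: "subspace Y" and c: "c \<ge> 0"
    and "\<And>x y. x \<in> Y \<Longrightarrow> y \<in> Y \<Longrightarrow> l (x + y) = l x + l y"
    and "\<And>t x. x \<in> Y \<Longrightarrow> l (t *\<^sub>R x) = t * l x"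
    and "\<And>y. y \<in> Y \<Longrightarrow> l y \<le> c * norm y"
  obtains F :: "'a \<Rightarrow>\<^sub>L real" where "norm F \<le> c" "\<forall>y\<in>Y. F y = l y"
proof -
  obtain f where f: "linear f" "\<And>x. f x \<le> c * norm x" "\<And>y. y \<in> Y \<Longrightarrow> f y = l y"
    using Hahn_Banach_sublinear[OF sublinear_scaled_norm[OF c] Y assms(3-5)] by blast
  from blinfun_of_norm_bounded[OF f(1) c f(2)] f(3) that show ?thesis by metis
qed

text \<open>The constraint \<open>f (- x0) \<le> - p x0\<close> is compatible with \<open>f \<le> p\<close> by homogeneity.\<close>

lemma supporting_functional:
  fixes p :: "'a::real_vector \<Rightarrow> real"
  assumes p: "sublinear p"
  obtains f where "linear f" "\<forall>x. f x \<le> p x" "f x0 = p x0"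
proof -
  obtain r where r: "sublinear r" "\<forall>x. r x \<le> p x" "\<forall>x. r x \<le> p (x - (- x0)) + (- p x0)"
  proof (rule ray_constrained_minorant[OF p, of "- x0" "- p x0"])
    show "0 \<le> p (- t *\<^sub>R (- x0)) + t * (- p x0)" if "t \<ge> 0" for t
      using sublinearD(2)[OF p that, of x0] by simp
  qed
  obtain f where f: "linear f" "\<And>x. f x \<le> r x" using linear_minorant_exists[OF r(1)] by blast
  have le: "f x \<le> p x" for x using f(2)[of x] r(2)[rule_format, of x] by simp
  have "f (- x0) \<le> - p x0" using f(2)[of "- x0"] r(3)[rule_format, of "- x0"] sublinearD(3)[OF p] by simp
  then have "f x0 = p x0" using le[of x0] linear_neg[OF f(1), of x0] by simp
  then show ?thesis using f(1) le that by blast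
qed

corollary norming_functional:
  fixes x :: "'a::real_normed_vector"
  obtains F :: "'a \<Rightarrow>\<^sub>L real" where "norm F \<le> 1" "F x = norm x"
proof -
  have "sublinear (\<lambda>x::'a. 1 * norm x)" by (rule sublinear_scaled_norm) simp
  then obtain f where f: "linear f" "\<forall>z. f z \<le> 1 * norm z" "f x = 1 * norm x" by (rule supporting_functional)
  obtain F :: "'a \<Rightarrow>\<^sub>L real" where "blinfun_apply F = f" "norm F \<le> 1"
    using blinfun_of_norm_bounded[OF f(1), of 1] f(2) by auto
  then show ?thesis using f(3) that by simp
qed

text \<open>Constraining functionals to be at most \<open>0\<close> on \<open>Y\<close> replaces the norm by the distance to \<open>Y\<close>, which is positive
at \<open>x\<close>; a functional that supports it there vanishes on \<open>Y\<close>.\<close>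

corollary separating_functional:
  fixes Y :: "'a::real_normed_vector set"
  assumes Y: "subspace Y" and x: "x \<notin> closure Y"
  obtains F :: "'a \<Rightarrow>\<^sub>L real" where "\<forall>y\<in>Y. F y = 0" "F x \<noteq> 0"
proof -
  define K where "K = (\<lambda>y. (y, 0 :: real)) ` Y"
  have "sublinear (\<lambda>x::'a. 1 * norm x)" by (rule sublinear_scaled_norm) simp
  then have n: "sublinear (norm :: 'a \<Rightarrow> real)" by simp
  obtain r where r: "sublinear r" and rle: "\<And>x w s. (w, s) \<in> K \<Longrightarrow> r x \<le> norm (x - w) + s"
    and rge: "\<And>x a. (\<And>w s. (w, s) \<in> K \<Longrightarrow> a \<le> norm (x - w) + s) \<Longrightarrow> a \<le> r x"
  proof (rule constrained_minorant[OF n, of K])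
    show "(0, 0) \<in> K" using subspace_0[OF Y] by (auto simp: K_def)
    show "a + b \<in> K" if "a \<in> K" "b \<in> K" for a b using that subspace_add[OF Y] by (auto simp: K_def)
    show "t *\<^sub>R a \<in> K" if "t > 0" "a \<in> K" for t a using that subspace_scale[OF Y] by (auto simp: K_def)
    show "0 \<le> norm (- w) + s" if "(w, s) \<in> K" for w s using that by (auto simp: K_def)
  qed blast
  obtain f where f: "linear f" "\<forall>z. f z \<le> r z" "f x = r x" by (rule supporting_functional[OF r])
  obtain e where e: "e > 0" "\<And>y. y \<in> Y \<Longrightarrow> e \<le> dist y x" using x unfolding closure_approachable by (metis not_le)
  have "e \<le> r x" by (rule rge) (use e(2) in \<open>auto simp: K_def dist_norm norm_minus_commute\<close>)
  have "(0, 0) \<in> K" using subspace_0[OF Y] by (auto simp: K_def)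
  then have le: "f z \<le> 1 * norm z" for z using f(2)[rule_format, of z] rle[of 0 0 z] by simp
  have Yle: "f y \<le> 0" if "y \<in> Y" for y using f(2)[rule_format, of y] rle[of y 0 y] that by (simp add: K_def)
  have "f y = 0" if "y \<in> Y" for y
    using Yle[OF that] Yle[OF subspace_neg[OF Y that]] linear_neg[OF f(1), of y] by simp
  moreover obtain F :: "'a \<Rightarrow>\<^sub>L real" where "blinfun_apply F = f"
    using blinfun_of_norm_bounded[OF f(1) _ le] by auto
  ultimately show ?thesis using f(3) e(1) \<open>e \<le> r x\<close> that[of F] by simp
qed

section \<open>Asplund spaces: countably many functionals are dense on a separable subspace\<close>

abbreviation close_on :: "'a::real_normed_vector set \<Rightarrow> real \<Rightarrow> ('a \<Rightarrow>\<^sub>L real) \<Rightarrow> ('a \<Rightarrow>\<^sub>L real) \<Rightarrow> bool" where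
  "close_on Y e f g \<equiv> \<forall>v\<in>Y. \<bar>blinfun_apply f v - blinfun_apply g v\<bar> \<le> e * norm v"

lemma sublinear_Lipschitz_continuous:
  fixes p :: "'a::real_normed_vector \<Rightarrow> real"
  assumes p: "sublinear p" and c: "\<And>x. p x \<le> c * norm x"
  shows "continuous_on UNIV p"
proof -
  have *: "p x - p y \<le> \<bar>c\<bar> * dist x y" for x y
  proof -
    have "p x - p y \<le> p (x - y)" using sublinearD(1)[OF p, of "x - y" y] by simp
    also have "\<dots> \<le> \<bar>c\<bar> * norm (x - y)" using c[of "x - y"] by (smt (verit) mult_right_mono norm_ge_zero)
    finally show ?thesis by (simp add: dist_norm)
  qed
  have "\<bar>c\<bar>-lipschitz_on UNIV p"
    by (rule lipschitz_onI) (use * in \<open>force simp: dist_real_def abs_le_iff dist_commute\<close>)+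
  then show ?thesis by (rule lipschitz_on_continuous_on)
qed

lemma sublinear_convex_on: "sublinear p \<Longrightarrow> convex_on UNIV p"
  unfolding convex_on_def using sublinearD(1,2)[of p] by (smt (verit) convex_UNIV)

text \<open>At a point \<open>x0\<close> where \<open>p\<close> has the Frechet derivative \<open>f\<close>, the functionals below \<open>p\<close> that nearly attain \<open>p x0\<close> form a
set of small diameter around \<open>f\<close>: compare \<open>g (x0 + u) \<le> p (x0 + u)\<close> with the expansion of \<open>p\<close> on a sphere
\<open>norm u = t\<close>.\<close>

lemma Asplund_sublinear_slice:
  fixes p :: "'a::banach \<Rightarrow> real"
  assumes X: "asplund_space TYPE('a)" and p: "sublinear p" and le: "\<And>x. p x \<le> norm x" and e: "e > 0"
  obtains x0 b and f :: "'a \<Rightarrow>\<^sub>L real" where "b < p x0"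
    "\<forall>g h. linear g \<longrightarrow> (\<forall>x. g x \<le> p x) \<longrightarrow> g x0 > b \<longrightarrow> \<bar>g h - f h\<bar> \<le> e * norm h"
proof -
  have cont: "continuous_on UNIV p" using sublinear_Lipschitz_continuous[OF p, of 1] le by simp
  have "(UNIV :: 'a set) \<subseteq> closure {x \<in> UNIV. p differentiable (at x)}"
    using X cont sublinear_convex_on[OF p] unfolding asplund_space_def by blast
  then obtain x0 where "p differentiable (at x0)" using closure_empty by fastforce
  then obtain F where F: "(p has_derivative F) (at x0)" by (auto simp: differentiable_def)
  then have bl: "bounded_linear F" by (rule has_derivative_bounded_linear)
  obtain d where d: "d > 0" and dF: "\<And>y. norm (y - x0) < d \<Longrightarrow> norm (p y - p x0 - F (y - x0)) \<le> e/2 * norm (y - x0)"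
    using F e unfolding has_derivative_at_alt by (metis half_gt_zero)
  define t where "t = d / 2"
  have t: "t > 0" "t < d" using d by (auto simp: t_def)
  show ?thesis
  proof
    show "p x0 - e * t / 2 < p x0" using e t by simp
    have "\<bar>g h - blinfun_apply (Blinfun F) h\<bar> \<le> e * norm h"
      if g: "linear g" "\<And>x. g x \<le> p x" "g x0 > p x0 - e * t / 2" for g :: "'a \<Rightarrow> real" and h
    proof -
    have one: "g h - F h \<le> e * norm h" for h
    proof (cases "h = 0")
      case True then show ?thesis using linear_0[OF g(1)] linear_0[OF bounded_linear.linear[OF bl]] by simp
    next
      case False
      define u where "u = (t / norm h) *\<^sub>R h"
      have nu: "norm u = t" using False t by (simp add: u_def)
      have "g x0 + g u \<le> p (x0 + u)" using g(2)[of "x0 + u"] linear_add[OF g(1)] by simp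
      moreover have "\<bar>p (x0 + u) - p x0 - F u\<bar> \<le> e / 2 * t" using dF[of "x0 + u"] nu t by simp
      ultimately have "g u - F u \<le> e * t" using g(3) by linarith
      then have "(t / norm h) * (g h - F h) \<le> e * t"
        using linear_cmul[OF g(1)] linear_cmul[OF bounded_linear.linear[OF bl]] by (simp add: u_def right_diff_distrib)
      then have "t * (g h - F h) \<le> t * (e * norm h)" using False by (simp add: field_simps)
      then show ?thesis using t by (simp only: mult_le_cancel_left_pos)
    qed
    show ?thesis
      using one[of h] one[of "- h"] linear_neg[OF g(1)] linear_neg[OF bounded_linear.linear[OF bl]]
      by (simp add: bounded_linear_Blinfun_apply[OF bl] abs_le_iff)
    qed
    then show "\<forall>g h. linear g \<longrightarrow> (\<forall>x. g x \<le> p x) \<longrightarrow> g x0 > p x0 - e * t / 2 \<longrightarrow>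
      \<bar>g h - blinfun_apply (Blinfun F) h\<bar> \<le> e * norm h" by blast
  qed
qed

lemma sup_of_functionals:
  fixes A :: "('a::real_normed_vector \<Rightarrow>\<^sub>L real) set"
  assumes "A \<noteq> {}" and ball: "\<forall>f\<in>A. norm f \<le> 1"
  defines "q \<equiv> \<lambda>x. SUP f\<in>A. blinfun_apply f x"
  shows "sublinear q" "q x \<le> norm x" "f \<in> A \<Longrightarrow> f x \<le> q x" "c < q x \<Longrightarrow> \<exists>f\<in>A. c < f x"
proof -
  have fx: "f x \<le> norm x" if "f \<in> A" for f x
    using norm_blinfun[of f x] ball that by (smt (verit) mult_left_le_one_le norm_ge_zero real_norm_def)
  have bdd: "bdd_above ((\<lambda>f. blinfun_apply f x) ` A)" for x using fx by (rule bdd_aboveI2)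
  show up: "f x \<le> q x" if "f \<in> A" for f x unfolding q_def using bdd that by (rule cSUP_upper[rotated])
  have least: "q x \<le> c" if "\<And>f. f \<in> A \<Longrightarrow> f x \<le> c" for x c
    unfolding q_def using assms(1) that by (rule cSUP_least)
  show "q x \<le> norm x" by (rule least) (rule fx)
  show "c < q x \<Longrightarrow> \<exists>f\<in>A. c < f x" using least[of x c] by force
  show "sublinear q"
  proof (rule sublinearI)
    show "q (x + y) \<le> q x + q y" for x y by (rule least) (simp add: blinfun.add_right add_mono up)
    show "q (t *\<^sub>R x) \<le> t * q x" if "t > 0" for t x
      by (rule least) (use that in \<open>simp add: blinfun.scaleR_right up\<close>)
    show "q 0 = 0" unfolding q_def using assms(1) by simp
  qed
qed

text \<open>The existence of small slices passes to a subspace \<open>Y\<close>. Among the sublinear functionals that agree on \<open>Y\<close> with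
the support functional \<open>q\<close> of \<open>A\<close>, choose a minimal one, \<open>p\<close>. It has a small slice \<open>{g \<le> p. g x0 > b}\<close>, possibly
with \<open>x0\<close> outside \<open>Y\<close>. Constraining functionals to \<open>g x0 \<le> b\<close> lowers \<open>p\<close>, so by minimality
it lowers the support functional at some \<open>y \<in> Y\<close>. Hence every functional near the top of \<open>A\<close> in the direction \<open>y\<close>, if
extended from \<open>Y\<close> below \<open>p\<close>, falls into the slice.\<close>

lemma Asplund_subspace_slice:
  fixes A :: "('a::banach \<Rightarrow>\<^sub>L real) set"
  assumes X: "asplund_space TYPE('a)" and A: "A \<noteq> {}" "\<forall>f\<in>A. norm f \<le> 1"
    and Y: "subspace Y" and e: "e > 0"
  obtains y c where "y \<in> Y" "\<exists>a\<in>A. a y > c"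
    "\<forall>a\<in>A. \<forall>b\<in>A. blinfun_apply a y > c \<longrightarrow> blinfun_apply b y > c \<longrightarrow>
      close_on Y e a b"
proof -
  define q where "q x = (SUP f\<in>A. blinfun_apply f x)" for x
  note q = sup_of_functionals[OF A, folded q_def]
  obtain p where p: "sublinear p" "\<forall>x. p x \<le> q x" and pY: "\<forall>y\<in>Y. p y = q y"
    and min: "\<forall>r. sublinear r \<longrightarrow> (\<forall>x. r x \<le> p x) \<longrightarrow> (\<forall>y\<in>Y. r y = q y) \<longrightarrow> r = p"
    by (rule minimal_sublinear_exists[OF q(1), of Y])
  obtain x0 b and f :: "'a \<Rightarrow>\<^sub>L real" where b: "b < p x0" and
    slice: "\<forall>g h. linear g \<longrightarrow> (\<forall>x. g x \<le> p x) \<longrightarrow> g x0 > b \<longrightarrow> \<bar>g h - f h\<bar> \<le> e/2 * norm h"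
    by (rule Asplund_sublinear_slice[OF X p(1) order_trans[OF spec[OF p(2)] q(2)] half_gt_zero[OF e]])
  have "\<exists>y\<in>Y. \<exists>t\<ge>0. p (y - t *\<^sub>R x0) + t * b < q y"
  proof (rule ccontr)
    assume "\<not> ?thesis"
    then have ge: "q y \<le> p (y - t *\<^sub>R x0) + t * b" if "y \<in> Y" "t \<ge> 0" for y t using that by force
    obtain r where r: "sublinear r" and rp: "\<forall>x. r x \<le> p x" and rx: "\<forall>x. r x \<le> p (x - x0) + b"
      and rge: "\<forall>x a. (\<forall>t\<ge>0. a \<le> p (x - t *\<^sub>R x0) + t * b) \<longrightarrow> a \<le> r x"
    proof (rule ray_constrained_minorant[OF p(1), of x0 b])
      show "0 \<le> p (- t *\<^sub>R x0) + t * b" if "t \<ge> 0" for t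
        using ge[OF subspace_0[OF Y] that] sublinearD(3)[OF q(1)] by simp
    qed
    have "r y = q y" if "y \<in> Y" for y
    proof -
      have "q y \<le> r y" using rge ge[OF that] by blast
      then show ?thesis using rp[rule_format, of y] pY that by simp
    qed
    then have "r = p" using r rp by (intro min[rule_format]) auto
    then show False using rx[rule_format, of x0] b sublinearD(3)[OF p(1)] by simp
  qed
  then obtain y t where y: "y \<in> Y" and t: "t \<ge> 0" and yt: "p (y - t *\<^sub>R x0) + t * b < q y" by blast
  define c where "c = p (y - t *\<^sub>R x0) + t * b"
  have near: "\<bar>a v - f v\<bar> \<le> e/2 * norm v" if a: "a \<in> A" "a y > c" and v: "v \<in> Y" for a v
  proof -
    obtain g where g: "linear g" "\<And>x. g x \<le> p x" and gY: "\<And>y. y \<in> Y \<Longrightarrow> g y = a y"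
      using Hahn_Banach_sublinear[OF p(1) Y, of "blinfun_apply a"] q(3)[OF a(1)] pY
      by (metis blinfun.add_right blinfun.scaleR_right real_scaleR_def)
    have "a y = g (y - t *\<^sub>R x0) + t * g x0"
      using gY[OF y] linear_diff[OF g(1)] linear_cmul[OF g(1)] by simp
    then have "t * b < t * g x0" using a(2) g(2)[of "y - t *\<^sub>R x0"] by (simp add: c_def)
    then have "b < g x0" using t by (simp add: mult_less_cancel_left)
    then have "\<bar>g v - f v\<bar> \<le> e/2 * norm v" using slice g by blast
    then show ?thesis using gY[OF v] by simp
  qed
  show ?thesis
  proof
    show "y \<in> Y" by fact
    show "\<exists>a\<in>A. a y > c" using q(4)[of c y] yt by (simp add: c_def)
    have "\<bar>a v - b v\<bar> \<le> e * norm v" if "a \<in> A" "b \<in> A" "a y > c" "b y > c" "v \<in> Y" for a b v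
      using near[of a v] near[of b v] that by linarith
    then show "\<forall>a\<in>A. \<forall>b\<in>A. blinfun_apply a y > c \<longrightarrow> blinfun_apply b y > c \<longrightarrow> close_on Y e a b" by blast
  qed
qed

text \<open>Slices of the ball given by a point of \<open>D\<close> and a rational level form a countable family that is as good as all
slices by points of \<open>Y\<close>. Remove from the ball all those that have a countable net. If functionals
remained, then the remaining set would have a small slice, and a slice of the family inside it would
consist of functionals that were removed and of others within \<open>e\<close> of a single one; so it would have
been removed too.\<close>

lemma countable_net_of_unit_ball_on_subspace:
  fixes D :: "'a::banach set"
  assumes X: "asplund_space TYPE('a)" and D: "countable D" and Y: "subspace Y" "Y \<subseteq> closure D" and e: "e > 0"
  obtains C :: "('a \<Rightarrow>\<^sub>L real) set" where "countable C"
    "\<forall>f :: 'a \<Rightarrow>\<^sub>L real. norm f \<le> 1 \<longrightarrow> (\<exists>c\<in>C. close_on Y e f c)"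
proof -
  define B where "B = {f :: 'a \<Rightarrow>\<^sub>L real. norm f \<le> 1}"
  define cov where "cov S \<longleftrightarrow> (\<exists>C :: ('a \<Rightarrow>\<^sub>L real) set. countable C \<and>
    (\<forall>f\<in>S. \<exists>c\<in>C. close_on Y e f c))" for S
  define S where "S d r = {f\<in>B. blinfun_apply f d > real_of_rat r}" for d r
  define G where "G = (\<Union>(d, r)\<in>{(d, r). d \<in> D \<and> cov (S d r)}. S d r)"
  have cov_UN: "cov (\<Union>i\<in>I. T i)" if I: "countable I" and T: "\<And>i. i \<in> I \<Longrightarrow> cov (T i)" for I :: "('a \<times> rat) set" and T
  proof -
    obtain C where "\<And>i. i \<in> I \<Longrightarrow> countable (C i) \<and> (\<forall>f\<in>T i. \<exists>c\<in>C i. close_on Y e f c)"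
      using T unfolding cov_def by metis
    then have C: "\<And>i. i \<in> I \<Longrightarrow> countable (C i)"
      "\<And>i f. i \<in> I \<Longrightarrow> f \<in> T i \<Longrightarrow> \<exists>c\<in>C i. close_on Y e f c" by auto
    show ?thesis
      unfolding cov_def
    proof (intro exI[of _ "\<Union>i\<in>I. C i"] conjI ballI)
      show "countable (\<Union>i\<in>I. C i)" using I C(1) by (rule countable_UN)
      fix f assume "f \<in> (\<Union>i\<in>I. T i)"
      then obtain i where i: "i \<in> I" "f \<in> T i" by blast
      from C(2)[OF this] i(1) show "\<exists>c\<in>\<Union>i\<in>I. C i. close_on Y e f c" by (meson UN_I)
    qed
  qed
  have covG: "cov G"
  proof -
    have "countable {(d, r). d \<in> D \<and> cov (S d r)}"
      by (rule countable_subset[of _ "D \<times> UNIV"]) (use D in auto)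
    then show ?thesis unfolding G_def by (rule cov_UN) auto
  qed
  have "B \<subseteq> G"
  proof (rule ccontr)
    assume "\<not> B \<subseteq> G"
    then have A: "B - G \<noteq> {}" "\<forall>f\<in>B - G. norm f \<le> 1" by (auto simp: B_def)
    obtain y c where y: "y \<in> Y" "\<exists>a\<in>B - G. a y > c"
      and sl: "\<forall>a\<in>B - G. \<forall>b\<in>B - G. blinfun_apply a y > c \<longrightarrow> blinfun_apply b y > c \<longrightarrow> close_on Y e a b"
      using Asplund_subspace_slice[OF X A Y(1) e] by blast
    then obtain a where a: "a \<in> B - G" "a y > c" by blast
    define \<eta> where "\<eta> = (a y - c) / 4"
    have \<eta>: "\<eta> > 0" using a by (simp add: \<eta>_def)
    have "y \<in> closure D" using y(1) Y(2) by blast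
    then obtain d where d: "d \<in> D" "dist d y < \<eta>" using \<eta> by (auto simp: closure_approachable)
    have dy: "\<bar>f d - f y\<bar> < \<eta>" if "f \<in> B" for f
    proof -
      have "\<bar>f d - f y\<bar> \<le> norm f * norm (d - y)" using norm_blinfun[of f "d - y"] by (simp add: blinfun.diff_right)
      also have "\<dots> \<le> 1 * norm (d - y)" using that by (intro mult_right_mono) (auto simp: B_def)
      finally show ?thesis using d by (simp add: dist_norm)
    qed
    obtain r where r: "c + \<eta> < real_of_rat r" "real_of_rat r < c + 2 * \<eta>" using of_rat_dense[of "c + \<eta>" "c + 2 * \<eta>"] \<eta> by auto
    have "real_of_rat r < a d" proof -
      have "a y = c + 4 * \<eta>" by (simp add: \<eta>_def field_simps)
      moreover have "\<bar>a d - a y\<bar> < \<eta>" using a dy[of a] by simp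
      ultimately show ?thesis using r by linarith
    qed
    then have "a \<in> S d r" using a by (simp add: S_def)
    have sub: "f y > c" if "f \<in> S d r" for f using that dy[of f] r by (auto simp: S_def abs_less_iff)
    from covG obtain C where C: "countable C" "\<And>f. f \<in> G \<Longrightarrow> \<exists>c\<in>C. close_on Y e f c"
      unfolding cov_def by blast
    have "cov (S d r)"
      unfolding cov_def
    proof (intro exI[of _ "insert a C"] conjI ballI)
      fix f assume f: "f \<in> S d r"
      show "\<exists>c\<in>insert a C. close_on Y e f c"
      proof (cases "f \<in> G")
        case False
        then have "f \<in> B - G" using f by (auto simp: S_def)
        then show ?thesis using sl a sub[OF f] by (intro bexI[of _ a]) auto
      qed (use C(2) in blast)
    qed (use C in simp)
    then have "a \<in> G" using \<open>a \<in> S d r\<close> d(1) by (auto simp: G_def)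
    then show False using a by blast
  qed
  then show ?thesis using covG that unfolding cov_def B_def by blast
qed

theorem Asplund_dual_separable_on_subspace:
  fixes D :: "'a::banach set"
  assumes X: "asplund_space TYPE('a)" and D: "countable D" and Y: "subspace Y" "Y \<subseteq> closure D"
  obtains C :: "nat \<Rightarrow> 'a \<Rightarrow>\<^sub>L real" where
    "\<forall>f. \<forall>e>0. \<exists>n. \<forall>v\<in>Y. \<bar>blinfun_apply f v - C n v\<bar> \<le> e * norm v"
proof -
  define dense where "dense n C \<longleftrightarrow> countable C \<and>
    (\<forall>f :: 'a \<Rightarrow>\<^sub>L real. norm f \<le> 1 \<longrightarrow>
      (\<exists>c\<in>C. close_on Y (inverse (real (Suc n))) f c))"
    for n and C :: "('a \<Rightarrow>\<^sub>L real) set"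
  have "\<exists>C. dense n C" for n
  proof -
    have "inverse (real (Suc n)) > 0" by simp
    then show ?thesis
      by (rule countable_net_of_unit_ball_on_subspace[OF X D Y]) (unfold dense_def, intro exI conjI)
  qed
  then obtain C where C0: "\<And>n. dense n (C n)" by metis
  have C: "countable (C n)"
    "norm f \<le> 1 \<Longrightarrow> \<exists>c\<in>C n. close_on Y (inverse (real (Suc n))) f c" for n f
    using C0[of n] unfolding dense_def by auto
  define E where "E = (\<Union>n m. (\<lambda>c. real (Suc m) *\<^sub>R c) ` C n)"
  have "countable E" unfolding E_def using C(1) by auto
  have E: "\<exists>c\<in>E. close_on Y e f c" if e: "e > 0" for f :: "'a \<Rightarrow>\<^sub>L real" and e
  proof -
    obtain m where m: "norm f < real m" using reals_Archimedean2 by blast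
    define k where "k = real (Suc m)"
    have k: "k > 0" "norm f \<le> k" using m by (simp_all add: k_def)
    obtain n where n: "inverse (real (Suc n)) < e / k" using reals_Archimedean[OF divide_pos_pos[OF e k(1)]] by blast
    have "norm ((1/k) *\<^sub>R f) \<le> 1" using k by (simp add: divide_le_eq_1)
    from C(2)[OF this, of n] obtain c where c: "c \<in> C n"
      "close_on Y (inverse (real (Suc n))) ((1/k) *\<^sub>R f) c" by blast
    have "\<bar>f v - (k *\<^sub>R c) v\<bar> \<le> e * norm v" if "v \<in> Y" for v
    proof -
      have "\<bar>f v - (k *\<^sub>R c) v\<bar> = k * \<bar>((1/k) *\<^sub>R f) v - c v\<bar>"
      proof -
        have "f v - (k *\<^sub>R c) v = k * (((1/k) *\<^sub>R f) v - c v)" using k by (simp add: blinfun.scaleR_left right_diff_distrib)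
        then show ?thesis using k by (simp add: abs_mult)
      qed
      also have "\<dots> \<le> k * (inverse (real (Suc n)) * norm v)" by (rule mult_left_mono[OF bspec[OF c(2) that]]) (use k in simp)
      also have "\<dots> \<le> k * (e / k * norm v)"
        using mult_right_mono[OF less_imp_le[OF n] norm_ge_zero[of v]] k by (simp only: mult_le_cancel_left_pos)
      finally show ?thesis using k by simp
    qed
    then show ?thesis using c(1) by (intro bexI[of _ "k *\<^sub>R c"]) (auto simp: E_def k_def)
  qed
  have "E \<noteq> {}" using E[of 1 0] by auto
  then have ran: "range (from_nat_into E) = E" using \<open>countable E\<close> by (rule range_from_nat_into)
  show ?thesis
  proof
    have "\<exists>n. close_on Y e f (from_nat_into E n)" if "e > 0" for f :: "'a \<Rightarrow>\<^sub>L real" and e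
    proof -
    from that obtain c where "c \<in> E" "close_on Y e f c" using E by blast
    moreover from this(1) obtain n where "from_nat_into E n = c" using ran by (metis rangeE)
    ultimately show ?thesis by blast
    qed
    then show "\<forall>f. \<forall>e>0. \<exists>n. close_on Y e f (from_nat_into E n)" by blast
  qed
qed

section \<open>Conjugates of uniformly convex dual energies\<close>

text \<open>The functions \<open>s n\<close> stand for two kinds of terms, evaluations at points and distances to convex sets. Squares
appear in \<open>s_mid\<close> because evaluations are linear but of either sign, while distances are convex and
nonnegative.\<close>

locale dual_energy =
  fixes s :: "nat \<Rightarrow> ('a::real_normed_vector \<Rightarrow>\<^sub>L real) \<Rightarrow> real"
  assumes s_le: "\<bar>s n f\<bar> \<le> norm f"
    and s_mid: "(s n ((1/2) *\<^sub>R (f + g)))\<^sup>2 \<le> ((s n f + s n g) / 2)\<^sup>2"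
begin

definition energy :: "('a \<Rightarrow>\<^sub>L real) \<Rightarrow> real" where
  "energy f = (norm f)\<^sup>2 + (\<Sum>n. (1/2)^Suc n * (s n f)\<^sup>2)"

definition energy_conj :: "'a \<Rightarrow> real" where
  "energy_conj x = (SUP f. blinfun_apply f x - energy f)"

lemma s_sq_le: "(s n f)\<^sup>2 \<le> (norm f)\<^sup>2"
  using power_mono[OF s_le[of n f], of 2] by simp

lemma summable_s: "summable (\<lambda>n. (1/2)^Suc n * (s n f)\<^sup>2)"
proof (rule summable_comparison_test')
  show "summable (\<lambda>n. (1/2::real)^Suc n * (norm f)\<^sup>2)"
    using sums_summable[OF power_half_series] by (rule summable_mult2)
  show "norm ((1/2)^Suc n * (s n f)\<^sup>2) \<le> (1/2)^Suc n * (norm f)\<^sup>2" for n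
    using s_sq_le[of n f] by (simp add: mult_left_mono del: power_Suc)
qed

lemma energy_ge: "(norm f)\<^sup>2 + (\<Sum>n<N. (1/2)^Suc n * (s n f)\<^sup>2) \<le> energy f"
  unfolding energy_def using sum_le_suminf[OF summable_s, of "{..<N}" f] by simp

lemma energy_ge_norm: "(norm f)\<^sup>2 \<le> energy f"
  using energy_ge[of f 0] by simp

lemma energy_le: "energy f \<le> 2 * (norm f)\<^sup>2"
proof -
  have "(\<Sum>n. (1/2)^Suc n * (s n f)\<^sup>2) \<le> (\<Sum>n. (1/2)^Suc n * (norm f)\<^sup>2)"
  proof (rule suminf_le)
    show "(1/2)^Suc n * (s n f)\<^sup>2 \<le> (1/2)^Suc n * (norm f)\<^sup>2" for n
      using s_sq_le by (intro mult_left_mono) auto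
    show "summable (\<lambda>n. (1/2::real)^Suc n * (norm f)\<^sup>2)"
      using sums_summable[OF power_half_series] by (rule summable_mult2)
  qed (rule summable_s)
  also have "\<dots> = (norm f)\<^sup>2"
    using sums_unique[OF sums_mult2[OF power_half_series, of "(norm f)\<^sup>2"]] by simp
  finally show ?thesis by (simp add: energy_def)
qed

text \<open>The parallelogram law, termwise.\<close>

lemma energy_midpoint:
  "energy ((1/2) *\<^sub>R (f + g)) + (norm f - norm g)\<^sup>2 / 4 + (1/2)^Suc n * (s n f - s n g)\<^sup>2 / 4
    \<le> (energy f + energy g) / 2"
proof -
  let ?m = "(1/2) *\<^sub>R (f + g)"
  have sq: "((a + b) / 2)\<^sup>2 = (a\<^sup>2 + b\<^sup>2) / 2 - (a - b)\<^sup>2 / 4" for a b :: real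
    by (simp add: power2_eq_square field_simps)
  have "norm ?m \<le> (norm f + norm g) / 2" using norm_triangle_ineq[of f g] by simp
  then have N: "(norm ?m)\<^sup>2 \<le> ((norm f)\<^sup>2 + (norm g)\<^sup>2) / 2 - (norm f - norm g)\<^sup>2 / 4"
    unfolding sq[symmetric] by (intro power_mono) auto
  define t where "t k = (1/2)^Suc k * (((s k f)\<^sup>2 + (s k g)\<^sup>2) / 2 - (s k ?m)\<^sup>2)" for k
  have t_ge: "(1/2)^Suc k * (s k f - s k g)\<^sup>2 / 4 \<le> t k" for k
  proof -
    have "(s k f - s k g)\<^sup>2 / 4 \<le> ((s k f)\<^sup>2 + (s k g)\<^sup>2) / 2 - (s k ?m)\<^sup>2"
      using s_mid[of k f g] unfolding sq by linarith
    then show ?thesis using mult_left_mono[of "(s k f - s k g)\<^sup>2 / 4" _ "(1/2)^Suc k"] unfolding t_def by simp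
  qed
  have t_eq: "t = (\<lambda>k. ((1/2)^Suc k * (s k f)\<^sup>2 + (1/2)^Suc k * (s k g)\<^sup>2) / 2 - (1/2)^Suc k * (s k ?m)\<^sup>2)"
    by (rule ext) (simp add: t_def field_simps)
  have sums: "(\<lambda>k. ((1/2)^Suc k * (s k f)\<^sup>2 + (1/2)^Suc k * (s k g)\<^sup>2) / 2 - (1/2)^Suc k * (s k ?m)\<^sup>2) sums
      (((\<Sum>k. (1/2)^Suc k * (s k f)\<^sup>2) + (\<Sum>k. (1/2)^Suc k * (s k g)\<^sup>2)) / 2 - (\<Sum>k. (1/2)^Suc k * (s k ?m)\<^sup>2))"
    by (intro sums_diff sums_divide sums_add summable_sums summable_s)
  then have "t sums (((\<Sum>k. (1/2)^Suc k * (s k f)\<^sup>2) + (\<Sum>k. (1/2)^Suc k * (s k g)\<^sup>2)) / 2 - (\<Sum>k. (1/2)^Suc k * (s k ?m)\<^sup>2))"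
    unfolding t_eq .
  moreover have "t n \<le> suminf t"
  proof -
    have "0 \<le> t k" for k by (rule order_trans[OF _ t_ge]) simp
    then show ?thesis using sum_le_suminf[OF sums_summable[OF calculation], of "{n}"] by simp
  qed
  ultimately have "t n \<le> ((\<Sum>k. (1/2)^Suc k * (s k f)\<^sup>2) + (\<Sum>k. (1/2)^Suc k * (s k g)\<^sup>2)) / 2 - (\<Sum>k. (1/2)^Suc k * (s k ?m)\<^sup>2)"
    by (simp add: sums_iff)
  then show ?thesis using N t_ge[of n] unfolding energy_def by argo
qed

lemma eval_minus_energy_le: "blinfun_apply f x - energy f \<le> (norm x)\<^sup>2 / 4"
proof -
  have "f x \<le> norm f * norm x" using norm_blinfun[of f x] by simp
  moreover have "0 \<le> (norm x / 2 - norm f)\<^sup>2" by simp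
  then have "norm f * norm x - (norm f)\<^sup>2 \<le> (norm x)\<^sup>2 / 4" by (simp add: power2_eq_square field_simps)
  ultimately show ?thesis using energy_ge_norm[of f] by linarith
qed

lemma bdd_eval_minus_energy: "bdd_above (range (\<lambda>f. blinfun_apply f x - energy f))"
  by (rule bdd_aboveI2[OF eval_minus_energy_le])

lemma energy_conj_upper: "blinfun_apply f x - energy f \<le> energy_conj x"
  unfolding energy_conj_def by (rule cSUP_upper[OF UNIV_I bdd_eval_minus_energy])

lemma energy_conj_le: "energy_conj x \<le> (norm x)\<^sup>2 / 4"
  unfolding energy_conj_def by (rule cSUP_least[OF UNIV_not_empty eval_minus_energy_le])

lemma energy_conj_near: "c < energy_conj x \<Longrightarrow> \<exists>f. c < blinfun_apply f x - energy f"
  unfolding energy_conj_def using less_cSUP_iff[OF UNIV_not_empty bdd_eval_minus_energy] by blast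

text \<open>Tested with a multiple of a norming functional; the factor \<open>1/4\<close> maximizes \<open>t * norm x - 2 * t^2\<close>.\<close>

lemma energy_conj_ge: "(norm x)\<^sup>2 / 8 \<le> energy_conj x"
proof -
  obtain F :: "'a \<Rightarrow>\<^sub>L real" where F: "norm F \<le> 1" "F x = norm x" by (rule norming_functional)
  let ?f = "(norm x / 4) *\<^sub>R F"
  have "norm ?f \<le> norm x / 4" using F(1) by (simp add: mult_left_le)
  then have "(norm ?f)\<^sup>2 \<le> (norm x / 4)\<^sup>2" by (intro power_mono) auto
  then have "energy ?f \<le> 2 * (norm x / 4)\<^sup>2" using energy_le[of ?f] by linarith
  moreover have "?f x = norm x / 4 * norm x" using F(2) by (simp add: blinfun.scaleR_left)
  ultimately have "(norm x)\<^sup>2 / 8 \<le> ?f x - energy ?f" by (simp add: power2_eq_square)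
  then show ?thesis using energy_conj_upper[of ?f x] by linarith
qed

lemma energy_conj_nonneg: "0 \<le> energy_conj x"
  using energy_conj_ge[of x] zero_le_power2[of "norm x"] by linarith

lemma near_maximizer_norm:
  assumes "energy_conj x - e \<le> blinfun_apply f x - energy f" and "e \<le> 1"
  shows "norm f \<le> norm x + 1"
proof (rule ccontr)
  assume "\<not> norm f \<le> norm x + 1"
  then have n: "norm f - norm x > 1" "norm f > 1" using norm_ge_zero[of x] by linarith+
  have "f x \<le> norm f * norm x" using norm_blinfun[of f x] by simp
  then have "norm f * norm f - norm f * norm x \<le> 1"
    using assms energy_ge_norm[of f] energy_conj_nonneg[of x] unfolding power2_eq_square by linarith
  then have "norm f * (norm f - norm x) \<le> 1" by (simp add: right_diff_distrib)
  moreover have "1 * 1 < norm f * (norm f - norm x)" using n by (intro mult_strict_mono) auto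
  ultimately show False by simp
qed

lemma maximizer_norm:
  assumes "energy_conj x \<le> blinfun_apply f x - energy f"
  shows "norm f \<le> norm x"
proof (rule ccontr)
  assume n: "\<not> norm f \<le> norm x"
  have "f x \<le> norm f * norm x" using norm_blinfun[of f x] by simp
  also have "\<dots> < norm f * norm f" using n norm_ge_zero[of x] by (intro mult_strict_left_mono) linarith+
  finally show False using assms energy_ge_norm[of f] energy_conj_nonneg[of x] unfolding power2_eq_square by linarith
qed

text \<open>Uniform convexity: the midpoint of two near maximizers cannot exceed the supremum.\<close>

lemma near_maximizers_close:
  assumes f: "energy_conj x - e \<le> blinfun_apply f x - energy f" and g: "energy_conj x - e \<le> blinfun_apply g x - energy g"
  shows "(norm f - norm g)\<^sup>2 \<le> 4 * e" "(s n f - s n g)\<^sup>2 \<le> 4 * 2^Suc n * e"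
proof -
  let ?m = "(1/2) *\<^sub>R (f + g)"
  have "?m x = (f x + g x) / 2" by (simp add: blinfun.scaleR_left blinfun.add_left)
  then have *: "(norm f - norm g)\<^sup>2 / 4 + (1/2)^Suc n * (s n f - s n g)\<^sup>2 / 4 \<le> e"
    using energy_conj_upper[of ?m x] energy_midpoint[of f g n] f g by argo
  have "0 \<le> (1/2)^Suc n * (s n f - s n g)\<^sup>2 / 4" by simp
  with * show "(norm f - norm g)\<^sup>2 \<le> 4 * e" by linarith
  have "(1/2)^Suc n * (s n f - s n g)\<^sup>2 \<le> 4 * e" using * zero_le_power2[of "norm f - norm g"] by linarith
  then have "2^Suc n * ((1/2)^Suc n * (s n f - s n g)\<^sup>2) \<le> 2^Suc n * (4 * e)" by (rule mult_left_mono) simp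
  then show "(s n f - s n g)\<^sup>2 \<le> 4 * 2^Suc n * e"
    by (simp add: mult.assoc[symmetric] power_mult_distrib[symmetric] del: power_Suc)
qed

lemma energy_conj_diff_le: "energy_conj (x + h) - energy_conj x \<le> (norm (x + h) + 1) * norm h"
proof (rule field_le_epsilon)
  fix e :: real assume e: "e > 0"
  define e' where "e' = min e 1"
  have e': "e' > 0" "e' \<le> e" "e' \<le> 1" using e by (auto simp: e'_def)
  obtain f where f: "energy_conj (x + h) - e' < blinfun_apply f (x + h) - energy f" using energy_conj_near[of "energy_conj (x + h) - e'" "x + h"] e' by auto
  have "f h \<le> norm f * norm h" using norm_blinfun[of f h] by simp
  also have "\<dots> \<le> (norm (x + h) + 1) * norm h"
    using near_maximizer_norm[OF less_imp_le[OF f] e'(3)] by (rule mult_right_mono) simp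
  finally show "energy_conj (x + h) - energy_conj x \<le> (norm (x + h) + 1) * norm h + e"
    using f energy_conj_upper[of f x] e' by (simp add: blinfun.add_right)
qed

text \<open>The easy half of Smulian's criterion. A near maximizer \<open>f\<close> at \<open>x + h\<close> is a near maximizer at \<open>x\<close>, so it is close to
\<open>p\<close>, and \<open>energy_conj (x + h)\<close> is about \<open>f x - energy f + f h \<le> energy_conj x + f h\<close>. At a
minimizer of \<open>\<phi> + g\<close> such an upper estimate for \<open>g\<close> is a lower estimate for \<open>\<phi>\<close>.\<close>

lemma energy_conj_superdifferentiable:
  assumes max: "energy_conj x \<le> blinfun_apply p x - energy p"
    and strong: "\<And>e. e > 0 \<Longrightarrow> \<exists>a>0. \<forall>f. energy_conj x - a \<le> blinfun_apply f x - energy f \<longrightarrow>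
      close_on Y e f p"
    and e: "e > 0"
  shows "\<exists>d>0. \<forall>h\<in>Y. norm h < d \<longrightarrow> energy_conj (x + h) \<le> energy_conj x + blinfun_apply p h + e * norm h"
proof -
  obtain a where a: "a > 0" and near: "\<And>f v. energy_conj x - a \<le> blinfun_apply f x - energy f \<Longrightarrow> v \<in> Y \<Longrightarrow>
      \<bar>blinfun_apply f v - blinfun_apply p v\<bar> \<le> (e/2) * norm v"
    using strong[of "e/2"] e by fastforce
  define d where "d = min (min 1 (e/2)) (a / (2 * norm x + 4))"
  have nx: "2 * norm x + 4 > 0" by (smt (verit) norm_ge_zero)
  have "d \<le> min 1 (e/2)" and d4: "d \<le> a / (2 * norm x + 4)"
    unfolding d_def by (rule min.cobounded1, rule min.cobounded2)
  then have d: "d > 0" "d \<le> 1" "d \<le> e/2" using e a nx by (simp_all add: d_def)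
  have "energy_conj (x + h) \<le> energy_conj x + p h + e * norm h" if h: "h \<in> Y" "norm h < d" for h
  proof (cases "h = 0")
    case False
    then have hp: "norm h > 0" by simp
    \<comment> \<open>The accuracy of the near maximizer has to be of smaller order than \<open>norm h\<close>.\<close>
    define q where "q = (norm h)\<^sup>2"
    have q: "q > 0" "q \<le> norm h" "q \<le> 1"
      using hp h(2) d(2) mult_left_le[of "norm h" "norm h"] by (auto simp: q_def power2_eq_square mult_le_one)
    obtain f where f: "energy_conj (x + h) - q < blinfun_apply f (x + h) - energy f" using energy_conj_near[of "energy_conj (x + h) - q" "x + h"] q by auto
    have nf: "norm f \<le> norm x + 2"
      using near_maximizer_norm[OF less_imp_le[OF f] q(3)] norm_triangle_ineq[of x h] h(2) d(2) by linarith
    have fh: "\<bar>f h\<bar> \<le> (norm x + 2) * norm h"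
      using norm_blinfun[of f h] mult_right_mono[OF nf norm_ge_zero[of h]] by simp
    have low: "energy_conj x - energy_conj (x + h) \<le> (norm x + 1) * norm h"
      using energy_conj_diff_le[of "x + h" "- h"] by simp
    have "(2 * norm x + 4) * norm h \<le> a"
      using less_imp_le[OF less_le_trans[OF h(2) d4]] nx by (simp add: pos_le_divide_eq mult.commute)
    then have "(norm x + 2) * norm h + (norm x + 1) * norm h + norm h \<le> a" by (simp add: algebra_simps)
    then have "energy_conj x - a \<le> f x - energy f"
      using f fh low q(2) by (simp add: blinfun.add_right)
    from near[OF this h(1)] have "f h \<le> p h + e/2 * norm h" by linarith
    moreover have "q \<le> e/2 * norm h" using h(2) d(3) hp by (simp add: q_def power2_eq_square)
    ultimately show ?thesis using f energy_conj_upper[of f x] by (simp add: blinfun.add_right) 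
  qed simp
  then show ?thesis using d(1) by blast
qed

end

section \<open>A function with quadratic growth, differentiable along a separable subspace\<close>

definition dist_on :: "'a::real_normed_vector set \<Rightarrow> ('a \<Rightarrow>\<^sub>L real) set \<Rightarrow> ('a \<Rightarrow>\<^sub>L real) \<Rightarrow> real" where
  "dist_on Y C f = Inf {r. 0 \<le> r \<and> (\<exists>c\<in>C. close_on Y r f c)}"

lemma dist_on_le:
  assumes "0 \<le> r" "c \<in> C" "close_on Y r f c"
  shows "dist_on Y C f \<le> r"
  unfolding dist_on_def by (rule cInf_lower) (use assms in \<open>auto intro!: bdd_belowI[of _ 0]\<close>)

lemma eval_diff_le: "\<bar>blinfun_apply f v - blinfun_apply g v\<bar> \<le> norm (f - g) * norm v"
  for f g :: "'a::real_normed_vector \<Rightarrow>\<^sub>L real"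
  using norm_blinfun[of "f - g" v] by (simp add: blinfun.diff_left)

context
  fixes C :: "('a::real_normed_vector \<Rightarrow>\<^sub>L real) set" and Y :: "'a set"
  assumes C0: "0 \<in> C"
begin

lemma dist_on_set_norm: "norm f \<in> {r. 0 \<le> r \<and> (\<exists>c\<in>C. close_on Y r f c)}"
  using C0 eval_diff_le[of f _ 0] by (auto intro!: bexI[of _ 0])

lemma dist_on_le_norm: "dist_on Y C f \<le> norm f"
  unfolding dist_on_def by (rule cInf_lower[OF dist_on_set_norm]) (auto intro!: bdd_belowI[of _ 0])

lemma dist_on_nonneg: "0 \<le> dist_on Y C f"
  unfolding dist_on_def by (rule cInf_greatest) (use dist_on_set_norm in blast)+

lemma dist_on_less:
  assumes "dist_on Y C f < r"
  shows "\<exists>c\<in>C. close_on Y r f c"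
proof -
  obtain r' c where "r' < r" "c \<in> C" "close_on Y r' f c"
    using cInf_lessD[OF _ assms[unfolded dist_on_def]] dist_on_set_norm by blast
  then show ?thesis by (meson less_imp_le mult_right_mono norm_ge_zero order_trans)
qed

lemma dist_on_midpoint:
  assumes "convex C"
  shows "dist_on Y C ((1/2) *\<^sub>R (f + g)) \<le> (dist_on Y C f + dist_on Y C g) / 2"
proof (rule field_le_epsilon)
  fix e :: real assume e: "e > 0"
  let ?r = "dist_on Y C f + e" and ?r' = "dist_on Y C g + e"
  obtain c c' where c: "c \<in> C" "close_on Y ?r f c"
    and c': "c' \<in> C" "close_on Y ?r' g c'"
    using dist_on_less[of f ?r] dist_on_less[of g ?r'] e by auto
  have "dist_on Y C ((1/2) *\<^sub>R (f + g)) \<le> (?r + ?r') / 2"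
  proof (rule dist_on_le)
    show "0 \<le> (?r + ?r') / 2" using dist_on_nonneg e by (simp add: add_nonneg_nonneg)
    show "(1/2) *\<^sub>R c + (1/2) *\<^sub>R c' \<in> C" using convexD[OF assms c(1) c'(1), of "1/2" "1/2"] by simp
    show "close_on Y ((?r + ?r') / 2) ((1/2) *\<^sub>R (f + g)) ((1/2) *\<^sub>R c + (1/2) *\<^sub>R c')"
    proof
      fix v assume v: "v \<in> Y"
      have "((1/2) *\<^sub>R (f + g)) v - ((1/2) *\<^sub>R c + (1/2) *\<^sub>R c') v = ((f v - c v) + (g v - c' v)) / 2"
        by (simp add: blinfun.scaleR_left blinfun.add_left field_simps)
      moreover have "(?r + ?r') / 2 * norm v = (?r * norm v + ?r' * norm v) / 2" by (simp add: field_simps)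
      moreover have "\<bar>(a + b) / 2\<bar> \<le> (R + S) / 2" if "\<bar>a\<bar> \<le> R" "\<bar>b\<bar> \<le> S" for a b R S :: real
        using abs_triangle_ineq[of a b] that by simp
      ultimately show "\<bar>((1/2) *\<^sub>R (f + g)) v - ((1/2) *\<^sub>R c + (1/2) *\<^sub>R c') v\<bar> \<le> (?r + ?r') / 2 * norm v"
        using bspec[OF c(2) v] bspec[OF c'(2) v] by (simp only:)
    qed
  qed
  then show "dist_on Y C ((1/2) *\<^sub>R (f + g)) \<le> (dist_on Y C f + dist_on Y C g) / 2 + e" by (simp add: field_simps)
qed

end

text \<open>The approximants converge along a subsequence, and their limit approximates both the limit functional and some
member of the sequence.\<close>

lemma compact_approximants_limit:
  fixes C :: "('a::real_normed_vector \<Rightarrow>\<^sub>L real) set"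
  assumes C: "compact C" and lim: "\<And>v. v \<in> Y \<Longrightarrow> (\<lambda>k. blinfun_apply (G k) v) \<longlonglongrightarrow> blinfun_apply p v"
    and near: "\<And>k. \<exists>c\<in>C. close_on Y r (G k) c" and e: "e > 0"
  shows "\<exists>c\<in>C. close_on Y r p c \<and>
    (\<exists>k. close_on Y (r + e) (G k) c)"
proof -
  obtain c where c: "\<And>k. c k \<in> C" "\<And>k. close_on Y r (G k) (c k)"
    using near by metis
  obtain l \<phi> where l: "l \<in> C" "strict_mono \<phi>" "(c \<circ> \<phi>) \<longlonglongrightarrow> l"
    using C c(1) unfolding compact_def by blast
  have "\<bar>p v - l v\<bar> \<le> r * norm v" if v: "v \<in> Y" for v
  proof -
    have "(\<lambda>k. G (\<phi> k) v - c (\<phi> k) v) \<longlonglongrightarrow> p v - l v"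
      using LIMSEQ_subseq_LIMSEQ[OF lim[OF v] l(2)] blinfun.tendsto[OF l(3) tendsto_const[of v]]
      by (intro tendsto_diff) (simp_all add: o_def)
    then have "(\<lambda>k. \<bar>G (\<phi> k) v - c (\<phi> k) v\<bar>) \<longlonglongrightarrow> \<bar>p v - l v\<bar>" by (rule tendsto_rabs)
    then show ?thesis by (rule LIMSEQ_le_const2) (use c(2) v in blast)
  qed
  moreover obtain k where k: "dist (c (\<phi> k)) l < e" using metric_LIMSEQ_D[OF l(3) e] by auto
  have "\<bar>G (\<phi> k) v - l v\<bar> \<le> (r + e) * norm v" if v: "v \<in> Y" for v
  proof -
    have "\<bar>c (\<phi> k) v - l v\<bar> \<le> e * norm v"
      using eval_diff_le[of "c (\<phi> k)" v l] k mult_right_mono[of "norm (c (\<phi> k) - l)" e "norm v"] by (simp add: dist_norm)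
    moreover have "\<bar>G (\<phi> k) v - c (\<phi> k) v\<bar> \<le> r * norm v" using c(2) v by blast
    ultimately show ?thesis unfolding distrib_right by linarith
  qed
  ultimately show ?thesis using l(1) by blast
qed

lemma bounded_functionals_Cauchy_closure:
  fixes F :: "nat \<Rightarrow> 'a::real_normed_vector \<Rightarrow>\<^sub>L real"
  assumes B: "\<And>k. norm (F k) \<le> B" and conv: "\<And>d. d \<in> D \<Longrightarrow> convergent (\<lambda>k. blinfun_apply (F k) d)"
    and v: "v \<in> closure D"
  shows "convergent (\<lambda>k. blinfun_apply (F k) v)"
proof (rule Cauchy_convergent, rule metric_CauchyI)
  fix e :: real assume e: "e > 0"
  have B0: "0 \<le> B" using B[of 0] norm_ge_zero order_trans by blast
  define \<eta> where "\<eta> = e / 3 / (B + 1)"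
  have \<eta>: "\<eta> > 0" using e B0 by (simp add: \<eta>_def)
  obtain d where d: "d \<in> D" "dist d v < \<eta>" using v \<eta> closure_approachable by blast
  have near: "\<bar>F k v - F k d\<bar> \<le> e / 3" for k
  proof -
    have "\<bar>F k v - F k d\<bar> \<le> norm (F k) * norm (v - d)" using norm_blinfun[of "F k" "v - d"] by (simp add: blinfun.diff_right)
    also have "\<dots> \<le> (B + 1) * \<eta>" using B[of k] B0 d(2) by (intro mult_mono) (auto simp: dist_norm norm_minus_commute)
    also have "\<dots> = e / 3" using B0 nonzero_mult_div_cancel_left[of "B + 1" "e / 3"] by (simp only: \<eta>_def times_divide_eq_right)
    finally show ?thesis .
  qed
  obtain M where M: "\<And>m n. m \<ge> M \<Longrightarrow> n \<ge> M \<Longrightarrow> dist (F m d) (F n d) < e / 3"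
    using metric_CauchyD[OF convergent_Cauchy[OF conv[OF d(1)]], of "e/3"] e by auto
  have "dist (F m v) (F n v) < e" if "m \<ge> M" "n \<ge> M" for m n
    using near[of m] near[of n] M[OF that] unfolding dist_real_def by linarith
  then show "\<exists>M. \<forall>m\<ge>M. \<forall>n\<ge>M. dist (F m v) (F n v) < e" by blast
qed

text \<open>Interleaving the sequence with its limit reduces convergence to the Cauchy property.\<close>

lemma bounded_functionals_tendsto_closure:
  fixes F :: "nat \<Rightarrow> 'a::real_normed_vector \<Rightarrow>\<^sub>L real"
  assumes B: "\<And>k. norm (F k) \<le> B" and lim: "\<And>d. d \<in> D \<Longrightarrow> (\<lambda>k. blinfun_apply (F k) d) \<longlonglongrightarrow> blinfun_apply f d"
    and v: "v \<in> closure D"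
  shows "(\<lambda>k. blinfun_apply (F k) v) \<longlonglongrightarrow> blinfun_apply f v"
proof -
  \<comment> \<open>Even places run through the sequence, odd ones repeat the limit.\<close>
  define G where "G k = (if even k then F (k div 2) else f)" for k
  have nG: "norm (G k) \<le> max B (norm f)" for k using B by (auto simp: G_def le_max_iff_disj)
  have cG: "convergent (\<lambda>k. G k d)" if "d \<in> D" for d
  proof -
    have "(\<lambda>k. G k d) \<longlonglongrightarrow> f d"
    proof (rule metric_LIMSEQ_I)
      fix e :: real assume "e > 0"
      then obtain N where N: "\<And>n. n \<ge> N \<Longrightarrow> dist (F n d) (f d) < e" using metric_LIMSEQ_D[OF lim[OF \<open>d \<in> D\<close>]] by blast
      then show "\<exists>N. \<forall>n\<ge>N. dist (G n d) (f d) < e" using \<open>e > 0\<close> by (intro exI[of _ "2 * N"]) (auto simp: G_def)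
    qed
    then show ?thesis by (rule convergentI)
  qed
  from bounded_functionals_Cauchy_closure[OF nG cG v] obtain L where L: "(\<lambda>k. G k v) \<longlonglongrightarrow> L" by (auto simp: convergent_def)
  have "(\<lambda>k. G (2 * k) v) \<longlonglongrightarrow> L" "(\<lambda>k. G (2 * k + 1) v) \<longlonglongrightarrow> L"
    using LIMSEQ_subseq_LIMSEQ[OF L, of "\<lambda>k. 2 * k"] LIMSEQ_subseq_LIMSEQ[OF L, of "\<lambda>k. 2 * k + 1"]
    by (auto simp: strict_mono_def o_def)
  then have "(\<lambda>k. F k v) \<longlonglongrightarrow> L" "(\<lambda>k::nat. f v) \<longlonglongrightarrow> L" by (auto simp: G_def)
  then show ?thesis using LIMSEQ_unique[OF _ tendsto_const] by metis
qed

lemma convergent_if_square_Cauchy: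
  fixes a :: "nat \<Rightarrow> real"
  assumes "\<And>k j. k \<le> j \<Longrightarrow> (a k - a j)\<^sup>2 \<le> K * inverse (real (Suc k))"
  shows "convergent a"
proof (rule Cauchy_convergent, rule CauchyI')
  fix e :: real assume e: "e > 0"
  have K: "0 \<le> K" using assms[of 0 0] by simp
  obtain M where M: "inverse (real (Suc M)) < e\<^sup>2 / (K + 1)" using reals_Archimedean[of "e\<^sup>2 / (K + 1)"] e K by auto
  have "dist (a m) (a n) < e" if "m \<ge> M" "n > m" for m n
  proof -
    have "(a m - a n)\<^sup>2 \<le> K * inverse (real (Suc m))" using assms that by simp
    also have "\<dots> \<le> (K + 1) * inverse (real (Suc M))" using K that by (intro mult_mono) (auto simp: field_simps)
    also have "\<dots> < e\<^sup>2" using M K by (simp add: pos_less_divide_eq mult.commute del: of_nat_Suc)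
    finally have "\<bar>a m - a n\<bar>\<^sup>2 < e\<^sup>2" by simp
    then show ?thesis using e power2_less_imp_less[of "\<bar>a m - a n\<bar>" e] by (simp add: dist_real_def)
  qed
  then show "\<exists>M. \<forall>m\<ge>M. \<forall>n>m. dist (a m) (a n) < e" by blast
qed

definition hull_seq :: "(nat \<Rightarrow> 'b::real_normed_vector) \<Rightarrow> nat \<Rightarrow> 'b set" where
  "hull_seq c n = convex hull (insert 0 (c ` {..n}))"

lemma hull_seq: "0 \<in> hull_seq c n" "c n \<in> hull_seq c n" "compact (hull_seq c n)" "convex (hull_seq c n)"
  unfolding hull_seq_def by (auto intro: hull_inc finite_imp_compact_convex_hull)

locale separable_dual_pair =
  fixes Y :: "'a::real_normed_vector set" and d :: "nat \<Rightarrow> 'a" and c :: "nat \<Rightarrow> 'a \<Rightarrow>\<^sub>L real"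
  assumes Y: "subspace Y" and dY: "range d \<subseteq> Y" and dense: "Y \<subseteq> closure (range d)"
    and dual_dense: "e > 0 \<Longrightarrow> \<exists>n. close_on Y e f (c n)"
begin

definition y :: "nat \<Rightarrow> 'a" where
  "y n = (1 / (1 + norm (d n))) *\<^sub>R d n"

text \<open>Terms with even index make maximizing sequences converge pointwise on \<open>Y\<close>, terms with odd index make the
convergence uniform on bounded sets. The points are scaled into the unit ball for the sake of \<open>s_le\<close>.\<close>

definition s :: "nat \<Rightarrow> ('a \<Rightarrow>\<^sub>L real) \<Rightarrow> real" where
  "s n f = (if even n then f (y (n div 2)) else dist_on Y (hull_seq c (n div 2)) f)"

lemma y: "y n \<in> Y" "norm (y n) \<le> 1" "f (d n) = (1 + norm (d n)) * f (y n)" for f :: "'a \<Rightarrow>\<^sub>L real"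
proof -
  show "y n \<in> Y" unfolding y_def using dY by (intro subspace_scale[OF Y]) auto
  have "1 + norm (d n) > 0" by (smt (verit) norm_ge_zero)
  then show "norm (y n) \<le> 1" "f (d n) = (1 + norm (d n)) * f (y n)"
    by (auto simp: y_def blinfun.scaleR_right field_simps)
qed

sublocale dual_energy s
proof
  fix n f g
  show "\<bar>s n f\<bar> \<le> norm f"
  proof (cases "even n")
    case True
    have "\<bar>f (y (n div 2))\<bar> \<le> norm f * norm (y (n div 2))" using norm_blinfun[of f "y (n div 2)"] by simp
    also have "\<dots> \<le> norm f" using y(2) by (simp add: mult_left_le)
    finally show ?thesis using True by (simp add: s_def)
  next
    case False
    then show ?thesis
      by (simp add: s_def abs_of_nonneg[OF dist_on_nonneg[OF hull_seq(1)]] dist_on_le_norm[OF hull_seq(1)])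
  qed
  show "(s n ((1/2) *\<^sub>R (f + g)))\<^sup>2 \<le> ((s n f + s n g) / 2)\<^sup>2"
  proof (cases "even n")
    case True
    then show ?thesis by (simp add: s_def blinfun.scaleR_left blinfun.add_left)
  next
    case False
    then show ?thesis
      using dist_on_midpoint[OF hull_seq(1,4)] dist_on_nonneg[OF hull_seq(1)] by (auto simp: s_def intro!: power_mono)
  qed
qed

text \<open>A maximizing sequence converges pointwise on \<open>Y\<close> by uniform convexity. The limit is a functional on \<open>Y\<close>;
extend it with norm at most the limit of the norms. The extension is a maximizer, because the other terms of
the energy are lower semicontinuous and depend only on the values on \<open>Y\<close>.\<close>

lemma maximizer_exists:
  assumes x: "x \<in> Y"
  obtains p where "energy_conj x \<le> blinfun_apply p x - energy p"
proof -
  have "\<exists>f. energy_conj x - inverse (real (Suc k)) \<le> blinfun_apply f x - energy f" for k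
  proof -
    have "energy_conj x - inverse (real (Suc k)) < energy_conj x" by simp
    then show ?thesis by (meson energy_conj_near less_imp_le)
  qed
  then obtain F where F: "\<And>k. energy_conj x - inverse (real (Suc k)) \<le> blinfun_apply (F k) x - energy (F k)" by metis
  have F': "energy_conj x - inverse (real (Suc k)) \<le> blinfun_apply (F j) x - energy (F j)" if "k \<le> j" for k j
  proof -
    have "inverse (real (Suc j)) \<le> inverse (real (Suc k))" using that by (intro le_imp_inverse_le) auto
    then show ?thesis using F[of j] by linarith
  qed
  have bound: "norm (F k) \<le> norm x + 1" for k
    using near_maximizer_norm[OF F[of k]] by (simp add: field_simps)
  have "convergent (\<lambda>k. norm (F k))"
    by (rule convergent_if_square_Cauchy[of _ 4]) (rule near_maximizers_close(1)[OF F F'])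
  then obtain L where L: "(\<lambda>k. norm (F k)) \<longlonglongrightarrow> L" by (auto simp: convergent_def)
  have s_conv: "convergent (\<lambda>k. s n (F k))" for n
    by (rule convergent_if_square_Cauchy[of _ "4 * 2^Suc n"]) (rule near_maximizers_close(2)[OF F F'])
  then obtain \<sigma> where \<sigma>: "\<And>n. (\<lambda>k. s n (F k)) \<longlonglongrightarrow> \<sigma> n" unfolding convergent_def by metis
  have conv: "convergent (\<lambda>k. F k v)" if "v \<in> Y" for v
  proof (rule bounded_functionals_Cauchy_closure[OF bound])
    show "v \<in> closure (range d)" using that dense by blast
    fix w assume "w \<in> range d"
    then obtain n where w: "w = d n" by blast
    have "convergent (\<lambda>k. F k (y n))" using s_conv[of "2 * n"] by (simp add: s_def)
    then show "convergent (\<lambda>k. F k w)" unfolding w y(3)[of _ n] by (intro convergent_mult convergent_const)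
  qed
  define l where "l v = lim (\<lambda>k. blinfun_apply (F k) v)" for v
  have l: "(\<lambda>k. F k v) \<longlonglongrightarrow> l v" if "v \<in> Y" for v
    using conv[OF that] by (simp add: l_def convergent_LIMSEQ_iff)
  obtain p where p: "norm p \<le> L" and pl: "\<forall>v\<in>Y. blinfun_apply p v = l v"
  proof (rule Hahn_Banach_norm[OF Y, of L l])
    show "0 \<le> L" by (rule LIMSEQ_le_const[OF L]) simp
    show "l (u + v) = l u + l v" if "u \<in> Y" "v \<in> Y" for u v
      by (rule LIMSEQ_unique[OF l[OF subspace_add[OF Y that]]])
        (use tendsto_add[OF l[OF that(1)] l[OF that(2)]] in \<open>simp add: blinfun.add_right\<close>)
    show "l (t *\<^sub>R v) = t * l v" if "v \<in> Y" for t v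
      by (rule LIMSEQ_unique[OF l[OF subspace_scale[OF Y that]]])
        (use tendsto_mult_left[OF l[OF that]] in \<open>simp add: blinfun.scaleR_right\<close>)
    show "l v \<le> L * norm v" if "v \<in> Y" for v
    proof (rule LIMSEQ_le[OF l[OF that] tendsto_mult_right[OF L]])
      show "\<exists>N. \<forall>k\<ge>N. F k v \<le> norm (F k) * norm v" using norm_blinfun[of "F _" v] by (auto simp: abs_le_iff)
    qed
  qed
  have lim_p: "(\<lambda>k. F k v) \<longlonglongrightarrow> p v" if "v \<in> Y" for v using l[OF that] pl that by simp
  have s_p: "(s n p)\<^sup>2 \<le> (\<sigma> n)\<^sup>2" for n
  proof (cases "even n")
    case True
    then have "s n p = \<sigma> n"
      using LIMSEQ_unique[OF \<sigma>[of n]] lim_p[OF y(1)[of "n div 2"]] by (simp add: s_def)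
    then show ?thesis by simp
  next
    case False
    define H where "H = hull_seq c (n div 2)"
    have H: "0 \<in> H" "compact H" using hull_seq by (auto simp: H_def)
    have sH: "s n f = dist_on Y H f" for f using False by (simp add: s_def H_def)
    have nonneg: "0 \<le> \<sigma> n" by (rule LIMSEQ_le_const[OF \<sigma>[of n]]) (simp add: sH dist_on_nonneg[OF H(1)])
    have "dist_on Y H p \<le> \<sigma> n"
    proof (rule field_le_epsilon)
      fix e :: real assume e: "e > 0"
      then have "\<forall>\<^sub>F k in sequentially. s n (F k) < \<sigma> n + e" using order_tendstoD(2)[OF \<sigma>[of n], of "\<sigma> n + e"] by simp
      then obtain K where K: "\<And>k. k \<ge> K \<Longrightarrow> s n (F k) < \<sigma> n + e" by (auto simp: eventually_sequentially)
      have "\<exists>c\<in>H. close_on Y (\<sigma> n + e) p c \<and>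
        (\<exists>k. close_on Y (\<sigma> n + e + 1) (F (k + K)) c)"
      proof (rule compact_approximants_limit[OF H(2)])
        show "(\<lambda>k. F (k + K) v) \<longlonglongrightarrow> p v" if "v \<in> Y" for v using LIMSEQ_ignore_initial_segment[OF lim_p[OF that]] .
        show "\<exists>c\<in>H. \<forall>v\<in>Y. \<bar>F (k + K) v - c v\<bar> \<le> (\<sigma> n + e) * norm v" for k
          using K[of "k + K"] unfolding sH by (intro dist_on_less[OF H(1)]) simp
      qed simp
      then show "dist_on Y H p \<le> \<sigma> n + e" using nonneg e dist_on_le[of "\<sigma> n + e" _ H Y p] by auto
    qed
    then show ?thesis using dist_on_nonneg[OF H(1)] unfolding sH by (intro power_mono) auto
  qed
  have lim_en: "(\<lambda>k. energy (F k)) \<longlonglongrightarrow> p x - energy_conj x"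
  proof -
    have "(\<lambda>k. F k x - energy (F k)) \<longlonglongrightarrow> energy_conj x"
    proof (rule tendsto_sandwich)
      show "\<forall>\<^sub>F k in sequentially. energy_conj x - inverse (real (Suc k)) \<le> F k x - energy (F k)" using F by simp
      show "\<forall>\<^sub>F k in sequentially. F k x - energy (F k) \<le> energy_conj x" using energy_conj_upper by simp
      show "(\<lambda>k. energy_conj x - inverse (real (Suc k))) \<longlonglongrightarrow> energy_conj x"
        using tendsto_diff[OF tendsto_const LIMSEQ_inverse_real_of_nat, of "energy_conj x"] by simp
    qed simp
    from tendsto_diff[OF lim_p[OF x] this] show ?thesis by simp
  qed
  have part: "(norm p)\<^sup>2 + (\<Sum>n<N. (1/2)^Suc n * (s n p)\<^sup>2) \<le> p x - energy_conj x" for N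
  proof -
    have "(norm p)\<^sup>2 + (\<Sum>n<N. (1/2)^Suc n * (s n p)\<^sup>2) \<le> L\<^sup>2 + (\<Sum>n<N. (1/2)^Suc n * (\<sigma> n)\<^sup>2)"
      by (intro add_mono power_mono[OF p norm_ge_zero] sum_mono mult_left_mono[OF s_p]) simp
    also have "\<dots> \<le> p x - energy_conj x"
    proof (rule LIMSEQ_le)
      show "(\<lambda>k. (norm (F k))\<^sup>2 + (\<Sum>n<N. (1/2)^Suc n * (s n (F k))\<^sup>2)) \<longlonglongrightarrow> L\<^sup>2 + (\<Sum>n<N. (1/2)^Suc n * (\<sigma> n)\<^sup>2)"
        by (intro tendsto_intros L \<sigma>)
      show "\<exists>K. \<forall>k\<ge>K. (norm (F k))\<^sup>2 + (\<Sum>n<N. (1/2)^Suc n * (s n (F k))\<^sup>2) \<le> energy (F k)" using energy_ge by blast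
    qed (rule lim_en)
    finally show ?thesis .
  qed
  have "(\<Sum>n. (1/2)^Suc n * (s n p)\<^sup>2) \<le> p x - energy_conj x - (norm p)\<^sup>2"
    using part by (intro suminf_le_const[OF summable_s]) (simp add: algebra_simps)
  then have "energy_conj x \<le> p x - energy p" by (simp add: energy_def)
  then show ?thesis by (rule that)
qed

text \<open>Otherwise some maximizing sequence stays away from \<open>p\<close>. The functional \<open>p\<close> is within \<open>e/6\<close> of some \<open>c m\<close>, hence
of the compact hull \<open>H\<close>; the distances to \<open>H\<close> converge by uniform convexity, so the sequence is eventually within
\<open>e/5\<close> of \<open>H\<close>, and compactness of \<open>H\<close> contradicts the choice of the sequence.\<close>

lemma maximizer_strong:
  assumes x: "x \<in> Y" and p: "energy_conj x \<le> blinfun_apply p x - energy p" and e: "e > 0"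
  shows "\<exists>a>0. \<forall>f. energy_conj x - a \<le> blinfun_apply f x - energy f \<longrightarrow>
      close_on Y e f p"
proof (rule ccontr)
  assume "\<not> ?thesis"
  then have "\<exists>f. energy_conj x - a \<le> blinfun_apply f x - energy f \<and> (\<exists>v\<in>Y. \<bar>blinfun_apply f v - blinfun_apply p v\<bar> > e * norm v)" if "a > 0" for a
    using that by (meson not_le)
  then have "\<exists>f. energy_conj x - inverse (real (Suc k)) \<le> blinfun_apply f x - energy f \<and> (\<exists>v\<in>Y. \<bar>blinfun_apply f v - blinfun_apply p v\<bar> > e * norm v)" for k
    by simp
  then obtain F where F: "\<And>k. energy_conj x - inverse (real (Suc k)) \<le> blinfun_apply (F k) x - energy (F k)"
    and bad: "\<And>k. \<exists>v\<in>Y. \<bar>blinfun_apply (F k) v - blinfun_apply p v\<bar> > e * norm v" by metis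
  have bound: "norm (F k) \<le> norm x + 1" for k
    using near_maximizer_norm[OF F[of k]] by (simp add: field_simps)
  have s_lim: "(\<lambda>k. s n (F k)) \<longlonglongrightarrow> s n p" for n
  proof -
    have "(\<lambda>k. (s n (F k) - s n p)\<^sup>2) \<longlonglongrightarrow> 0"
    proof (rule tendsto_sandwich[of "\<lambda>_. 0"])
      have "energy_conj x - inverse (real (Suc k)) \<le> p x - energy p" for k using p by (smt (verit) inverse_nonnegative_iff_nonnegative of_nat_0_le_iff)
      then show "\<forall>\<^sub>F k in sequentially. (s n (F k) - s n p)\<^sup>2 \<le> 4 * 2^Suc n * inverse (real (Suc k))"
        by (intro always_eventually allI near_maximizers_close(2)[OF F])
      show "(\<lambda>k. 4 * 2^Suc n * inverse (real (Suc k))) \<longlonglongrightarrow> 0"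
        using tendsto_mult_left[OF LIMSEQ_inverse_real_of_nat, of "4 * 2^Suc n"] by simp
    qed auto
    then have "(\<lambda>k. sqrt ((s n (F k) - s n p)\<^sup>2)) \<longlonglongrightarrow> sqrt 0" by (rule tendsto_real_sqrt)
    then have "(\<lambda>k. s n (F k) - s n p) \<longlonglongrightarrow> 0" by (simp add: tendsto_rabs_zero_iff)
    then show ?thesis by (rule LIM_zero_cancel)
  qed
  have lim: "(\<lambda>k. F k v) \<longlonglongrightarrow> p v" if "v \<in> Y" for v
  proof (rule bounded_functionals_tendsto_closure[OF bound])
    show "v \<in> closure (range d)" using that dense by blast
    fix w assume "w \<in> range d"
    then obtain n where w: "w = d n" by blast
    have "(\<lambda>k. F k (y n)) \<longlonglongrightarrow> p (y n)" using s_lim[of "2 * n"] by (simp add: s_def)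
    then show "(\<lambda>k. F k w) \<longlonglongrightarrow> p w" unfolding w y(3)[of _ n] by (rule tendsto_mult_left)
  qed
  obtain m where m: "close_on Y (e/6) p (c m)" using dual_dense[of "e/6"] e by auto
  define H where "H = hull_seq c m"
  have H: "0 \<in> H" "compact H" "c m \<in> H" using hull_seq by (auto simp: H_def)
  obtain i where sH: "\<And>f. s i f = dist_on Y H f"
  proof
    show "s (2 * m + 1) f = dist_on Y H f" for f by (simp add: s_def H_def)
  qed
  have "dist_on Y H p \<le> e/6" by (rule dist_on_le[OF _ H(3) m]) (use e in simp)
  then have "\<forall>\<^sub>F k in sequentially. s i (F k) < e/5"
    using order_tendstoD(2)[OF s_lim[of i], of "e/5"] e by (simp add: sH)
  then obtain K where K: "\<And>k. k \<ge> K \<Longrightarrow> dist_on Y H (F k) < e/5" by (auto simp: eventually_sequentially sH)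
  have "\<exists>c\<in>H. close_on Y (e/5) p c \<and>
    (\<exists>k. close_on Y (e/5 + e/5) (F (k + K)) c)"
  proof (rule compact_approximants_limit[OF H(2)])
    show "(\<lambda>k. F (k + K) v) \<longlonglongrightarrow> p v" if "v \<in> Y" for v using LIMSEQ_ignore_initial_segment[OF lim[OF that]] .
    show "\<exists>c\<in>H. \<forall>v\<in>Y. \<bar>F (k + K) v - c v\<bar> \<le> e/5 * norm v" for k
      using K[of "k + K"] by (intro dist_on_less[OF H(1)]) simp
  qed (use e in simp)
  then obtain h k where hk: "close_on Y (e/5) p h"
    "close_on Y (e/5 + e/5) (F (k + K)) h" by blast
  obtain v where v: "v \<in> Y" "\<bar>F (k + K) v - p v\<bar> > e * norm v" using bad by blast
  have "\<bar>F (k + K) v - p v\<bar> \<le> e/5 * norm v + (e/5 + e/5) * norm v" using bspec[OF hk(1) v(1)] bspec[OF hk(2) v(1)] by linarith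
  also have "\<dots> = 3/5 * (e * norm v)" by (simp add: field_simps)
  also have "\<dots> \<le> e * norm v" using mult_nonneg_nonneg[OF less_imp_le[OF e] norm_ge_zero[of v]] by linarith
  finally show False using v(2) by linarith
qed

end

theorem smooth_gauge_exists:
  fixes D :: "'a::banach set"
  assumes X: "asplund_space TYPE('a)" and D: "countable D" "D \<subseteq> Y" and Y: "subspace Y" "Y \<subseteq> closure D"
  obtains g :: "'a \<Rightarrow> real" where "\<forall>x. (norm x)\<^sup>2 / 8 \<le> g x" "\<forall>x. g x \<le> (norm x)\<^sup>2 / 4"
    "\<forall>x h. g (x + h) - g x \<le> (norm (x + h) + 1) * norm h"
    "\<forall>x\<in>Y. \<exists>p. norm p \<le> norm x \<and> (\<forall>e>0. \<exists>d>0. \<forall>h\<in>Y. norm h < d \<longrightarrow> g (x + h) \<le> g x + blinfun_apply p h + e * norm h)"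
proof -
  have "D \<noteq> {}" using subsetD[OF Y(2) subspace_0[OF Y(1)]] by auto
  then have ran: "range (from_nat_into D) = D" using D(1) by (rule range_from_nat_into)
  obtain c :: "nat \<Rightarrow> 'a \<Rightarrow>\<^sub>L real" where
    c: "\<forall>f. \<forall>e>0. \<exists>n. close_on Y e f (c n)"
    by (rule Asplund_dual_separable_on_subspace[OF X D(1) Y])
  interpret separable_dual_pair Y "from_nat_into D" c
  proof
    show "subspace Y" by (rule Y(1))
    show "range (from_nat_into D) \<subseteq> Y" unfolding ran by (rule D(2))
    show "Y \<subseteq> closure (range (from_nat_into D))" unfolding ran by (rule Y(2))
    show "\<exists>n. close_on Y e f (c n)" if "e > 0" for f e
      using c that by blast
  qed
  show ?thesis
  proof
    show "\<forall>x. (norm x)\<^sup>2 / 8 \<le> energy_conj x" using energy_conj_ge by blast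
    show "\<forall>x. energy_conj x \<le> (norm x)\<^sup>2 / 4" using energy_conj_le by blast
    show "\<forall>x h. energy_conj (x + h) - energy_conj x \<le> (norm (x + h) + 1) * norm h" using energy_conj_diff_le by blast
    show "\<forall>x\<in>Y. \<exists>p. norm p \<le> norm x \<and> (\<forall>e>0. \<exists>d>0. \<forall>h\<in>Y. norm h < d \<longrightarrow> energy_conj (x + h) \<le> energy_conj x + blinfun_apply p h + e * norm h)"
    proof
      fix x assume x: "x \<in> Y"
      obtain p where p: "energy_conj x \<le> blinfun_apply p x - energy p" using maximizer_exists[OF x] by blast
      show "\<exists>p. norm p \<le> norm x \<and> (\<forall>e>0. \<exists>d>0. \<forall>h\<in>Y. norm h < d \<longrightarrow> energy_conj (x + h) \<le> energy_conj x + blinfun_apply p h + e * norm h)"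
        by (intro exI[of _ p] conjI allI impI maximizer_norm[OF p] energy_conj_superdifferentiable[OF p maximizer_strong[OF x p]])
    qed
  qed
qed

section \<open>The smooth variational principle and sums of translates\<close>

text \<open>As in Ekeland's principle, but the perturbations are multiples of \<open>\<rho> _ (zs i)\<close>, which inherit smoothness from
\<open>\<rho>\<close>. The centres are chosen so that \<open>zs (Suc n)\<close> minimizes up to \<open>\<epsilon> n\<close> the function perturbed so far. This is
small compared with the next weight \<open>\<mu> (Suc n)\<close>, so the quadratic lower bound on \<open>\<rho>\<close> makes the
sublevel sets \<open>S n\<close> shrink to a point.\<close>

theorem Borwein_Preiss:
  fixes F :: "'b::complete_space \<Rightarrow> real" and \<rho> :: "'b \<Rightarrow> 'b \<Rightarrow> real" and \<mu> :: "nat \<Rightarrow> real"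
  assumes M: "closed M" "z0 \<in> M"
    and lsc: "\<And>u w a. (\<forall>n::nat. u n \<in> M \<and> F (u n) \<le> a) \<Longrightarrow> u \<longlonglongrightarrow> w \<Longrightarrow> F w \<le> a"
    and low: "\<And>w. w \<in> M \<Longrightarrow> m \<le> F w"
    and \<rho>: "\<And>w z. 0 \<le> \<rho> w z" "\<And>z. \<rho> z z = 0" "\<And>z. continuous_on UNIV (\<lambda>w. \<rho> w z)"
    and c: "c > 0" "\<And>w z. c * (dist w z)\<^sup>2 \<le> \<rho> w z"
    and R: "\<And>w z. w \<in> M \<Longrightarrow> z \<in> M \<Longrightarrow> \<rho> w z \<le> R"
    and \<mu>: "\<And>n. \<mu> n > 0" "summable \<mu>"
  obtains z zs where "z \<in> M" "\<forall>i::nat. zs i \<in> M" "F z + (\<Sum>i. \<mu> i * \<rho> z (zs i)) \<le> F z0"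
    "\<forall>w\<in>M. F z + (\<Sum>i. \<mu> i * \<rho> z (zs i)) \<le> F w + (\<Sum>i. \<mu> i * \<rho> w (zs i))"
proof -
  \<comment> \<open>With this accuracy \<open>S (Suc n)\<close> lies within \<open>(1/2)^n\<close> of \<open>zs (Suc n)\<close>.\<close>
  define \<epsilon> where "\<epsilon> n = \<mu> (Suc n) * (c * ((1/2)^n)\<^sup>2)" for n
  have \<epsilon>: "\<epsilon> n > 0" for n using \<mu>(1) c(1) by (simp add: \<epsilon>_def)
  define P where "P n s \<longleftrightarrow> fst s \<in> M \<and> (\<forall>w\<in>M. m \<le> snd s w) \<and> (n = 0 \<longrightarrow> s = (z0, F))"
    for n :: nat and s :: "'b \<times> ('b \<Rightarrow> real)"
  define Q where "Q n s t \<longleftrightarrow> snd t = (\<lambda>w. snd s w + \<mu> n * \<rho> w (fst s)) \<and> snd t (fst t) \<le> snd t (fst s) \<and>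
      (\<forall>w\<in>M. snd t w \<le> snd t (fst s) \<longrightarrow> snd t (fst t) \<le> snd t w + \<epsilon> n)"
    for n and s t :: "'b \<times> ('b \<Rightarrow> real)"
  have "\<exists>f. \<forall>n. P n (f n) \<and> Q n (f n) (f (Suc n))"
  proof (rule dependent_nat_choice)
    show "\<exists>s. P 0 s" by (rule exI[of _ "(z0, F)"]) (simp add: P_def M low)
    fix s n assume s: "P n s"
    define H where "H w = snd s w + \<mu> n * \<rho> w (fst s)" for w
    define S where "S = {w \<in> M. H w \<le> H (fst s)}"
    have Hm: "m \<le> H w" if "w \<in> M" for w
    proof -
      have "m \<le> snd s w" using s that by (simp add: P_def)
      moreover have "0 \<le> \<mu> n * \<rho> w (fst s)" using \<mu>(1)[of n] \<rho>(1) by simp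
      ultimately show ?thesis by (simp add: H_def)
    qed
    have bdd: "bdd_below (H ` S)" using Hm by (intro bdd_belowI2[of _ m]) (simp add: S_def)
    have S: "fst s \<in> S" using s by (simp add: S_def P_def)
    then obtain z where z: "z \<in> S" "H z < Inf (H ` S) + \<epsilon> n"
      using cInf_lessD[of "H ` S" "Inf (H ` S) + \<epsilon> n"] \<epsilon>[of n] by auto
    have "H z \<le> H w + \<epsilon> n" if "w \<in> S" for w
      using z(2) cINF_lower[OF bdd that] by simp
    then have "P (Suc n) (z, H)" "Q n s (z, H)" using z(1) Hm by (auto simp: P_def Q_def S_def H_def)
    then show "\<exists>t. P (Suc n) t \<and> Q n s t" by blast
  qed
  then obtain f where f: "\<forall>n. P n (f n) \<and> Q n (f n) (f (Suc n))" by blast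
  define zs where "zs n = fst (f n)" for n
  define H where "H n = snd (f n)" for n
  have z0: "zs 0 = z0" "H 0 = F" using f[rule_format, of 0] by (auto simp: P_def zs_def H_def)
  have zsM: "zs n \<in> M" for n using f[rule_format, of n] by (simp add: P_def zs_def)
  have H_Suc: "H (Suc n) w = H n w + \<mu> n * \<rho> w (zs n)" for n w
    using f[rule_format, of n] by (simp add: Q_def zs_def H_def)
  have H_sum: "H n w = F w + (\<Sum>j<n. \<mu> j * \<rho> w (zs j))" for n w
    by (induction n) (auto simp: z0 H_Suc)
  have Hzs: "H (Suc n) (zs n) = H n (zs n)" for n by (simp add: H_Suc \<rho>(2))
  have "H (Suc n) (zs (Suc n)) \<le> H (Suc n) (zs n)" for n
    using f[rule_format, of n] unfolding Q_def zs_def H_def by blast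
  then have desc: "H (Suc n) (zs (Suc n)) \<le> H n (zs n)" for n by (simp only: Hzs)
  have "H (Suc n) (zs (Suc n)) \<le> H (Suc n) w + \<epsilon> n" if "w \<in> M" "H (Suc n) w \<le> H (Suc n) (zs n)" for n w
    using f[rule_format, of n] that unfolding Q_def zs_def H_def by blast
  then have near: "H (Suc n) (zs (Suc n)) \<le> H (Suc n) w + \<epsilon> n" if "w \<in> M" "H (Suc n) w \<le> H n (zs n)" for n w
    using that by (simp only: Hzs)
  define S where "S n = {w \<in> M. H (Suc n) w \<le> H n (zs n)}" for n
  have H_mono: "H n w \<le> H (Suc n) w" for n w using H_Suc[of n w] \<mu>(1)[of n] \<rho>(1)[of w "zs n"] by simp
  have S_Suc: "S (Suc n) \<subseteq> S n" for n
    using desc[of n] H_mono[of "Suc n"] by (force simp: S_def intro: order_trans)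
  have S_anti: "S j \<subseteq> S i" if "i \<le> j" for i j using lift_Suc_antimono_le[of S, OF S_Suc that] .
  have zsS: "zs n \<in> S n" for n using zsM H_Suc[of n "zs n"] by (simp add: S_def \<rho>(2))
  have diam: "dist w (zs (Suc n)) \<le> (1/2)^n" if w: "w \<in> S (Suc n)" for n w
  proof -
    have "w \<in> S n" using w S_Suc by blast
    then have "H (Suc n) (zs (Suc n)) \<le> H (Suc n) w + \<epsilon> n" by (intro near) (auto simp: S_def)
    moreover have "H (Suc (Suc n)) w \<le> H (Suc n) (zs (Suc n))" using w by (simp add: S_def)
    ultimately have "\<mu> (Suc n) * \<rho> w (zs (Suc n)) \<le> \<mu> (Suc n) * (c * ((1/2)^n)\<^sup>2)"
      using H_Suc[of "Suc n" w] by (simp add: \<epsilon>_def)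
    then have "\<rho> w (zs (Suc n)) \<le> c * ((1/2)^n)\<^sup>2" using \<mu>(1)[of "Suc n"] by (simp only: mult_le_cancel_left_pos)
    with c(2)[of w "zs (Suc n)"] have "c * (dist w (zs (Suc n)))\<^sup>2 \<le> c * ((1/2)^n)\<^sup>2" by linarith
    then have "(dist w (zs (Suc n)))\<^sup>2 \<le> ((1/2)^n)\<^sup>2" using c(1) by (simp only: mult_le_cancel_left_pos)
    then show ?thesis by (rule power2_le_imp_le) simp
  qed
  have half: "\<exists>N. (1/2)^N < e" if "e > 0" for e :: real using real_arch_pow_inv[OF that, of "1/2"] by simp
  have "Cauchy zs"
  proof (rule metric_CauchyI)
    fix e :: real assume "e > 0"
    then obtain N where N: "(1/2)^N < e/2" using half[of "e/2"] by auto
    have "dist (zs i) (zs j) < e" if "i \<ge> Suc N" "j \<ge> Suc N" for i j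
    proof -
      have "zs i \<in> S (Suc N)" "zs j \<in> S (Suc N)" using zsS S_anti that by blast+
      then show ?thesis using diam[of "zs i" N] diam[of "zs j" N] dist_triangle2[of "zs i" "zs j" "zs (Suc N)"] N by linarith
    qed
    then show "\<exists>N. \<forall>i\<ge>N. \<forall>j\<ge>N. dist (zs i) (zs j) < e" by blast
  qed
  then obtain z where z: "zs \<longlonglongrightarrow> z" using Cauchy_convergent convergent_def by blast
  have zM: "z \<in> M" using closed_sequentially[OF M(1) _ z] zsM by blast
  have zS: "z \<in> S n" for n
  proof -
    define k where "k w = (\<Sum>j<Suc n. \<mu> j * \<rho> w (zs j))" for w
    have "continuous_on UNIV k" unfolding k_def by (intro continuous_intros \<rho>(3))
    then have kz: "(\<lambda>i. k (zs i)) \<longlonglongrightarrow> k z" using z by (simp add: continuous_on_eq_continuous_at isCont_tendsto_compose)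
    have "F z \<le> H n (zs n) - k z"
    proof (rule field_le_epsilon)
      fix e :: real assume "e > 0"
      then have "\<forall>\<^sub>F i in sequentially. k z - e < k (zs i)" using order_tendstoD(1)[OF kz, of "k z - e"] by simp
      then obtain N where N: "\<And>i. i \<ge> N \<Longrightarrow> k z - e < k (zs i)" by (auto simp: eventually_sequentially)
      have "\<forall>i. zs (i + (N + n)) \<in> M \<and> F (zs (i + (N + n))) \<le> H n (zs n) - k z + e"
      proof
        fix i
        have "zs (i + (N + n)) \<in> S n" using zsS S_anti[of n "i + (N + n)"] by auto
        then have "F (zs (i + (N + n))) + k (zs (i + (N + n))) \<le> H n (zs n)" by (simp add: S_def H_sum k_def)
        then show "zs (i + (N + n)) \<in> M \<and> F (zs (i + (N + n))) \<le> H n (zs n) - k z + e"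
          using N[of "i + (N + n)"] zsM by auto
      qed
      from lsc[OF this LIMSEQ_ignore_initial_segment[OF z]] show "F z \<le> H n (zs n) - k z + e" .
    qed
    then show ?thesis using zM by (simp add: S_def H_sum k_def)
  qed
  have summ: "summable (\<lambda>i. \<mu> i * \<rho> w (zs i))" if "w \<in> M" for w
  proof (rule summable_comparison_test')
    show "summable (\<lambda>i. \<mu> i * R)" using \<mu>(2) by (rule summable_mult2)
    show "norm (\<mu> i * \<rho> w (zs i)) \<le> \<mu> i * R" for i
      using \<mu>(1)[of i] R[OF that zsM[of i]] \<rho>(1)[of w "zs i"] by (simp add: abs_mult)
  qed
  have total: "F z + (\<Sum>i. \<mu> i * \<rho> z (zs i)) \<le> H n (zs n)" for n
  proof -
    have anti: "H j (zs j) \<le> H i (zs i)" if "i \<le> j" for i j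
      using lift_Suc_antimono_le[of "\<lambda>i. H i (zs i)", OF desc that] .
    have mono: "H i z \<le> H j z" if "i \<le> j" for i j
      using lift_Suc_mono_le[of "\<lambda>i. H i z", OF H_mono that] .
    have "(\<Sum>j<N. \<mu> j * \<rho> z (zs j)) \<le> H n (zs n) - F z" for N
    proof -
      have "H N z \<le> H (Suc (N + n)) z" by (rule mono) simp
      also have "\<dots> \<le> H (N + n) (zs (N + n))" using zS[of "N + n"] by (simp add: S_def)
      also have "\<dots> \<le> H n (zs n)" by (rule anti) simp
      finally show ?thesis by (simp add: H_sum)
    qed
    then have "(\<Sum>i. \<mu> i * \<rho> z (zs i)) \<le> H n (zs n) - F z" by (rule suminf_le_const[OF summ[OF zM]])
    then show ?thesis by simp
  qed
  show ?thesis
  proof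
    show "z \<in> M" by (rule zM)
    show "\<forall>i. zs i \<in> M" using zsM by blast
    show "F z + (\<Sum>i. \<mu> i * \<rho> z (zs i)) \<le> F z0" using total[of 0] by (simp add: z0)
    show "\<forall>w\<in>M. F z + (\<Sum>i. \<mu> i * \<rho> z (zs i)) \<le> F w + (\<Sum>i. \<mu> i * \<rho> w (zs i))"
    proof
      fix w assume w: "w \<in> M"
      show "F z + (\<Sum>i. \<mu> i * \<rho> z (zs i)) \<le> F w + (\<Sum>i. \<mu> i * \<rho> w (zs i))"
      proof (cases "\<forall>n. w \<in> S n")
        case True
        have "dist w z < e" if e: "e > 0" for e
        proof -
          obtain N where N: "(1/2)^N < e/2" using half[OF half_gt_zero[OF e]] by blast
          have "w \<in> S (Suc N)" using True by blast
          then show ?thesis using diam[of w N] diam[OF zS[of "Suc N"]] dist_triangle2[of w z "zs (Suc N)"] N by linarith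
        qed
        then have "w = z" using zero_less_dist_iff[of w z] by blast
        then show ?thesis by simp
      next
        case False
        then obtain n where "w \<notin> S n" by blast
        then have "H n (zs n) \<le> H (Suc n) w" using w by (simp add: S_def)
        also have "\<dots> \<le> F w + (\<Sum>i. \<mu> i * \<rho> w (zs i))"
          unfolding H_sum using sum_le_suminf[OF summ[OF w], of "{..<Suc n}"] \<mu>(1) \<rho>(1)
          by (simp add: less_imp_le del: sum.lessThan_Suc)
        finally show ?thesis using total[of n] by linarith
      qed
    qed
  qed
qed

text \<open>One half of Frechet differentiability along a subspace.\<close>

definition superdiff_on :: "'a::real_normed_vector set \<Rightarrow> ('a \<Rightarrow> real) \<Rightarrow> 'a \<Rightarrow> ('a \<Rightarrow>\<^sub>L real) \<Rightarrow> bool" where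
  "superdiff_on Y g x p \<longleftrightarrow>
    (\<forall>e>0. \<exists>d>0. \<forall>h\<in>Y. norm h < d \<longrightarrow> g (x + h) \<le> g x + blinfun_apply p h + e * norm h)"

lemma superdiff_onE:
  assumes "superdiff_on Y g x p" "e > 0"
  obtains d where "d > 0" "\<forall>h\<in>Y. norm h < d \<longrightarrow> g (x + h) \<le> g x + blinfun_apply p h + e * norm h"
proof -
  have "\<exists>d>0. \<forall>h\<in>Y. norm h < d \<longrightarrow> g (x + h) \<le> g x + blinfun_apply p h + e * norm h"
    by (rule assms(1)[unfolded superdiff_on_def, THEN spec, THEN mp, OF assms(2)])
  then show ?thesis by (elim exE conjE) (rule that)
qed

text \<open>Finitely many terms are treated individually and the tail by the local Lipschitz bound on \<open>g\<close>, which is uniform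
since \<open>x - a i\<close> stays bounded.\<close>

lemma superdiff_on_series:
  fixes g :: "'a::real_normed_vector \<Rightarrow> real" and a :: "nat \<Rightarrow> 'a"
  assumes g: "\<forall>x. 0 \<le> g x" "\<forall>x. g x \<le> (norm x)\<^sup>2 / 4" "\<forall>x h. g (x + h) - g x \<le> (norm (x + h) + 1) * norm h"
    and p: "\<And>i. superdiff_on Y g (x - a i) (p i)" "\<And>i. norm (p i) \<le> R" and R: "\<And>i. norm (x - a i) \<le> R"
    and \<mu>: "\<And>i. \<mu> i > 0" "summable \<mu>"
  shows "superdiff_on Y (\<lambda>w. \<Sum>i. \<mu> i * g (w - a i)) x (\<Sum>i. \<mu> i *\<^sub>R p i)"
    and "norm (\<Sum>i. \<mu> i *\<^sub>R p i) \<le> suminf \<mu> * R"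
proof -
  have R0: "0 \<le> R" using R[of 0] norm_ge_zero order_trans by blast
  have sn: "summable (\<lambda>i. norm (\<mu> i *\<^sub>R p i))"
  proof (rule summable_comparison_test')
    show "summable (\<lambda>i. \<mu> i * R)" using \<mu>(2) by (rule summable_mult2)
    show "norm (norm (\<mu> i *\<^sub>R p i)) \<le> \<mu> i * R" for i using p(2)[of i] \<mu>(1)[of i] by simp
  qed
  then have sp: "summable (\<lambda>i. \<mu> i *\<^sub>R p i)" by (rule summable_norm_cancel)
  have "norm (\<Sum>i. \<mu> i *\<^sub>R p i) \<le> (\<Sum>i. norm (\<mu> i *\<^sub>R p i))" by (rule summable_norm[OF sn])
  also have "\<dots> \<le> (\<Sum>i. \<mu> i * R)"
    using p(2) \<mu>(1) by (intro suminf_le sn summable_mult2 \<mu>(2)) (simp add: less_imp_le mult_left_mono)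
  also have "\<dots> = suminf \<mu> * R" using \<mu>(2) by (rule suminf_mult2[symmetric])
  finally show "norm (\<Sum>i. \<mu> i *\<^sub>R p i) \<le> suminf \<mu> * R" .
  have ev: "(\<Sum>i. \<mu> i *\<^sub>R p i) h = (\<Sum>i. \<mu> i * p i h)" "summable (\<lambda>i. \<mu> i * p i h)" for h
  proof -
    have bl: "bounded_linear (\<lambda>f. blinfun_apply f h)" by (rule bounded_linear_intros)+
    show "(\<Sum>i. \<mu> i *\<^sub>R p i) h = (\<Sum>i. \<mu> i * p i h)" "summable (\<lambda>i. \<mu> i * p i h)"
      using bounded_linear.suminf[OF bl sp] bounded_linear.summable[OF bl sp] by (simp_all add: blinfun.scaleR_left)
  qed
  have sg: "summable (\<lambda>i. \<mu> i * g (x + h - a i))" for h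
  proof (rule summable_comparison_test')
    show "summable (\<lambda>i. \<mu> i * ((R + norm h)\<^sup>2 / 4))" using \<mu>(2) by (rule summable_mult2)
    fix i
    have "norm (x + h - a i) \<le> R + norm h" using R[of i] norm_triangle_ineq[of "x - a i" h] by (simp add: algebra_simps)
    then have "(norm (x + h - a i))\<^sup>2 \<le> (R + norm h)\<^sup>2" by (rule power_mono) simp
    then have "g (x + h - a i) \<le> (R + norm h)\<^sup>2 / 4" using g(2)[rule_format, of "x + h - a i"] by linarith
    then show "norm (\<mu> i * g (x + h - a i)) \<le> \<mu> i * ((R + norm h)\<^sup>2 / 4)"
      using \<mu>(1)[of i] g(1) by (simp add: abs_mult mult_left_mono)
  qed
  show "superdiff_on Y (\<lambda>w. \<Sum>i. \<mu> i * g (w - a i)) x (\<Sum>i. \<mu> i *\<^sub>R p i)"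
    unfolding superdiff_on_def
  proof (intro allI impI)
    fix e :: real assume e: "e > 0"
    define B where "B = 2 * R + 2"
    have B: "B > 0" using R0 by (simp add: B_def)
    define e' where "e' = e / 2 / (suminf \<mu> + 1)"
    have s0: "0 \<le> suminf \<mu>" by (rule suminf_nonneg[OF \<mu>(2)]) (simp add: \<mu>(1) less_imp_le)
    have e': "e' > 0" "suminf \<mu> * e' \<le> e/2" using e s0 by (auto simp: e'_def field_simps)
    obtain N where N: "\<And>n. n \<ge> N \<Longrightarrow> norm (\<Sum>i. \<mu> (i + n)) < e / 2 / B"
      using suminf_exist_split[of "e/2/B" \<mu>] e B \<mu>(2) by auto
    have "\<bar>\<Sum>i. \<mu> (i + N)\<bar> * B < e/2" using N[of N] B by (simp add: pos_less_divide_eq mult.assoc)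
    then have tail: "(\<Sum>i. \<mu> (i + N)) * B \<le> e/2"
      using mult_right_mono[OF abs_ge_self less_imp_le[OF B]] by (meson less_imp_le order_trans)
    have "\<forall>i. \<exists>d>0. \<forall>h\<in>Y. norm h < d \<longrightarrow> g (x - a i + h) \<le> g (x - a i) + blinfun_apply (p i) h + e' * norm h"
      using p(1) e'(1) unfolding superdiff_on_def by blast
    then obtain d where d: "\<And>i. d i > 0"
      "\<And>i h. h \<in> Y \<Longrightarrow> norm h < d i \<Longrightarrow> g (x - a i + h) \<le> g (x - a i) + blinfun_apply (p i) h + e' * norm h" by metis
    define d' where "d' = Min (insert 1 (d ` {..<N}))"
    have d': "d' > 0" "d' \<le> 1" "\<And>i. i < N \<Longrightarrow> d' \<le> d i" using d(1) by (auto simp: d'_def)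
    have "(\<Sum>i. \<mu> i * g (x + h - a i)) \<le> (\<Sum>i. \<mu> i * g (x - a i)) + (\<Sum>i. \<mu> i *\<^sub>R p i) h + e * norm h"
      if h: "h \<in> Y" "norm h < d'" for h
    proof -
      define b where "b i = (if i < N then e' else B)" for i
      have step: "g (x + h - a i) - g (x - a i) - p i h \<le> b i * norm h" for i
      proof (cases "i < N")
        case True
        then have "norm h < d i" using h(2) d'(3) by fastforce
        from d(2)[OF h(1) this] show ?thesis using True by (simp add: b_def algebra_simps)
      next
        case False
        have eq: "x + h - a i = x - a i + h" by simp
        have "norm (x - a i + h) \<le> R + 1" using R[of i] norm_triangle_ineq[of "x - a i" h] h(2) d'(2) by linarith
        then have "(norm (x - a i + h) + 1) * norm h \<le> (R + 2) * norm h" by (intro mult_right_mono) auto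
        moreover have "- p i h \<le> R * norm h"
          using norm_blinfun[of "p i" h] mult_right_mono[OF p(2)[of i] norm_ge_zero[of h]] by simp
        ultimately have "g (x + h - a i) - g (x - a i) - p i h \<le> (R + 2) * norm h + R * norm h"
          using g(3)[rule_format, of "x - a i" h] unfolding eq by linarith
        then show ?thesis using False by (simp add: b_def B_def algebra_simps)
      qed
      have sb: "summable (\<lambda>i. \<mu> i * b i)"
      proof (rule summable_comparison_test')
        show "summable (\<lambda>i. \<mu> i * max e' B)" using \<mu>(2) by (rule summable_mult2)
        show "norm (\<mu> i * b i) \<le> \<mu> i * max e' B" for i
          using \<mu>(1)[of i] e'(1) B by (simp add: b_def abs_mult mult_left_mono)
      qed
      have "(\<Sum>i. \<mu> i * b i) = (\<Sum>i. \<mu> (i + N) * b (i + N)) + (\<Sum>i<N. \<mu> i * b i)"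
        by (rule suminf_split_initial_segment[OF sb])
      also have "(\<Sum>i. \<mu> (i + N) * b (i + N)) = (\<Sum>i. \<mu> (i + N)) * B"
        using suminf_mult2[OF summable_ignore_initial_segment[OF \<mu>(2)], of N B] by (simp add: b_def)
      also have "(\<Sum>i<N. \<mu> i * b i) = (\<Sum>i<N. \<mu> i) * e'" by (simp add: b_def sum_distrib_right)
      also have "(\<Sum>i<N. \<mu> i) * e' \<le> suminf \<mu> * e'"
        using e'(1) \<mu> by (intro mult_right_mono sum_le_suminf) (auto simp: less_imp_le)
      finally have "(\<Sum>i. \<mu> i * b i) \<le> e" using tail e'(2) by linarith
      then have be: "(\<Sum>i. \<mu> i * b i) * norm h \<le> e * norm h" by (rule mult_right_mono) simp
      have "(\<Sum>i. \<mu> i * g (x + h - a i)) - (\<Sum>i. \<mu> i * g (x - a i)) - (\<Sum>i. \<mu> i * p i h) =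
          (\<Sum>i. \<mu> i * g (x + h - a i) - \<mu> i * g (x - a i) - \<mu> i * p i h)"
        using sg[of h] sg[of 0] ev(2)[of h] by (simp add: suminf_diff summable_diff)
      also have "\<dots> \<le> (\<Sum>i. \<mu> i * b i * norm h)"
      proof (rule suminf_le)
        show "\<mu> i * g (x + h - a i) - \<mu> i * g (x - a i) - \<mu> i * p i h \<le> \<mu> i * b i * norm h" for i
          using mult_left_mono[OF step[of i] less_imp_le[OF \<mu>(1)[of i]]] by (simp add: algebra_simps)
        show "summable (\<lambda>i. \<mu> i * g (x + h - a i) - \<mu> i * g (x - a i) - \<mu> i * p i h)"
          using sg[of h] sg[of 0] ev(2)[of h] by (intro summable_diff) auto
        show "summable (\<lambda>i. \<mu> i * b i * norm h)" using sb by (rule summable_mult2)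
      qed
      also have "\<dots> = (\<Sum>i. \<mu> i * b i) * norm h" by (rule suminf_mult2[OF sb, symmetric])
      finally show ?thesis using be unfolding ev(1) by linarith
    qed
    then show "\<exists>d>0. \<forall>h\<in>Y. norm h < d \<longrightarrow> (\<Sum>i. \<mu> i * g (x + h - a i)) \<le>
        (\<Sum>i. \<mu> i * g (x - a i)) + (\<Sum>i. \<mu> i *\<^sub>R p i) h + e * norm h" using d'(1) by blast
  qed
qed

section \<open>Subgradients determined by a countable set\<close>

text \<open>The constraints are passed through the cone generated by the convex hull of \<open>S\<close>.\<close>

lemma linear_below_constraints:
  fixes N :: "'b::real_vector \<Rightarrow> real"
  assumes N: "sublinear N" and S: "\<And>v s. (v, s) \<in> convex hull S \<Longrightarrow> 0 \<le> s + N (- v)"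
  obtains \<xi> where "linear \<xi>" "\<forall>v. \<xi> v \<le> N v" "\<forall>(h, r)\<in>S. \<xi> h \<le> r"
proof -
  define K where "K = insert (0, 0) {t *\<^sub>R a | t a. t > 0 \<and> a \<in> convex hull S}"
  have KI: "t *\<^sub>R a \<in> K" if "t > 0" "a \<in> convex hull S" for t a using that unfolding K_def by blast
  have KE: "\<exists>t a'. a = t *\<^sub>R a' \<and> t > 0 \<and> a' \<in> convex hull S" if "a \<in> K" "a \<noteq> (0, 0)" for a
    using that unfolding K_def by blast
  obtain r where r: "sublinear r" and rle: "\<And>x w s. (w, s) \<in> K \<Longrightarrow> r x \<le> N (x - w) + s"
  proof (rule constrained_minorant[OF N, of K])
    show "(0, 0) \<in> K" by (simp add: K_def)
    show "a + b \<in> K" if ab: "a \<in> K" "b \<in> K" for a b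
    proof (cases "a = (0, 0) \<or> b = (0, 0)")
      case True
      then show ?thesis using ab by (auto simp: zero_prod_def[symmetric])
    next
      case False
      then obtain t u a' b' where a: "a = t *\<^sub>R a'" "t > 0" "a' \<in> convex hull S"
        and b: "b = u *\<^sub>R b'" "u > 0" "b' \<in> convex hull S"
        using KE[OF ab(1)] KE[OF ab(2)] by blast
      have "(t / (t + u)) *\<^sub>R a' + (u / (t + u)) *\<^sub>R b' \<in> convex hull S"
        using a b by (intro convexD[OF convex_convex_hull]) (auto simp: add_divide_distrib[symmetric])
      from KI[OF _ this, of "t + u"] show ?thesis using a b by (simp add: scaleR_add_right)
    qed
    show "t *\<^sub>R a \<in> K" if t: "t > 0" and a: "a \<in> K" for t a
    proof (cases "a = (0, 0)")
      case True
      then show ?thesis by (simp add: K_def)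
    next
      case False
      then obtain u a' where "a = u *\<^sub>R a'" "u > 0" "a' \<in> convex hull S" using KE[OF a] by blast
      then show ?thesis using KI[of "t * u" a'] t by simp
    qed
    show "0 \<le> N (- w) + s" if ws: "(w, s) \<in> K" for w s
    proof (cases "(w, s) = (0, 0)")
      case True
      then show ?thesis using sublinearD(3)[OF N] by simp
    next
      case False
      then obtain t a' where "(w, s) = t *\<^sub>R a'" "t > 0" "a' \<in> convex hull S" using KE[OF ws] by blast
      then obtain v s' where t: "(w, s) = t *\<^sub>R (v, s')" "t > 0" "(v, s') \<in> convex hull S" by (cases a') blast
      have "N (- w) = t * N (- v)" using t sublinearD(2)[OF N, of t "- v"] by simp
      then have "N (- w) + s = t * (s' + N (- v))" using t by (simp add: algebra_simps)
      then show ?thesis using t(2) S[OF t(3)] by simp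
    qed
  qed blast
  obtain \<xi> where \<xi>: "linear \<xi>" "\<And>x. \<xi> x \<le> r x" using linear_minorant_exists[OF r] by blast
  show ?thesis
  proof
    show "linear \<xi>" by fact
    have "(0, 0) \<in> K" by (simp add: K_def)
    from rle[OF this] \<xi>(2) show "\<forall>v. \<xi> v \<le> N v" by (auto intro: order_trans)
    have "\<xi> h \<le> s" if "(h, s) \<in> S" for h s
    proof -
      have "(h, s) \<in> K" using KI[of 1 "(h, s)"] hull_inc[OF that] by simp
      from rle[OF this, of h] \<xi>(2)[of h] show ?thesis using sublinearD(3)[OF N] by simp
    qed
    then show "\<forall>(h, r)\<in>S. \<xi> h \<le> r" by auto
  qed
qed

text \<open>A linear \<open>\<xi>\<close> is a Frechet subgradient of \<open>F\<close> at \<open>x\<close> relative to \<open>U\<close>, with \<open>r = F x\<close> and radius \<open>\<delta> n\<close> for the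
tolerance \<open>1/(n + 1)\<close>, iff \<open>\<xi> h \<le> s\<close> for every \<open>(h, s)\<close> in this set. The value \<open>r\<close> is kept separate
from \<open>F x\<close> so that it can be replaced by a rational number.\<close>

definition secants :: "('b::real_normed_vector \<Rightarrow> real) \<Rightarrow> 'b set \<Rightarrow> 'b \<Rightarrow> real \<Rightarrow> (nat \<Rightarrow> real) \<Rightarrow> nat set \<Rightarrow> ('b \<times> real) set" where
  "secants F U x r \<delta> I = (\<lambda>(u, n). (u - x, F u - r + norm (u - x) / (real n + 1))) ` {(u, n). u \<in> U \<and> n \<in> I \<and> norm (u - x) < \<delta> n}"

lemma secants_mono: "U \<subseteq> U' \<Longrightarrow> I \<subseteq> I' \<Longrightarrow> secants F U x r \<delta> I \<subseteq> secants F U' x r \<delta> I'"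
  unfolding secants_def by (intro image_mono) auto

lemma secants_hull_finite:
  assumes "a \<in> convex hull (secants F U x r \<delta> I)"
  obtains U' m where "finite U'" "U' \<subseteq> U" "a \<in> convex hull (secants F U' x r \<delta> (I \<inter> {..<m}))"
proof -
  obtain S w where S: "finite S" "S \<subseteq> secants F U x r \<delta> I" "\<forall>x\<in>S. 0 \<le> w x" "sum w S = 1" "(\<Sum>v\<in>S. w v *\<^sub>R v) = a"
    using assms unfolding convex_hull_explicit by blast
  have a: "a \<in> convex hull S" using S(1,3-5) unfolding convex_hull_finite[OF S(1)] by blast
  obtain C where C: "C \<subseteq> {(u, n). u \<in> U \<and> n \<in> I \<and> norm (u - x) < \<delta> n}" "finite C"
    "S = (\<lambda>(u, n). (u - x, F u - r + norm (u - x) / (real n + 1))) ` C"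
    using finite_subset_image[OF S(1) S(2)[unfolded secants_def]] by blast
  obtain m where m: "snd ` C \<subseteq> {..<m}" using finite_nat_bounded[of "snd ` C"] C(2) by auto
  have "C \<subseteq> {(u, n). u \<in> fst ` C \<and> n \<in> I \<inter> {..<m} \<and> norm (u - x) < \<delta> n}"
  proof
    fix c assume c: "c \<in> C"
    then have "fst c \<in> fst ` C" "snd c \<in> {..<m}" using m by blast+
    then show "c \<in> {(u, n). u \<in> fst ` C \<and> n \<in> I \<inter> {..<m} \<and> norm (u - x) < \<delta> n}" using c C(1) by (cases c) auto
  qed
  then have "S \<subseteq> secants F (fst ` C) x r \<delta> (I \<inter> {..<m})" unfolding C(3) secants_def by (rule image_mono)
  then have "a \<in> convex hull (secants F (fst ` C) x r \<delta> (I \<inter> {..<m}))" using a hull_mono by blast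
  moreover have "finite (fst ` C)" "fst ` C \<subseteq> U" using C by auto
  ultimately show ?thesis using that by blast
qed

text \<open>For \<open>\<sigma> = 0\<close> this is, by \<open>linear_below_constraints\<close>, the only obstruction to a linear \<open>\<xi> \<le> N\<close> below the secants
of the first \<open>m\<close> tolerances; a margin \<open>\<sigma> > 0\<close> makes it stable under perturbation.\<close>

definition infeasible :: "('b::real_normed_vector \<Rightarrow> real) \<Rightarrow> ('b \<Rightarrow> real) \<Rightarrow> 'b set \<Rightarrow> 'b \<Rightarrow> real \<Rightarrow> real \<Rightarrow> (nat \<Rightarrow> real) \<Rightarrow> nat \<Rightarrow> bool" where
  "infeasible N F U x r \<sigma> \<delta> m \<longleftrightarrow> (\<exists>(v, s)\<in>convex hull (secants F U x r \<delta> {..<m}). s + N (- v) < - \<sigma>)"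

lemma infeasible_mono:
  assumes "infeasible N F U x r \<sigma> \<delta> m" "U \<subseteq> U'" "\<sigma>' \<le> \<sigma>"
  shows "infeasible N F U' x r \<sigma>' \<delta> m"
proof -
  obtain v s where vs: "(v, s) \<in> convex hull (secants F U x r \<delta> {..<m})" "s + N (- v) < - \<sigma>"
    using assms(1) unfolding infeasible_def by blast
  have "(v, s) \<in> convex hull (secants F U' x r \<delta> {..<m})"
    using vs(1) hull_mono[OF secants_mono[OF assms(2) subset_refl]] by blast
  moreover have "s + N (- v) < - \<sigma>'" using vs(2) assms(3) by linarith
  ultimately show ?thesis unfolding infeasible_def by blast
qed

lemma infeasible_finite:
  assumes "infeasible N F U x r \<sigma> \<delta> m"
  shows "\<exists>U'. finite U' \<and> U' \<subseteq> U \<and> infeasible N F U' x r \<sigma> \<delta> m"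
proof -
  obtain v s where vs: "(v, s) \<in> convex hull (secants F U x r \<delta> {..<m})" "s + N (- v) < - \<sigma>"
    using assms unfolding infeasible_def by blast
  obtain U' k where U': "finite U'" "U' \<subseteq> U" "(v, s) \<in> convex hull (secants F U' x r \<delta> ({..<m} \<inter> {..<k}))"
    by (rule secants_hull_finite[OF vs(1)])
  have "secants F U' x r \<delta> ({..<m} \<inter> {..<k}) \<subseteq> secants F U' x r \<delta> {..<m}" by (rule secants_mono) auto
  then have "(v, s) \<in> convex hull (secants F U' x r \<delta> {..<m})" using U'(3) hull_mono by blast
  then show ?thesis using U' vs(2) unfolding infeasible_def by blast
qed

text \<open>A small change of \<open>x\<close> and \<open>r\<close> moves every secant by a vector of the convex set \<open>B\<close>; the Minkowski sum of the
perturbed hull with \<open>B\<close> is convex, hence contains the whole original hull.\<close>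

lemma infeasible_perturb:
  assumes N: "sublinear N" "\<And>v. N v \<le> L * norm v" "0 \<le> L"
    and inf: "infeasible N F U x r \<sigma> \<delta> m"
    and near: "norm (x - x') \<le> \<eta>" "\<bar>r - r'\<bar> \<le> \<eta>" "\<And>n. n < m \<Longrightarrow> \<delta> n + \<eta> \<le> \<delta>' n"
  shows "infeasible N F U x' r' (\<sigma> - (2 + L) * \<eta>) \<delta>' m"
proof -
  define H where "H = convex hull (secants F U x' r' \<delta>' {..<m})"
  define B where "B = cball (0 :: 'a) \<eta> \<times> {- 2 * \<eta>..}"
  have "convex (\<Union>a\<in>H. \<Union>b\<in>B. {a + b})"
    unfolding H_def B_def by (intro convex_sums convex_convex_hull convex_Times convex_cball convex_real_interval)
  moreover have "secants F U x r \<delta> {..<m} \<subseteq> (\<Union>a\<in>H. \<Union>b\<in>B. {a + b})"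
  proof
    fix a assume "a \<in> secants F U x r \<delta> {..<m}"
    then obtain u n where u: "a = (u - x, F u - r + norm (u - x) / (real n + 1))" "u \<in> U" "n < m" "norm (u - x) < \<delta> n"
      by (auto simp: secants_def)
    define a' where "a' = (u - x', F u - r' + norm (u - x') / (real n + 1))"
    have d1: "norm (u - x') \<le> norm (u - x) + \<eta>" using norm_triangle_ineq[of "u - x" "x - x'"] near(1) by simp
    then have "norm (u - x') < \<delta>' n" using near(3)[OF u(3)] u(4) by linarith
    then have "a' \<in> secants F U x' r' \<delta>' {..<m}" using u(2,3) by (force simp: secants_def a'_def)
    then have a'H: "a' \<in> H" unfolding H_def by (rule hull_inc)
    have "norm (u - x') / (real n + 1) \<le> (norm (u - x) + \<eta>) / (real n + 1)" using d1 by (intro divide_right_mono) auto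
    also have "\<dots> \<le> norm (u - x) / (real n + 1) + \<eta>"
    proof -
      have "0 \<le> \<eta>" using near(1) norm_ge_zero order_trans by blast
      then have "\<eta> / (real n + 1) \<le> \<eta>" by (simp add: divide_le_eq mult_left_le field_simps)
      then show ?thesis by (simp add: add_divide_distrib)
    qed
    finally have "snd a - snd a' \<ge> - 2 * \<eta>" using near(2) by (simp add: u(1) a'_def)
    moreover have "fst a - fst a' = x' - x" by (simp add: u(1) a'_def)
    ultimately have "a - a' \<in> B" using near(1) by (simp add: B_def mem_Times_iff norm_minus_commute)
    then show "a \<in> (\<Union>a\<in>H. \<Union>b\<in>B. {a + b})" using a'H by (intro UN_I[of a'] UN_I[of "a - a'"]) auto
  qed
  ultimately have sub: "convex hull (secants F U x r \<delta> {..<m}) \<subseteq> (\<Union>a\<in>H. \<Union>b\<in>B. {a + b})" by (rule hull_minimal[rotated])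
  obtain v s where vs: "(v, s) \<in> convex hull (secants F U x r \<delta> {..<m})" "s + N (- v) < - \<sigma>"
    using inf unfolding infeasible_def by blast
  obtain v' s' w t where H: "(v', s') \<in> H" and B: "(w, t) \<in> B" and eq: "v = v' + w" "s = s' + t"
    using subsetD[OF sub vs(1)] by auto
  have "N (- v') \<le> N (- v) + N w" using sublinearD(1)[OF N(1), of "- v" w] eq by simp
  moreover have "N w \<le> L * \<eta>" using N(2)[of w] mult_left_mono[OF _ N(3), of "norm w" \<eta>] B by (simp add: B_def)
  moreover have "s' \<le> s + 2 * \<eta>" using B eq by (simp add: B_def)
  ultimately have "s' + N (- v') < - (\<sigma> - (2 + L) * \<eta>)" using vs(2) by (simp add: algebra_simps)
  then show ?thesis using H unfolding infeasible_def H_def by blast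
qed

lemma rat_between: "\<exists>q. a < real_of_rat q \<and> real_of_rat q < b" if "a < b" for a b
  using of_rat_dense[OF that] by blast

text \<open>The separable reduction. If no subgradient exists, then a finite system of secants is infeasible with a positive
margin. Moving to a point \<open>x'\<close> of the countable set and to rational data, the hypothesis on \<open>D\<close> yields
an infeasible system with points in \<open>D\<close>; moving back to \<open>x\<close> contradicts the existence of the subgradient \<open>p\<close>
relative to \<open>D\<close>. Passing to \<open>x'\<close> and back enlarges the radii from \<open>d n / 2\<close> to at most \<open>d n\<close>.\<close>

lemma subgradient_from_dense_set:
  fixes F :: "'b::real_normed_vector \<Rightarrow> real"
  assumes N: "sublinear N" "\<And>v. N v \<le> L * norm v" "0 \<le> L"
    and refl: "\<And>x r \<sigma> \<delta>. x \<in> D \<Longrightarrow> infeasible N F E x (of_rat r) (of_rat \<sigma>) (\<lambda>n. of_rat (\<delta> ! n)) (length \<delta>) \<Longrightarrow>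
      infeasible N F (E \<inter> D) x (of_rat r) (of_rat \<sigma>) (\<lambda>n. of_rat (\<delta> ! n)) (length \<delta>)"
    and x: "x \<in> closure D" and p: "linear p" "\<And>v. p v \<le> N v"
    and sub: "\<forall>n::nat. \<exists>d>0. \<forall>u\<in>E \<inter> D. norm (u - x) < d \<longrightarrow> p (u - x) \<le> F u - F x + norm (u - x) / (real n + 1)"
  obtains \<xi> where "linear \<xi>" "\<forall>v. \<xi> v \<le> N v"
    "\<forall>n::nat. \<exists>d>0. \<forall>u\<in>E. norm (u - x) < d \<longrightarrow> \<xi> (u - x) \<le> F u - F x + norm (u - x) / (real n + 1)"
proof -
  from choice[OF sub] obtain d where d: "\<And>n. d n > 0"
    "\<And>n u. u \<in> E \<inter> D \<Longrightarrow> norm (u - x) < d n \<Longrightarrow> p (u - x) \<le> F u - F x + norm (u - x) / (real n + 1)" by blast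
  have feas: "0 \<le> s + N (- v)" if vs: "(v, s) \<in> convex hull (secants F E x (F x) (\<lambda>n. d n / 2) UNIV)" for v s
  proof (rule ccontr)
    assume neg: "\<not> 0 \<le> s + N (- v)"
    have "s + N (- v) < 0" using neg by simp
    then obtain z where "s + N (- v) < z" "z < 0" using dense by blast
    then obtain \<sigma> where \<sigma>: "\<sigma> > 0" "s + N (- v) < - \<sigma>" by (metis neg_0_less_iff_less minus_minus)
    obtain U m where "finite U" and U: "U \<subseteq> E" "(v, s) \<in> convex hull (secants F U x (F x) (\<lambda>n. d n / 2) (UNIV \<inter> {..<m}))"
      by (rule secants_hull_finite[OF vs])
    then have "infeasible N F U x (F x) \<sigma> (\<lambda>n. d n / 2) m" using \<sigma>(2) by (auto simp: infeasible_def)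
    then have inf: "infeasible N F E x (F x) \<sigma> (\<lambda>n. d n / 2) m" using U(1) by (rule infeasible_mono) simp
    define \<eta> where "\<eta> = Min (insert (\<sigma> / (4 * (2 + L))) ((\<lambda>n. d n / 8) ` {..<m}))"
    have \<eta>: "\<eta> > 0" using \<sigma>(1) N(3) d(1) by (simp add: \<eta>_def)
    have \<eta>2: "\<eta> \<le> \<sigma> / (4 * (2 + L))" unfolding \<eta>_def by (rule Min_le) auto
    have \<eta>3: "\<eta> \<le> d n / 8" if "n < m" for n unfolding \<eta>_def by (rule Min_le) (use that in auto)
    have L\<eta>: "(2 + L) * \<eta> \<le> \<sigma> / 4" using \<eta>2 N(3) by (simp add: pos_le_divide_eq mult.commute mult.left_commute)
    obtain x' where x': "x' \<in> D" "norm (x - x') \<le> \<eta>"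
      using x \<eta> unfolding closure_approachable by (force simp: dist_norm norm_minus_commute)
    have "F x - \<eta> < F x + \<eta>" using \<eta> by simp
    then obtain r where "F x - \<eta> < real_of_rat r \<and> real_of_rat r < F x + \<eta>" using rat_between by blast
    then have r: "\<bar>F x - of_rat r\<bar> \<le> \<eta>" by linarith
    obtain \<sigma>' where \<sigma>': "\<sigma> / 4 < of_rat \<sigma>'" "of_rat \<sigma>' < \<sigma> / 2" using rat_between[of "\<sigma> / 4" "\<sigma> / 2"] \<sigma>(1) by auto
    \<comment> \<open>Rational radii that leave room \<open>\<eta> \<le> d n / 8\<close> on both sides.\<close>
    have "\<forall>n. \<exists>q. 5/8 * d n < real_of_rat q \<and> real_of_rat q < 7/8 * d n" using d(1) by (intro allI rat_between) simp
    then obtain q where q: "\<And>n. 5/8 * d n < real_of_rat (q n)" "\<And>n. real_of_rat (q n) < 7/8 * d n" by metis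
    define \<delta> where "\<delta> = map q [0..<m]"
    have \<delta>: "length \<delta> = m" "\<And>n. n < m \<Longrightarrow> \<delta> ! n = q n" by (auto simp: \<delta>_def)
    have "infeasible N F E x' (of_rat r) (\<sigma> - (2 + L) * \<eta>) (\<lambda>n. of_rat (\<delta> ! n)) m"
    proof (rule infeasible_perturb[OF N inf x'(2) r])
      show "d n / 2 + \<eta> \<le> of_rat (\<delta> ! n)" if "n < m" for n using \<delta>(2)[OF that] \<eta>3[OF that] q(1)[of n] by simp
    qed
    then have "infeasible N F E x' (of_rat r) (of_rat \<sigma>') (\<lambda>n. of_rat (\<delta> ! n)) (length \<delta>)"
      unfolding \<delta>(1) by (rule infeasible_mono) (use L\<eta> \<sigma>' \<sigma>(1) in auto)
    then have "infeasible N F (E \<inter> D) x' (of_rat r) (of_rat \<sigma>') (\<lambda>n. of_rat (\<delta> ! n)) m"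
      using refl[OF x'(1)] \<delta>(1) by metis
    then have "infeasible N F (E \<inter> D) x (F x) (of_rat \<sigma>' - (2 + L) * \<eta>) d m"
    proof (rule infeasible_perturb[OF N])
      show "norm (x' - x) \<le> \<eta>" using x'(2) by (simp add: norm_minus_commute)
      show "\<bar>of_rat r - F x\<bar> \<le> \<eta>" using r by (simp add: abs_minus_commute)
      show "of_rat (\<delta> ! n) + \<eta> \<le> d n" if "n < m" for n using \<delta>(2)[OF that] \<eta>3[OF that] q(2)[of n] by simp
    qed
    then obtain v' s' where vs': "(v', s') \<in> convex hull (secants F (E \<inter> D) x (F x) d {..<m})" "s' + N (- v') < 0"
      using L\<eta> \<sigma>'(1) unfolding infeasible_def by force
    have "convex hull (secants F (E \<inter> D) x (F x) d {..<m}) \<subseteq> {a. p (fst a) \<le> snd a}"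
    proof (rule hull_minimal)
      show "secants F (E \<inter> D) x (F x) d {..<m} \<subseteq> {a. p (fst a) \<le> snd a}" using d(2) by (auto simp: secants_def)
      show "convex {a. p (fst a) \<le> snd a}"
        by (rule convexI) (auto simp: linear_add[OF p(1)] linear_cmul[OF p(1)] intro!: add_mono mult_left_mono)
    qed
    then have "p v' \<le> s'" using vs'(1) by auto
    then show False using vs'(2) p(2)[of "- v'"] linear_neg[OF p(1), of v'] by linarith
  qed
  obtain \<xi> where \<xi>: "linear \<xi>" "\<forall>v. \<xi> v \<le> N v" "\<forall>(h, r)\<in>secants F E x (F x) (\<lambda>n. d n / 2) UNIV. \<xi> h \<le> r"
    by (rule linear_below_constraints[OF N(1) feas])
  have "\<exists>d>0. \<forall>u\<in>E. norm (u - x) < d \<longrightarrow> \<xi> (u - x) \<le> F u - F x + norm (u - x) / (real n + 1)" for n :: nat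
    by (rule exI[of _ "d n / 2"]) (use \<xi>(3) d(1)[of n] in \<open>force simp: secants_def\<close>)
  then show ?thesis using \<xi>(1,2) that by blast
qed

lemma countable_closed_under_operation:
  fixes Op :: "'a \<Rightarrow> 'a \<Rightarrow> 'p::countable \<Rightarrow> 'a set"
  assumes Op: "\<And>x y p. countable (Op x y p)" and D0: "countable D0"
  obtains D where "countable D" "D0 \<subseteq> D" "\<forall>x\<in>D. \<forall>y\<in>D. \<forall>p. Op x y p \<subseteq> D"
proof -
  define step where "step A = A \<union> (\<Union>x\<in>A. \<Union>y\<in>A. \<Union>p. Op x y p)" for A
  define D where "D = (\<Union>n. (step ^^ n) D0)"
  have c: "countable ((step ^^ n) D0)" for n by (induction n) (auto simp: step_def D0 Op)
  have mono: "(step ^^ i) D0 \<subseteq> (step ^^ j) D0" if "i \<le> j" for i j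
    using lift_Suc_mono_le[of "\<lambda>n. (step ^^ n) D0", OF _ that] by (auto simp: step_def)
  show ?thesis
  proof
    show "countable D" unfolding D_def using c by blast
    show "D0 \<subseteq> D" using UN_upper[of 0 UNIV "\<lambda>n. (step ^^ n) D0"] by (simp add: D_def)
    show "\<forall>x\<in>D. \<forall>y\<in>D. \<forall>p. Op x y p \<subseteq> D"
    proof (intro ballI allI)
      fix x y p assume "x \<in> D" "y \<in> D"
      then obtain i j where "x \<in> (step ^^ i) D0" "y \<in> (step ^^ j) D0" by (auto simp: D_def)
      then have "x \<in> (step ^^ max i j) D0" "y \<in> (step ^^ max i j) D0"
        using mono[of i "max i j"] mono[of j "max i j"] by auto
      then have "Op x y p \<subseteq> (step ^^ Suc (max i j)) D0" by (auto simp: step_def)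
      then show "Op x y p \<subseteq> D" unfolding D_def by blast
    qed
  qed
qed

lemma subspace_closure_of_rational_space:
  fixes D :: "'a::real_normed_vector set"
  assumes "D \<noteq> {}" and add: "\<And>x y. x \<in> D \<Longrightarrow> y \<in> D \<Longrightarrow> x + y \<in> D"
    and scale: "\<And>x q. x \<in> D \<Longrightarrow> real_of_rat q *\<^sub>R x \<in> D"
  shows "subspace (closure D)"
proof (rule subspaceI)
  obtain x where "x \<in> D" using assms(1) by blast
  then have "0 \<in> D" using scale[of x 0] by simp
  then show "0 \<in> closure D" using closure_subset by blast
next
  fix x y assume "x \<in> closure D" "y \<in> closure D"
  then obtain u v where "\<forall>n. u n \<in> D" "u \<longlonglongrightarrow> x" "\<forall>n. v n \<in> D" "v \<longlonglongrightarrow> y" unfolding closure_sequential by blast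
  then show "x + y \<in> closure D"
    unfolding closure_sequential by (intro exI[of _ "\<lambda>n. u n + v n"]) (auto intro: add tendsto_add)
next
  fix t :: real and x assume "x \<in> closure D"
  then obtain u where u: "\<forall>n. u n \<in> D" "u \<longlonglongrightarrow> x" unfolding closure_sequential by blast
  have "\<exists>q. t - inverse (real (Suc n)) < real_of_rat q \<and> real_of_rat q < t" for n by (rule rat_between) simp
  then obtain q where q: "\<And>n. t - inverse (real (Suc n)) < real_of_rat (q n)" "\<And>n. real_of_rat (q n) < t" by metis
  have "(\<lambda>n. real_of_rat (q n)) \<longlonglongrightarrow> t"
  proof (rule tendsto_sandwich)
    show "\<forall>\<^sub>F n in sequentially. t - inverse (real (Suc n)) \<le> real_of_rat (q n)" using q(1) by (simp add: less_imp_le del: of_nat_Suc)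
    show "\<forall>\<^sub>F n in sequentially. real_of_rat (q n) \<le> t" using q(2) by (simp add: less_imp_le)
    show "(\<lambda>n. t - inverse (real (Suc n))) \<longlonglongrightarrow> t"
      using tendsto_diff[OF tendsto_const LIMSEQ_inverse_real_of_nat, of t] by simp
  qed simp
  then show "t *\<^sub>R x \<in> closure D"
    unfolding closure_sequential using u scale by (intro exI[of _ "\<lambda>n. real_of_rat (q n) *\<^sub>R u n"]) (auto intro: tendsto_scaleR)
qed

section \<open>Separable determination of pairs of subgradients\<close>

lemma frechet_subdiffI:
  fixes \<phi> :: "'a::real_normed_vector \<Rightarrow> ereal"
  assumes proper: "\<forall>x. \<phi> x \<noteq> - \<infinity>" and x: "\<bar>\<phi> x\<bar> \<noteq> \<infinity>"
    and sub: "\<forall>n::nat. \<exists>d>0. \<forall>u. \<bar>\<phi> u\<bar> \<noteq> \<infinity> \<longrightarrow> norm (u - x) < d \<longrightarrow>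
      blinfun_apply y (u - x) \<le> real_of_ereal (\<phi> u) - real_of_ereal (\<phi> x) + norm (u - x) / (real n + 1)"
  shows "y \<in> frechet_subdiff \<phi> x"
proof -
  obtain a where a: "\<phi> x = ereal a" using x by (cases "\<phi> x") auto
  let ?q = "\<lambda>u. (\<phi> u - \<phi> x - ereal (blinfun_apply y (u - x))) / ereal (norm (u - x))"
  have "\<forall>\<^sub>F u in at x. c < ?q u" if c: "c < 0" for c :: ereal
  proof -
    obtain n :: nat where n: "c < ereal (- inverse (real (Suc n)))"
    proof (cases c)
      case (real r)
      then have "0 < - r" using c by (simp add: zero_ereal_def)
      then obtain n where "inverse (real (Suc n)) < - r" using reals_Archimedean by blast
      then show ?thesis using real by (intro that[of n]) simp
    qed (use c in \<open>auto intro: that\<close>)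
    obtain d where d: "d > 0" "\<And>u. \<bar>\<phi> u\<bar> \<noteq> \<infinity> \<Longrightarrow> norm (u - x) < d \<Longrightarrow>
        y (u - x) \<le> real_of_ereal (\<phi> u) - real_of_ereal (\<phi> x) + norm (u - x) / (real n + 1)"
      using sub by blast
    have "c < ?q u" if u: "u \<noteq> x" "dist u x < d" for u
    proof (cases "\<phi> u")
      case (real b)
      have pos: "norm (u - x) > 0" using u(1) by simp
      have "y (u - x) \<le> b - a + norm (u - x) * inverse (real (Suc n))"
        using d(2)[of u] u(2) real a by (simp add: dist_norm divide_inverse add.commute)
      then have "- inverse (real (Suc n)) * norm (u - x) \<le> b - a - y (u - x)" by (simp add: algebra_simps)
      then have "- inverse (real (Suc n)) \<le> (b - a - y (u - x)) / norm (u - x)" using pos by (simp only: pos_le_divide_eq)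
      then have "ereal (- inverse (real (Suc n))) \<le> ?q u" using real a pos by simp
      with n show ?thesis by (rule less_le_trans)
    next
      case PInf
      then have "?q u = \<infinity>" using a u(1) by simp
      then show ?thesis using less_le_trans[OF c, of "?q u"] by simp
    next
      case MInf
      then show ?thesis using proper by simp
    qed
    then show ?thesis unfolding eventually_at using d(1) by blast
  qed
  then have "0 \<le> Liminf (at x) ?q" unfolding le_Liminf_iff by blast
  then show ?thesis using a by (simp add: frechet_subdiff_def edom_def)
qed

lemma frechet_subdiffD:
  fixes \<phi> :: "'a::real_normed_vector \<Rightarrow> ereal"
  assumes y: "y \<in> frechet_subdiff \<phi> x" and x: "\<phi> x = ereal a" and e: "e > 0"
  shows "\<exists>d>0. \<forall>u. norm (u - x) < d \<longrightarrow> ereal (a + blinfun_apply y (u - x) - e * norm (u - x)) \<le> \<phi> u"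
proof -
  let ?q = "\<lambda>u. (\<phi> u - \<phi> x - ereal (blinfun_apply y (u - x))) / ereal (norm (u - x))"
  have "ereal (- e) < 0" using e by simp
  moreover have "0 \<le> Liminf (at x) ?q" using y by (simp add: frechet_subdiff_def)
  ultimately have "\<forall>\<^sub>F u in at x. ereal (- e) < ?q u" unfolding le_Liminf_iff by blast
  then obtain d where d: "d > 0" "\<And>u. u \<noteq> x \<Longrightarrow> dist u x < d \<Longrightarrow> ereal (- e) < ?q u"
    unfolding eventually_at by blast
  have "ereal (a + y (u - x) - e * norm (u - x)) \<le> \<phi> u" if u: "norm (u - x) < d" for u
  proof (cases "u = x")
    case True
    then show ?thesis using x by simp
  next
    case False
    then have pos: "norm (u - x) > 0" by simp
    have lt: "ereal (- e) < ?q u" using d(2)[OF False] u by (simp add: dist_norm)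
    show ?thesis
    proof (cases "\<phi> u")
      case (real b)
      then have "- e < (b - a - y (u - x)) / norm (u - x)" using lt x pos by simp
      then have "- e * norm (u - x) < b - a - y (u - x)" using pos by (simp only: pos_less_divide_eq)
      then show ?thesis using real by simp
    next
      case MInf
      then show ?thesis using lt x pos by simp
    qed simp
  qed
  then show ?thesis using d(1) by blast
qed

lemma norm_components_le: "norm (fst v) \<le> norm v" "norm (snd v) \<le> norm v"
  using norm_fst_le[of "fst v" "snd v"] norm_snd_le[of "snd v" "fst v"] by simp_all

text \<open>Frechet subgradients of \<open>(u1, u2) \<mapsto> \<phi>1 u1 + \<phi>2 u2\<close> at \<open>(x1, x2)\<close> relative to \<open>Y \<times> Y\<close>.\<close>

definition joint_subgradient_on ::
  "'a::real_normed_vector set \<Rightarrow> ('a \<Rightarrow> ereal) \<Rightarrow> ('a \<Rightarrow> ereal) \<Rightarrow> 'a \<Rightarrow> 'a \<Rightarrow> ('a \<Rightarrow>\<^sub>L real) \<Rightarrow> ('a \<Rightarrow>\<^sub>L real) \<Rightarrow> bool" where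
  "joint_subgradient_on Y \<phi>1 \<phi>2 x1 x2 p1 p2 \<longleftrightarrow> (\<forall>e>0. \<exists>d>0. \<forall>u1\<in>Y. \<forall>u2\<in>Y. \<bar>\<phi>1 u1\<bar> \<noteq> \<infinity> \<longrightarrow> \<bar>\<phi>2 u2\<bar> \<noteq> \<infinity> \<longrightarrow>
     norm (u1 - x1) < d \<longrightarrow> norm (u2 - x2) < d \<longrightarrow>
     blinfun_apply p1 (u1 - x1) + blinfun_apply p2 (u2 - x2) \<le> real_of_ereal (\<phi>1 u1) + real_of_ereal (\<phi>2 u2)
       - (real_of_ereal (\<phi>1 x1) + real_of_ereal (\<phi>2 x2)) + e * (norm (u1 - x1) + norm (u2 - x2)))"

text \<open>Pairs \<open>(q1, q2)\<close> with \<open>norm q1 \<le> k\<close> and \<open>norm (q1 + q2 - xs) \<le> e\<close> are dominated on the product space by the sublinear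
functional \<open>N k (v1, v2) = k * norm (v1 - v2) + xs v2 + e * norm v2\<close>, as is seen by writing
\<open>q1 v1 + q2 v2 = q1 (v1 - v2) + (q1 + q2) v2\<close>. Conversely, a linear functional below \<open>N k\<close> splits into
such a pair: test it on vectors \<open>(v, 0)\<close> and on the diagonal. The set \<open>D\<close> is closed under sums, rational
multiples and the choice \<open>W\<close> of finitely many points that witness infeasibility.\<close>

theorem separable_determination:
  fixes \<phi>1 \<phi>2 :: "'a::banach \<Rightarrow> ereal"
  assumes proper: "\<forall>x. \<phi>1 x \<noteq> - \<infinity>" "\<forall>x. \<phi>2 x \<noteq> - \<infinity>" and e: "e > 0" and D0: "countable D0" "D0 \<noteq> {}"
  obtains D where "countable D" "D0 \<subseteq> D" "subspace (closure D)"
    "\<forall>x1\<in>closure D. \<forall>x2\<in>closure D. \<forall>p1 p2. \<bar>\<phi>1 x1\<bar> \<noteq> \<infinity> \<longrightarrow> \<bar>\<phi>2 x2\<bar> \<noteq> \<infinity> \<longrightarrow> norm (p1 + p2 - xs) \<le> e \<longrightarrow>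
      joint_subgradient_on (closure D) \<phi>1 \<phi>2 x1 x2 p1 p2 \<longrightarrow>
      (\<exists>q1 q2. norm (q1 + q2 - xs) \<le> e \<and> q1 \<in> frechet_subdiff \<phi>1 x1 \<and> q2 \<in> frechet_subdiff \<phi>2 x2)"
proof -
  define E where "E = {u. \<bar>\<phi>1 (fst u)\<bar> \<noteq> \<infinity> \<and> \<bar>\<phi>2 (snd u)\<bar> \<noteq> \<infinity>}"
  define F where "F u = real_of_ereal (\<phi>1 (fst u)) + real_of_ereal (\<phi>2 (snd u))" for u
  define N where "N k v = real k * norm (fst v - snd v) + blinfun_apply xs (snd v) + e * norm (snd v)" for k :: nat and v :: "'a \<times> 'a"
  have N_sub: "sublinear (N k)" for k
  proof (rule sublinearI)
    fix v w :: "'a \<times> 'a"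
    have "real k * norm (fst (v + w) - snd (v + w)) \<le> real k * (norm (fst v - snd v) + norm (fst w - snd w))"
      using norm_triangle_ineq[of "fst v - snd v" "fst w - snd w"] by (intro mult_left_mono) (auto simp: algebra_simps)
    moreover have "e * norm (snd (v + w)) \<le> e * (norm (snd v) + norm (snd w))"
      using norm_triangle_ineq[of "snd v" "snd w"] e by (intro mult_left_mono) auto
    ultimately show "N k (v + w) \<le> N k v + N k w" by (simp add: N_def blinfun.add_right algebra_simps)
  next
    fix t :: real and v :: "'a \<times> 'a" assume t: "t > 0"
    have "norm (t *\<^sub>R fst v - t *\<^sub>R snd v) = t * norm (fst v - snd v)" using t by (simp flip: scaleR_diff_right)
    then show "N k (t *\<^sub>R v) \<le> t * N k v" using t by (simp add: N_def blinfun.scaleR_right algebra_simps)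
  qed (simp add: N_def)
  define L where "L k = 2 * real k + norm xs + e" for k
  have L0: "0 \<le> L k" for k using e by (simp add: L_def)
  have N_le: "N k v \<le> L k * norm v" for k v
  proof -
    have n: "norm (fst v) \<le> norm v" "norm (snd v) \<le> norm v" by (rule norm_components_le)+
    have "real k * norm (fst v - snd v) \<le> real k * (2 * norm v)"
      using norm_triangle_ineq4[of "fst v" "snd v"] n by (intro mult_left_mono) auto
    moreover have "xs (snd v) \<le> norm xs * norm v"
      using norm_blinfun[of xs "snd v"] mult_left_mono[OF n(2), of "norm xs"] by simp
    moreover have "e * norm (snd v) \<le> e * norm v" using n(2) e by (intro mult_left_mono) auto
    ultimately show ?thesis by (simp add: N_def L_def algebra_simps)
  qed
  define bad where "bad U x k r \<sigma> \<delta> \<longleftrightarrow>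
    infeasible (N k) F U x (of_rat r) (of_rat \<sigma>) (\<lambda>n. of_rat (\<delta> ! n)) (length \<delta>)"
    for U x k and r \<sigma> :: rat and \<delta> :: "rat list"
  define W where "W x k r \<sigma> \<delta> = (if bad E x k r \<sigma> \<delta> then SOME U. finite U \<and> U \<subseteq> E \<and> bad U x k r \<sigma> \<delta> else {})" for x k r \<sigma> \<delta>
  have W: "finite (W x k r \<sigma> \<delta>)" "bad E x k r \<sigma> \<delta> \<Longrightarrow> W x k r \<sigma> \<delta> \<subseteq> E \<and> bad (W x k r \<sigma> \<delta>) x k r \<sigma> \<delta>" for x k r \<sigma> \<delta>
  proof -
    have "finite (W x k r \<sigma> \<delta>) \<and> W x k r \<sigma> \<delta> \<subseteq> E \<and> bad (W x k r \<sigma> \<delta>) x k r \<sigma> \<delta>" if b: "bad E x k r \<sigma> \<delta>"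
    proof -
      have "\<exists>U. finite U \<and> U \<subseteq> E \<and> bad U x k r \<sigma> \<delta>" using infeasible_finite[OF b[unfolded bad_def]] unfolding bad_def .
      from someI_ex[OF this] show ?thesis using b by (simp add: W_def)
    qed
    then show "finite (W x k r \<sigma> \<delta>)" "bad E x k r \<sigma> \<delta> \<Longrightarrow> W x k r \<sigma> \<delta> \<subseteq> E \<and> bad (W x k r \<sigma> \<delta>) x k r \<sigma> \<delta>"
      by (cases "bad E x k r \<sigma> \<delta>", auto simp: W_def)
  qed
  define Op :: "'a \<Rightarrow> 'a \<Rightarrow> nat \<times> rat \<times> rat \<times> rat list \<Rightarrow> 'a set" where
    "Op x y = (\<lambda>(k, r, \<sigma>, \<delta>). {x + y, of_rat r *\<^sub>R x} \<union> fst ` W (x, y) k r \<sigma> \<delta> \<union> snd ` W (x, y) k r \<sigma> \<delta>)" for x y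
  have Op_c: "countable (Op x y p)" for x y p
    unfolding Op_def by (auto split: prod.split intro!: countable_finite finite_imageI W(1))
  obtain D where D: "countable D" "D0 \<subseteq> D" "\<forall>x\<in>D. \<forall>y\<in>D. \<forall>p. Op x y p \<subseteq> D"
    by (rule countable_closed_under_operation[OF Op_c D0(1)])
  have Dop: "x + y \<in> D" "of_rat r *\<^sub>R x \<in> D" "fst ` W (x, y) k r \<sigma> \<delta> \<subseteq> D" "snd ` W (x, y) k r \<sigma> \<delta> \<subseteq> D"
    if "x \<in> D" "y \<in> D" for x y k r \<sigma> \<delta>
    using D(3)[rule_format, OF that, of "(k, r, \<sigma>, \<delta>)"] by (auto simp: Op_def)
  have sub: "subspace (closure D)"
  proof (rule subspace_closure_of_rational_space)
    show "D \<noteq> {}" using D(2) D0(2) by blast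
    show "x + y \<in> D" if "x \<in> D" "y \<in> D" for x y using Dop(1)[OF that] .
    show "of_rat q *\<^sub>R x \<in> D" if "x \<in> D" for x q using Dop(2)[OF that that] .
  qed
  have refl: "infeasible (N k) F (E \<inter> D \<times> D) z (of_rat r) (of_rat \<sigma>) (\<lambda>n. of_rat (\<delta> ! n)) (length \<delta>)"
    if z: "z \<in> D \<times> D" and b: "infeasible (N k) F E z (of_rat r) (of_rat \<sigma>) (\<lambda>n. of_rat (\<delta> ! n)) (length \<delta>)"
    for z k r \<sigma> \<delta>
  proof -
    obtain x y where xy: "z = (x, y)" "x \<in> D" "y \<in> D" using z by auto
    have WE: "W z k r \<sigma> \<delta> \<subseteq> E" and Wbad: "bad (W z k r \<sigma> \<delta>) z k r \<sigma> \<delta>" using W(2)[of z k r \<sigma> \<delta>] b by (auto simp: bad_def)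
    have "w \<in> D \<times> D" if w: "w \<in> W z k r \<sigma> \<delta>" for w
    proof -
      have "fst w \<in> D" by (rule subsetD[OF Dop(3)[OF xy(2,3)] imageI[OF w[unfolded xy(1)]]])
      moreover have "snd w \<in> D" by (rule subsetD[OF Dop(4)[OF xy(2,3)] imageI[OF w[unfolded xy(1)]]])
      ultimately show ?thesis by (simp add: mem_Times_iff)
    qed
    then have "W z k r \<sigma> \<delta> \<subseteq> D \<times> D" by (rule subsetI)
    with WE have "W z k r \<sigma> \<delta> \<subseteq> E \<inter> D \<times> D" by (rule Int_greatest)
    then show ?thesis by (rule infeasible_mono[OF Wbad[unfolded bad_def] _ order_refl])
  qed
  show ?thesis
  proof (rule that[OF D(1,2) sub], intro ballI allI impI)
    fix x1 x2 and p1 p2 :: "'a \<Rightarrow>\<^sub>L real"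
    assume x1: "x1 \<in> closure D" and x2: "x2 \<in> closure D" and fin: "\<bar>\<phi>1 x1\<bar> \<noteq> \<infinity>" "\<bar>\<phi>2 x2\<bar> \<noteq> \<infinity>"
      and p12: "norm (p1 + p2 - xs) \<le> e"
      and sub12: "joint_subgradient_on (closure D) \<phi>1 \<phi>2 x1 x2 p1 p2"
    obtain k :: nat where k: "norm p1 \<le> real k" using real_arch_simple by blast
    define p where "p v = p1 (fst v) + p2 (snd v)" for v
    have p_lin: "linear p" by (rule linearI) (simp_all add: p_def blinfun.add_right blinfun.scaleR_right algebra_simps)
    have p_le: "p v \<le> N k v" for v
    proof -
      have "p v = p1 (fst v - snd v) + xs (snd v) + (p1 + p2 - xs) (snd v)"
        by (simp add: p_def blinfun.diff_right blinfun.add_left blinfun.diff_left)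
      moreover have "p1 (fst v - snd v) \<le> real k * norm (fst v - snd v)"
        using norm_blinfun[of p1 "fst v - snd v"] mult_right_mono[OF k norm_ge_zero[of "fst v - snd v"]] by simp
      moreover have "(p1 + p2 - xs) (snd v) \<le> e * norm (snd v)"
        using norm_blinfun[of "p1 + p2 - xs" "snd v"] mult_right_mono[OF p12 norm_ge_zero[of "snd v"]]
        by simp
      ultimately show ?thesis by (simp add: N_def)
    qed
    have sub_p: "\<forall>n::nat. \<exists>d>0. \<forall>u\<in>E \<inter> D \<times> D. norm (u - (x1, x2)) < d \<longrightarrow> p (u - (x1, x2)) \<le> F u - F (x1, x2) + norm (u - (x1, x2)) / (real n + 1)"
    proof
      fix n :: nat
      define e' where "e' = inverse (real n + 1) / 2"
      have e': "e' > 0" by (simp add: e'_def)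
      obtain d where d: "d > 0" "\<forall>u1\<in>closure D. \<forall>u2\<in>closure D. \<bar>\<phi>1 u1\<bar> \<noteq> \<infinity> \<longrightarrow> \<bar>\<phi>2 u2\<bar> \<noteq> \<infinity> \<longrightarrow>
        norm (u1 - x1) < d \<longrightarrow> norm (u2 - x2) < d \<longrightarrow>
        blinfun_apply p1 (u1 - x1) + blinfun_apply p2 (u2 - x2) \<le> real_of_ereal (\<phi>1 u1) + real_of_ereal (\<phi>2 u2)
          - (real_of_ereal (\<phi>1 x1) + real_of_ereal (\<phi>2 x2)) + e' * (norm (u1 - x1) + norm (u2 - x2))"
        using sub12[unfolded joint_subgradient_on_def, THEN spec, THEN mp, OF e'] by (elim exE conjE) (rule that)
      have "p (u - (x1, x2)) \<le> F u - F (x1, x2) + norm (u - (x1, x2)) / (real n + 1)"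
        if u: "u \<in> E \<inter> D \<times> D" "norm (u - (x1, x2)) < d" for u
      proof -
        have un: "norm (fst u - x1) < d" "norm (snd u - x2) < d"
          using u(2) norm_components_le(1)[of "u - (x1, x2)"] norm_components_le(2)[of "u - (x1, x2)"] by simp_all
        have uc: "fst u \<in> closure D" "snd u \<in> closure D" "\<bar>\<phi>1 (fst u)\<bar> \<noteq> \<infinity>" "\<bar>\<phi>2 (snd u)\<bar> \<noteq> \<infinity>"
          using u(1) subsetD[OF closure_subset[of D]] by (simp_all add: mem_Times_iff E_def)
        have "p1 (fst u - x1) + p2 (snd u - x2) \<le> real_of_ereal (\<phi>1 (fst u)) + real_of_ereal (\<phi>2 (snd u))
          - (real_of_ereal (\<phi>1 x1) + real_of_ereal (\<phi>2 x2)) + e' * (norm (fst u - x1) + norm (snd u - x2))"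
          by (rule d(2)[rule_format, OF uc un])
        moreover have "e' * (norm (fst u - x1) + norm (snd u - x2)) \<le> e' * (2 * norm (u - (x1, x2)))"
          using norm_components_le[of "u - (x1, x2)"] e' by (intro mult_left_mono) auto
        moreover have "e' * (2 * norm (u - (x1, x2))) = norm (u - (x1, x2)) / (real n + 1)"
        proof -
          have "inverse c / 2 * (2 * t) = t / c" for c t :: real by (simp add: inverse_eq_divide)
          then show ?thesis unfolding e'_def .
        qed
        moreover have "p (u - (x1, x2)) = p1 (fst u - x1) + p2 (snd u - x2)" by (simp add: p_def)
        moreover have "F (x1, x2) = real_of_ereal (\<phi>1 x1) + real_of_ereal (\<phi>2 x2)" by (simp add: F_def)
        ultimately show ?thesis using F_def[of u] by linarith
      qed
      then show "\<exists>d>0. \<forall>u\<in>E \<inter> D \<times> D. norm (u - (x1, x2)) < d \<longrightarrow> p (u - (x1, x2)) \<le> F u - F (x1, x2) + norm (u - (x1, x2)) / (real n + 1)"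
        using d(1) by blast
    qed
    have xcl: "(x1, x2) \<in> closure (D \<times> D)" using x1 x2 by (simp add: closure_Times)
    obtain \<xi> where \<xi>: "linear \<xi>" "\<forall>v. \<xi> v \<le> N k v"
      "\<forall>n::nat. \<exists>d>0. \<forall>u\<in>E. norm (u - (x1, x2)) < d \<longrightarrow> \<xi> (u - (x1, x2)) \<le> F u - F (x1, x2) + norm (u - (x1, x2)) / (real n + 1)"
      by (rule subgradient_from_dense_set[OF N_sub N_le L0 refl xcl p_lin p_le sub_p])
    have lin1: "linear (\<lambda>h. \<xi> (h, 0))" and lin2: "linear (\<lambda>h. \<xi> (0, h))"
      using linear_add[OF \<xi>(1), of "(_, 0)" "(_, 0)"] linear_add[OF \<xi>(1), of "(0, _)" "(0, _)"]
        linear_cmul[OF \<xi>(1), of _ "(_, 0)"] linear_cmul[OF \<xi>(1), of _ "(0, _)"]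
      by (auto intro!: linearI)
    have le: "\<xi> (h, 0) \<le> L k * norm h" "\<xi> (0, h) \<le> L k * norm h" for h
      using \<xi>(2)[rule_format, of "(h, 0)"] N_le[of k "(h, 0)"] \<xi>(2)[rule_format, of "(0, h)"] N_le[of k "(0, h)"] by (auto simp: norm_Pair)
    obtain q1 :: "'a \<Rightarrow>\<^sub>L real" where q1: "blinfun_apply q1 = (\<lambda>h. \<xi> (h, 0))" by (rule blinfun_of_norm_bounded[OF lin1 L0 le(1)])
    obtain q2 :: "'a \<Rightarrow>\<^sub>L real" where q2: "blinfun_apply q2 = (\<lambda>h. \<xi> (0, h))" by (rule blinfun_of_norm_bounded[OF lin2 L0 le(2)])
    have q12: "(q1 + q2 - xs) h \<le> e * norm h" for h
    proof -
      have "\<xi> (h, h) = q1 h + q2 h" using linear_add[OF \<xi>(1), of "(h, 0)" "(0, h)"] by (simp add: q1 q2)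
      then show ?thesis using \<xi>(2)[rule_format, of "(h, h)"] by (simp add: N_def blinfun.add_left blinfun.diff_left)
    qed
    have "norm ((q1 + q2 - xs) h) \<le> e * norm h" for h
      using q12[of h] q12[of "- h"] by (simp add: blinfun.minus_right abs_le_iff)
    then have "norm (q1 + q2 - xs) \<le> e" using e by (intro norm_blinfun_bound) auto
    moreover have "q1 \<in> frechet_subdiff \<phi>1 x1"
    proof (rule frechet_subdiffI[OF proper(1) fin(1)], rule allI)
      fix n :: nat
      obtain d where d: "d > 0" "\<forall>u\<in>E. norm (u - (x1, x2)) < d \<longrightarrow> \<xi> (u - (x1, x2)) \<le> F u - F (x1, x2) + norm (u - (x1, x2)) / (real n + 1)"
        using \<xi>(3)[THEN spec, of n] by (elim exE conjE) (rule that)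
      have "q1 (u - x1) \<le> real_of_ereal (\<phi>1 u) - real_of_ereal (\<phi>1 x1) + norm (u - x1) / (real n + 1)"
        if "\<bar>\<phi>1 u\<bar> \<noteq> \<infinity>" "norm (u - x1) < d" for u
        using d(2)[rule_format, of "(u, x2)"] that fin by (simp add: E_def F_def q1 norm_Pair)
      then show "\<exists>d>0. \<forall>u. \<bar>\<phi>1 u\<bar> \<noteq> \<infinity> \<longrightarrow> norm (u - x1) < d \<longrightarrow>
          q1 (u - x1) \<le> real_of_ereal (\<phi>1 u) - real_of_ereal (\<phi>1 x1) + norm (u - x1) / (real n + 1)"
        using d(1) by blast
    qed
    moreover have "q2 \<in> frechet_subdiff \<phi>2 x2"
    proof (rule frechet_subdiffI[OF proper(2) fin(2)], rule allI)
      fix n :: nat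
      obtain d where d: "d > 0" "\<forall>u\<in>E. norm (u - (x1, x2)) < d \<longrightarrow> \<xi> (u - (x1, x2)) \<le> F u - F (x1, x2) + norm (u - (x1, x2)) / (real n + 1)"
        using \<xi>(3)[THEN spec, of n] by (elim exE conjE) (rule that)
      have "q2 (u - x2) \<le> real_of_ereal (\<phi>2 u) - real_of_ereal (\<phi>2 x2) + norm (u - x2) / (real n + 1)"
        if "\<bar>\<phi>2 u\<bar> \<noteq> \<infinity>" "norm (u - x2) < d" for u
        using d(2)[rule_format, of "(x1, u)"] that fin by (simp add: E_def F_def q2 norm_Pair)
      then show "\<exists>d>0. \<forall>u. \<bar>\<phi>2 u\<bar> \<noteq> \<infinity> \<longrightarrow> norm (u - x2) < d \<longrightarrow>
          q2 (u - x2) \<le> real_of_ereal (\<phi>2 u) - real_of_ereal (\<phi>2 x2) + norm (u - x2) / (real n + 1)"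
        using d(1) by blast
    qed
    ultimately show "\<exists>q1 q2. norm (q1 + q2 - xs) \<le> e \<and> q1 \<in> frechet_subdiff \<phi>1 x1 \<and> q2 \<in> frechet_subdiff \<phi>2 x2" by blast
  qed
qed

section \<open>Weakly convergent subsequences\<close>

text \<open>Induction on the spanning set: a new vector \<open>b\<close> has positive distance from the span of the others, which is
closed by the induction hypothesis, so the coefficients of \<open>b\<close> are bounded.\<close>

lemma finite_span_bounded_convergent_subseq:
  fixes B :: "'a::real_normed_vector set"
  assumes "finite B" "\<forall>n::nat. s n \<in> span B \<and> norm (s n) \<le> R"
  shows "\<exists>(\<phi>::nat \<Rightarrow> nat) l. strict_mono \<phi> \<and> l \<in> span B \<and> (s \<circ> \<phi>) \<longlonglongrightarrow> l"
  using assms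
proof (induction B arbitrary: s R rule: finite_induct)
  case empty
  then have "s = (\<lambda>_. 0)" by auto
  then show ?case by (intro exI[of _ id] exI[of _ 0]) (auto simp: strict_mono_def o_def)
next
  case (insert b B)
  show ?case
  proof (cases "b \<in> span B")
    case True
    then show ?thesis using insert by (simp add: span_redundant)
  next
    case False
    have "\<exists>d>0. \<forall>y\<in>span B. d \<le> norm (b - y)"
    proof (rule ccontr)
      assume "\<not> ?thesis"
      then have "\<exists>y\<in>span B. norm (b - y) < inverse (real (Suc n))" for n by (meson inverse_positive_iff_positive not_le of_nat_0_less_iff zero_less_Suc)
      then obtain y where y: "\<And>n. y n \<in> span B" "\<And>n. norm (b - y n) < inverse (real (Suc n))" by metis
      have "norm (y n) \<le> norm b + 1" for n
      proof -
        have "inverse (real (Suc n)) \<le> 1" by (simp add: field_simps)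
        then show ?thesis using y(2)[of n] norm_triangle_ineq2[of "y n" b] by (simp add: norm_minus_commute)
      qed
      with y(1) insert.IH[of y "norm b + 1"] obtain \<phi> l where l: "strict_mono \<phi>" "l \<in> span B" "(y \<circ> \<phi>) \<longlonglongrightarrow> l" by blast
      have "y \<longlonglongrightarrow> b"
      proof (rule Lim_transform_bound[of _ "\<lambda>n. inverse (real (Suc n))", THEN LIM_zero_cancel])
        show "\<forall>\<^sub>F n in sequentially. norm (y n - b) \<le> norm (inverse (real (Suc n)))" 
          using y(2) by (intro always_eventually allI) (simp add: norm_minus_commute less_imp_le)
      qed (rule LIMSEQ_inverse_real_of_nat)
      then have "l = b" using LIMSEQ_unique[OF l(3) LIMSEQ_subseq_LIMSEQ[OF _ l(1)]] by blast
      then show False using l(2) False by simp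
    qed
    then obtain d where d: "d > 0" "\<And>y. y \<in> span B \<Longrightarrow> d \<le> norm (b - y)" by blast
    have "\<exists>k. s n - k *\<^sub>R b \<in> span B" for n using insert.prems by (simp add: span_breakdown_eq)
    then obtain t where t: "\<And>n. s n - t n *\<^sub>R b \<in> span B" by metis
    have t_le: "\<bar>t n\<bar> \<le> R / d" for n
    proof (cases "t n = 0")
      case True
      have "0 \<le> R" using insert.prems norm_ge_zero order_trans by blast
      then show ?thesis using True d(1) by simp
    next
      case False
      define y where "y = (- 1 / t n) *\<^sub>R (s n - t n *\<^sub>R b)"
      have "y \<in> span B" unfolding y_def using t by (intro span_scale)
      then have "\<bar>t n\<bar> * d \<le> \<bar>t n\<bar> * norm (b - y)" using d(2) by (intro mult_left_mono) auto
      also have "\<dots> = norm (t n *\<^sub>R (b - y))" by simp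
      also have "t n *\<^sub>R (b - y) = s n" using False by (simp add: y_def algebra_simps)
      finally show ?thesis using insert.prems d(1) by (simp add: pos_le_divide_eq order_trans)
    qed
    then have "\<forall>n. t n \<in> {- (R / d)..R / d}" by (simp add: abs_le_iff minus_le_iff)
    then obtain \<phi> t' where \<phi>: "strict_mono \<phi>" "(t \<circ> \<phi>) \<longlonglongrightarrow> t'"
      using compact_Icc[of "- (R / d)" "R / d"] unfolding compact_def by blast
    define u where "u n = s (\<phi> n) - t (\<phi> n) *\<^sub>R b" for n
    have u: "u n \<in> span B \<and> norm (u n) \<le> R + R / d * norm b" for n
    proof -
      have "norm (u n) \<le> norm (s (\<phi> n)) + \<bar>t (\<phi> n)\<bar> * norm b"
        unfolding u_def using norm_triangle_ineq4[of "s (\<phi> n)" "t (\<phi> n) *\<^sub>R b"] by simp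
      also have "\<dots> \<le> R + R / d * norm b" using insert.prems t_le by (intro add_mono mult_right_mono) auto
      finally show ?thesis using t by (simp add: u_def)
    qed
    then obtain \<psi> l where \<psi>: "strict_mono \<psi>" "l \<in> span B" "(u \<circ> \<psi>) \<longlonglongrightarrow> l" using insert.IH[of u] by blast
    have "(\<lambda>n. (t \<circ> \<phi>) (\<psi> n) *\<^sub>R b + (u \<circ> \<psi>) n) \<longlonglongrightarrow> t' *\<^sub>R b + l"
      using LIMSEQ_subseq_LIMSEQ[OF \<phi>(2) \<psi>(1)] \<psi>(3) by (intro tendsto_intros) (auto simp: o_def)
    then have "(s \<circ> (\<phi> \<circ> \<psi>)) \<longlonglongrightarrow> t' *\<^sub>R b + l" by (simp add: u_def o_def)
    moreover have "t' *\<^sub>R b + l \<in> span (insert b B)"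
      by (rule span_add[OF span_scale[OF span_base[OF insertI1]] subsetD[OF span_mono[OF subset_insertI] \<psi>(2)]])
    ultimately show ?thesis using strict_mono_o[OF \<phi>(1) \<psi>(1)] by blast
  qed
qed

text \<open>Taking limits is a bounded functional on the space \<open>Z\<close> of those \<open>g\<close> for which \<open>g (u n)\<close> converges. Extended to the
whole dual it is represented by a point.\<close>

lemma reflexive_cluster_point:
  fixes u :: "nat \<Rightarrow> 'a::banach"
  assumes refl: "reflexive_space TYPE('a)" and R: "\<And>n. norm (u n) \<le> R"
  obtains x where "\<forall>g :: 'a \<Rightarrow>\<^sub>L real. convergent (\<lambda>n. g (u n)) \<longrightarrow> (\<lambda>n. g (u n)) \<longlonglongrightarrow> g x"
proof -
  define Z where "Z = {g :: 'a \<Rightarrow>\<^sub>L real. convergent (\<lambda>n. g (u n))}"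
  define l where "l g = lim (\<lambda>n. blinfun_apply g (u n))" for g :: "'a \<Rightarrow>\<^sub>L real"
  have l: "(\<lambda>n. g (u n)) \<longlonglongrightarrow> l g" if "g \<in> Z" for g using that by (simp add: Z_def l_def convergent_LIMSEQ_iff)
  have Z: "subspace Z"
    by (rule subspaceI)
      (auto simp: Z_def blinfun.add_left blinfun.scaleR_left convergent_const intro: convergent_add convergent_mult)
  have R0: "0 \<le> R" using R[of 0] norm_ge_zero order_trans by blast
  obtain F :: "('a \<Rightarrow>\<^sub>L real) \<Rightarrow>\<^sub>L real" where F: "norm F \<le> R" "\<forall>g\<in>Z. blinfun_apply F g = l g"
  proof (rule Hahn_Banach_norm[OF Z R0, of l])
    show "l (f + g) = l f + l g" if "f \<in> Z" "g \<in> Z" for f g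
      by (rule LIMSEQ_unique[OF l[OF subspace_add[OF Z that]]])
        (use tendsto_add[OF l[OF that(1)] l[OF that(2)]] in \<open>simp add: blinfun.add_left\<close>)
    show "l (t *\<^sub>R g) = t * l g" if "g \<in> Z" for t g
      by (rule LIMSEQ_unique[OF l[OF subspace_scale[OF Z that]]])
        (use tendsto_mult_left[OF l[OF that]] in \<open>simp add: blinfun.scaleR_left\<close>)
    show "l g \<le> R * norm g" if "g \<in> Z" for g
    proof (rule LIMSEQ_le_const2[OF l[OF that]])
      have "g (u n) \<le> R * norm g" for n
        using norm_blinfun[of g "u n"] mult_left_mono[OF R[of n] norm_ge_zero[of g]] by (simp add: mult.commute abs_le_iff)
      then show "\<exists>N. \<forall>n\<ge>N. g (u n) \<le> R * norm g" by blast
    qed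
  qed
  obtain x where x: "\<And>g :: 'a \<Rightarrow>\<^sub>L real. F g = g x" using refl unfolding reflexive_space_def by blast
  show ?thesis
  proof (rule that[of x], intro allI impI)
    fix g :: "'a \<Rightarrow>\<^sub>L real" assume "convergent (\<lambda>n. g (u n))"
    then have "g \<in> Z" by (simp add: Z_def)
    then show "(\<lambda>n. g (u n)) \<longlonglongrightarrow> g x" using l[of g] F(2) x[of g] by simp
  qed
qed

lemma bounded_real_convergent_subseq:
  fixes a :: "nat \<Rightarrow> real"
  assumes "\<And>n. \<bar>a n\<bar> \<le> R"
  obtains \<phi> :: "nat \<Rightarrow> nat" where "strict_mono \<phi>" "convergent (a \<circ> \<phi>)"
proof -
  have "\<forall>n. a n \<in> {- R..R}" using assms by (simp add: abs_le_iff minus_le_iff)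
  then obtain \<phi> l where "strict_mono \<phi>" "(a \<circ> \<phi>) \<longlonglongrightarrow> l" using compact_Icc[of "- R" R] unfolding compact_def by blast
  then show ?thesis using that by (auto simp: convergent_def)
qed

text \<open>Let \<open>D\<close> be the countable rational span of the sequence and pass to a diagonal subsequence \<open>u\<close> along which the norming
functionals \<open>N y\<close> with \<open>y \<in> D\<close> converge. All cluster points of subsequences of \<open>u\<close> lie in \<open>closure D\<close> and
agree under each \<open>N y\<close>. Their differences then vanish, because a nonzero element of \<open>closure D\<close> is not
annihilated by \<open>N y\<close> for nearby \<open>y\<close>. Hence \<open>f (u n)\<close> cannot have two limit points.\<close>

theorem reflexive_weakly_convergent_subseq:
  fixes s :: "nat \<Rightarrow> 'a::banach"
  assumes refl: "reflexive_space TYPE('a)" and R: "\<And>n. norm (s n) \<le> R"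
  obtains \<phi> x where "strict_mono \<phi>" "weakly_converges (s \<circ> \<phi>) x"
proof -
  define Op :: "'a \<Rightarrow> 'a \<Rightarrow> rat \<Rightarrow> 'a set" where "Op x y q = {x + y, of_rat q *\<^sub>R x}" for x y q
  obtain D where D: "countable D" "range s \<subseteq> D" "\<forall>x\<in>D. \<forall>y\<in>D. \<forall>q. Op x y q \<subseteq> D"
  proof (rule countable_closed_under_operation[of Op "range s"])
    show "countable (Op x y q)" for x y q by (simp add: Op_def)
  qed auto
  have Dop: "x + y \<in> D" "of_rat q *\<^sub>R x \<in> D" if "x \<in> D" "y \<in> D" for x y q
    using D(3)[rule_format, OF that, of q] by (auto simp: Op_def)
  have D_ne: "D \<noteq> {}" using D(2) by blast
  have Y: "subspace (closure D)" by (rule subspace_closure_of_rational_space[OF D_ne Dop])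
  have "\<exists>F :: 'a \<Rightarrow>\<^sub>L real. norm F \<le> 1 \<and> blinfun_apply F x = norm x" for x by (rule norming_functional[of x]) blast
  then obtain N :: "'a \<Rightarrow> 'a \<Rightarrow>\<^sub>L real" where N: "\<And>x. norm (N x) \<le> 1" "\<And>x. N x x = norm x" by metis
  have N_le: "\<bar>N d x\<bar> \<le> norm x" for d x
    using norm_blinfun[of "N d" x] mult_right_mono[OF N(1)[of d] norm_ge_zero[of x]] by simp
  define d where "d = from_nat_into D"
  have ran: "range d = D" unfolding d_def by (rule range_from_nat_into[OF D_ne D(1)])
  interpret subseqs "\<lambda>k r. convergent (\<lambda>n. N (d k) (s (r n)))"
  proof
    fix k and r :: "nat \<Rightarrow> nat"
    have "\<bar>N (d k) (s (r n))\<bar> \<le> R" for n using N_le[of "d k" "s (r n)"] R[of "r n"] by linarith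
    then obtain \<phi> where "strict_mono \<phi>" "convergent ((\<lambda>n. N (d k) (s (r n))) \<circ> \<phi>)" by (rule bounded_real_convergent_subseq)
    then show "\<exists>r'. strict_mono r' \<and> convergent (\<lambda>n. N (d k) (s ((r \<circ> r') n)))" by (auto simp: o_def)
  qed
  define u where "u = s \<circ> diagseq"
  have uR: "norm (u n) \<le> R" for n using R by (simp add: u_def)
  have uN: "convergent (\<lambda>n. N y (u n))" if y: "y \<in> D" for y
  proof -
    obtain k where k: "y = d k" using y ran by auto
    have "convergent (\<lambda>n. N (d k) (s ((diagseq \<circ> (+) (Suc k)) n)))"
    proof (rule diagseq_holds)
      fix n r s' assume "strict_mono (r :: nat \<Rightarrow> nat)" "convergent (\<lambda>m. N (d n) (s (s' m)))"
      then show "convergent (\<lambda>m. N (d n) (s ((s' \<circ> r) m)))"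
        using convergent_subseq_convergent[of "\<lambda>m. N (d n) (s (s' m))" r] by (simp add: o_def)
    qed
    then have "convergent (\<lambda>n. N y (u (n + Suc k)))" by (simp add: u_def k add.commute)
    then show ?thesis by (rule convergent_ignore_initial_segment[THEN iffD1])
  qed
  have cluster_in: "x \<in> closure D" if v: "\<And>n. v n \<in> closure D"
    and x: "\<forall>g :: 'a \<Rightarrow>\<^sub>L real. convergent (\<lambda>n. g (v n)) \<longrightarrow> (\<lambda>n. g (v n)) \<longlonglongrightarrow> g x" for v :: "nat \<Rightarrow> 'a" and x
  proof (rule ccontr)
    assume "x \<notin> closure D"
    then have "x \<notin> closure (closure D)" by simp
    then obtain F :: "'a \<Rightarrow>\<^sub>L real" where F: "\<forall>y\<in>closure D. F y = 0" "F x \<noteq> 0" by (rule separating_functional[OF Y])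
    have "(\<lambda>n. F (v n)) = (\<lambda>n. 0)" using F(1) v by auto
    then have "(\<lambda>n::nat. 0) \<longlonglongrightarrow> F x" using x[rule_format, of F] by (simp add: convergent_const)
    then show False using F(2) LIMSEQ_unique[OF _ tendsto_const] by metis
  qed
  have uD: "u n \<in> closure D" for n using D(2) closure_subset[of D] by (auto simp: u_def)
  obtain x where x: "\<forall>g :: 'a \<Rightarrow>\<^sub>L real. convergent (\<lambda>n. g (u n)) \<longrightarrow> (\<lambda>n. g (u n)) \<longlonglongrightarrow> g x"
    by (rule reflexive_cluster_point[OF refl uR])
  have "(\<lambda>n. f (u n)) \<longlonglongrightarrow> f x" for f :: "'a \<Rightarrow>\<^sub>L real"
  proof (rule ccontr)
    assume "\<not> (\<lambda>n. f (u n)) \<longlonglongrightarrow> f x"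
    then obtain e where e: "e > 0" "\<not> (\<forall>\<^sub>F n in sequentially. dist (f (u n)) (f x) < e)" unfolding tendsto_iff by blast
    obtain r :: "nat \<Rightarrow> nat" where r: "strict_mono r" "\<And>n. \<not> dist (f (u (r n))) (f x) < e"
      using not_eventually_sequentiallyD[OF e(2)] by blast
    have fb: "\<bar>f (u (r n))\<bar> \<le> norm f * R" for n
      using norm_blinfun[of f "u (r n)"] mult_left_mono[OF uR[of "r n"] norm_ge_zero[of f]] by simp
    obtain \<psi> where \<psi>: "strict_mono \<psi>" "convergent ((\<lambda>n. f (u (r n))) \<circ> \<psi>)" by (rule bounded_real_convergent_subseq[OF fb])
    define v where "v n = u (r (\<psi> n))" for n
    have vR: "norm (v n) \<le> R" for n using uR by (simp add: v_def)
    obtain x' where x': "\<forall>g :: 'a \<Rightarrow>\<^sub>L real. convergent (\<lambda>n. g (v n)) \<longrightarrow> (\<lambda>n. g (v n)) \<longlonglongrightarrow> g x'"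
      by (rule reflexive_cluster_point[OF refl vR])
    have "(\<lambda>n. f (v n)) \<longlonglongrightarrow> f x'" using x'[rule_format, of f] \<psi>(2) by (simp add: v_def o_def)
    then have "(\<lambda>n. dist (f (v n)) (f x)) \<longlonglongrightarrow> dist (f x') (f x)" by (intro tendsto_dist tendsto_const)
    then have "e \<le> dist (f x') (f x)"
      by (rule LIMSEQ_le_const) (use r(2) in \<open>auto simp: v_def not_less\<close>)
    then have ne: "x \<noteq> x'" using e(1) by auto
    have Ny: "N y x' = N y x" if y: "y \<in> D" for y
    proof -
      have lim: "(\<lambda>n. N y (u n)) \<longlonglongrightarrow> N y x" using x uN[OF y] by blast
      have "(\<lambda>n. N y (v n)) \<longlonglongrightarrow> N y x"
        using LIMSEQ_subseq_LIMSEQ[OF lim strict_mono_o[OF r(1) \<psi>(1)]] by (simp add: v_def o_def)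
      moreover from this have "(\<lambda>n. N y (v n)) \<longlonglongrightarrow> N y x'" using x' by (simp add: convergentI)
      ultimately show ?thesis using LIMSEQ_unique by blast
    qed
    have "x' \<in> closure D" by (rule cluster_in[of v]) (use uD x' in \<open>auto simp: v_def\<close>)
    then have "x - x' \<in> closure D" using cluster_in[of u, OF uD x] by (intro subspace_diff[OF Y])
    moreover have "norm (x - x') / 2 > 0" using ne by simp
    ultimately obtain y where y: "y \<in> D" "dist y (x - x') < norm (x - x') / 2" unfolding closure_approachable by blast
    have "norm y = N y (y - (x - x'))" using N(2)[of y] Ny[OF y(1)] by (simp add: blinfun.diff_right)
    also have "\<dots> \<le> norm (y - (x - x'))" using N_le[of y "y - (x - x')"] by (simp add: abs_le_iff)
    finally have "norm y < norm (x - x') / 2" using y(2) by (simp add: dist_norm)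
    moreover have "norm (x - x') \<le> norm y + dist y (x - x')"
      using norm_triangle_ineq4[of y "y - (x - x')"] by (simp add: dist_norm)
    ultimately show False using y(2) by linarith
  qed
  then have "weakly_converges (s \<circ> diagseq) x" by (simp add: weakly_converges_def u_def)
  with subseq_diagseq show ?thesis by (rule that)
qed

section \<open>Decoupled lower bounds\<close>

lemma lsc_sequentially:
  assumes "lsc \<phi>" "u \<longlonglongrightarrow> x"
  shows "\<phi> x \<le> liminf (\<lambda>n. \<phi> (u n))"
  unfolding le_Liminf_iff
proof (intro allI impI)
  fix c assume c: "c < \<phi> x"
  then have "c < Liminf (at x) \<phi>" using assms(1) less_le_trans unfolding lsc_def by blast
  then have "\<forall>\<^sub>F y in at x. c < \<phi> y" by (rule less_LiminfD)
  then have "\<forall>\<^sub>F y in nhds x. c < \<phi> y" using c by (simp add: eventually_nhds_conv_at)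
  then show "\<forall>\<^sub>F n in sequentially. c < \<phi> (u n)" using assms(2) by (rule eventually_compose_filterlim)
qed

text \<open>What the reflexive and the finite-dimensional case have in common: two bounded sequences that approach each other
have a common weak limit along a subsequence, at which both functions are lower semicontinuous.\<close>

definition pairwise_weakly_lsc :: "('a::real_normed_vector \<Rightarrow> ereal) \<Rightarrow> ('a \<Rightarrow> ereal) \<Rightarrow> bool" where
  "pairwise_weakly_lsc \<phi>1 \<phi>2 \<longleftrightarrow> (\<forall>s1 s2 R. (\<forall>n. norm (s1 n) \<le> R) \<longrightarrow> (\<lambda>n. s1 n - s2 n) \<longlonglongrightarrow> 0 \<longrightarrow>
     (\<exists>k x. strict_mono (k :: nat \<Rightarrow> nat) \<and> weakly_converges (s1 \<circ> k) x \<and>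
       \<phi>1 x \<le> liminf (\<lambda>n. \<phi>1 (s1 (k n))) \<and> \<phi>2 x \<le> liminf (\<lambda>n. \<phi>2 (s2 (k n)))))"

lemma pairwise_weakly_lsc_reflexive:
  fixes \<phi>1 \<phi>2 :: "'a::banach \<Rightarrow> ereal"
  assumes refl: "reflexive_space TYPE('a)" and w: "weakly_seq_lsc \<phi>1" "weakly_seq_lsc \<phi>2"
  shows "pairwise_weakly_lsc \<phi>1 \<phi>2"
  unfolding pairwise_weakly_lsc_def
proof (intro allI impI)
  fix s1 s2 :: "nat \<Rightarrow> 'a" and R
  assume R: "\<forall>n. norm (s1 n) \<le> R" and diff: "(\<lambda>n. s1 n - s2 n) \<longlonglongrightarrow> 0"
  obtain k x where k: "strict_mono k" and x: "weakly_converges (s1 \<circ> k) x"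
    by (rule reflexive_weakly_convergent_subseq[OF refl, of s1 R]) (use R in blast)+
  have "(\<lambda>n. f (s2 (k n))) \<longlonglongrightarrow> f x" for f :: "'a \<Rightarrow>\<^sub>L real"
  proof -
    have "(\<lambda>n. f (s1 (k n) - s2 (k n))) \<longlonglongrightarrow> f 0"
      using LIMSEQ_subseq_LIMSEQ[OF diff k] by (intro blinfun.tendsto tendsto_const) (simp add: o_def)
    moreover have "(\<lambda>n. f (s1 (k n))) \<longlonglongrightarrow> f x" using x by (simp add: weakly_converges_def)
    ultimately have "(\<lambda>n. f (s1 (k n)) - f (s1 (k n) - s2 (k n))) \<longlonglongrightarrow> f x - f 0" by (intro tendsto_diff)
    then show ?thesis by (simp add: blinfun.diff_right)
  qed
  then have x2: "weakly_converges (s2 \<circ> k) x" by (simp add: weakly_converges_def)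
  show "\<exists>k x. strict_mono k \<and> weakly_converges (s1 \<circ> k) x \<and>
      \<phi>1 x \<le> liminf (\<lambda>n. \<phi>1 (s1 (k n))) \<and> \<phi>2 x \<le> liminf (\<lambda>n. \<phi>2 (s2 (k n)))"
    using k x w(1)[unfolded weakly_seq_lsc_def, rule_format, OF x] w(2)[unfolded weakly_seq_lsc_def, rule_format, OF x2]
    by (intro exI[of _ k] exI[of _ x]) simp
qed

lemma pairwise_weakly_lsc_finite_dim:
  fixes \<phi>1 \<phi>2 :: "'a::real_normed_vector \<Rightarrow> ereal"
  assumes fin: "finite_dim_space TYPE('a)" and l: "lsc \<phi>1" "lsc \<phi>2"
  shows "pairwise_weakly_lsc \<phi>1 \<phi>2"
  unfolding pairwise_weakly_lsc_def
proof (intro allI impI)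
  fix s1 s2 :: "nat \<Rightarrow> 'a" and R
  assume R: "\<forall>n. norm (s1 n) \<le> R" and diff: "(\<lambda>n. s1 n - s2 n) \<longlonglongrightarrow> 0"
  obtain B :: "'a set" where "finite B" "span B = UNIV" using fin unfolding finite_dim_space_def by blast
  then obtain k x where k: "strict_mono k" and x: "(s1 \<circ> k) \<longlonglongrightarrow> x"
    using finite_span_bounded_convergent_subseq[of B s1 R] R by auto
  then have x1: "(\<lambda>n. s1 (k n)) \<longlonglongrightarrow> x" by (simp add: o_def)
  have "(\<lambda>n. s1 (k n) - (s1 (k n) - s2 (k n))) \<longlonglongrightarrow> x - 0"
    using LIMSEQ_subseq_LIMSEQ[OF diff k] by (intro tendsto_diff x1) (simp add: o_def)
  then have x2: "(\<lambda>n. s2 (k n)) \<longlonglongrightarrow> x" by simp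
  have "weakly_converges (s1 \<circ> k) x"
    unfolding weakly_converges_def o_def by (intro allI blinfun.tendsto tendsto_const x1)
  then show "\<exists>k x. strict_mono k \<and> weakly_converges (s1 \<circ> k) x \<and>
      \<phi>1 x \<le> liminf (\<lambda>n. \<phi>1 (s1 (k n))) \<and> \<phi>2 x \<le> liminf (\<lambda>n. \<phi>2 (s2 (k n)))"
    using k lsc_sequentially[OF l(1) x1] lsc_sequentially[OF l(2) x2] by (intro exI[of _ k] exI[of _ x]) simp
qed

lemma ereal_less_add_split:
  fixes a b :: ereal
  assumes "ereal z < a + b" "a \<noteq> - \<infinity>" "b \<noteq> - \<infinity>"
  shows "\<exists>c1 c2. ereal c1 < a \<and> ereal c2 < b \<and> z < c1 + c2"
proof (cases a)
  case a: (real r)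
  show ?thesis
  proof (cases b)
    case b: (real t)
    have "z < r + t" using assms a b by simp
    then show ?thesis using a b
      by (intro exI[of _ "r - (r + t - z) / 3"] exI[of _ "t - (r + t - z) / 3"]) (simp add: field_simps)
  next
    case PInf
    then show ?thesis using a by (intro exI[of _ "r - 1"] exI[of _ "z - r + 2"]) simp
  qed (use assms in simp)
next
  case PInf
  show ?thesis
  proof (cases b)
    case b: (real t)
    then show ?thesis using PInf by (intro exI[of _ "z - t + 2"] exI[of _ "t - 1"]) simp
  next
    case PInf': PInf
    then show ?thesis using PInf by (intro exI[of _ "z + 1"] exI[of _ 0]) simp
  qed (use assms in simp)
qed (use assms in simp)

text \<open>The subgradient inequality of \<open>xs\<close> for the sum at \<open>z\<close>, where \<open>a\<close> is the value at \<open>z\<close>, persists if the arguments of the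
two summands are decoupled. The error \<open>e * d\<close> is proportional to the radius of the ball so that it is outweighed
by a quadratic term with coefficient of order \<open>e / d\<close>, which has a derivative of order \<open>e\<close> on that ball.\<close>

definition decoupled_bound :: "('a::real_normed_vector \<Rightarrow> ereal) \<Rightarrow> ('a \<Rightarrow> ereal) \<Rightarrow> 'a \<Rightarrow> ('a \<Rightarrow>\<^sub>L real) \<Rightarrow> real \<Rightarrow> bool" where
  "decoupled_bound \<phi>1 \<phi>2 z xs a \<longleftrightarrow> (\<forall>e>0. \<exists>d0>0. \<forall>d. 0 < d \<and> d \<le> d0 \<longrightarrow>
     (\<forall>\<kappa>>0. \<exists>\<eta>>0. \<forall>x1\<in>cball z d. \<forall>x2\<in>cball z d. norm (x1 - x2) < \<eta> \<longrightarrow>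
       ereal (a + blinfun_apply xs (x2 - z) - e * d - \<kappa>) \<le> \<phi>1 x1 + \<phi>2 x2))"

text \<open>For a pair \<open>(x1, x2)\<close> in the ball of radius \<open>d\<close>, which is essentially interior to the ball of radius \<open>2 * d\<close>, firm
quasiuniform lower semicontinuity gives a common point \<open>x\<close> close to both whose value is not much larger; apply
the subgradient inequality at \<open>x\<close> with tolerance \<open>e/2\<close>.\<close>

lemma decoupled_bound_firm:
  fixes \<phi>1 \<phi>2 :: "'a::real_normed_vector \<Rightarrow> ereal"
  assumes proper: "\<forall>x. \<phi>1 x \<noteq> - \<infinity>" "\<forall>x. \<phi>2 x \<noteq> - \<infinity>"
    and z: "\<phi>1 z + \<phi>2 z = ereal a" and xs: "xs \<in> frechet_subdiff (\<lambda>x. \<phi>1 x + \<phi>2 x) z"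
    and firm: "firmly_quasi_lsc_near \<phi>1 \<phi>2 z"
  shows "decoupled_bound \<phi>1 \<phi>2 z xs a"
  unfolding decoupled_bound_def
proof (intro allI impI)
  fix e :: real assume e: "e > 0"
  obtain ds where ds: "ds > 0"
    "\<And>u. norm (u - z) < ds \<Longrightarrow> ereal (a + xs (u - z) - e/2 * norm (u - z)) \<le> \<phi>1 u + \<phi>2 u"
    using frechet_subdiffD[OF xs z half_gt_zero[OF e]] by blast
  obtain b where b: "b > 0" "\<And>d. 0 < d \<Longrightarrow> d < b \<Longrightarrow> firmly_quasi_lsc_on \<phi>1 \<phi>2 (cball z d)"
    using firm unfolding firmly_quasi_lsc_near_def eventually_at_right_field by blast
  have "\<exists>\<eta>>0. \<forall>x1\<in>cball z d. \<forall>x2\<in>cball z d. norm (x1 - x2) < \<eta> \<longrightarrow>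
       ereal (a + blinfun_apply xs (x2 - z) - e * d - \<kappa>) \<le> \<phi>1 x1 + \<phi>2 x2"
    if d: "0 < d" "d \<le> min ds b / 3" and \<kappa>: "\<kappa> > 0" for d \<kappa>
  proof -
    have d2: "2 * d < ds" "2 * d < b" using d ds(1) b(1) by linarith+
    define U where "U = cball z (2 * d)"
    \<comment> \<open>\<open>V\<close> is essentially interior to \<open>U\<close> because the radius is doubled.\<close>
    define V where "V = cball z d"
    define \<kappa>' where "\<kappa>' = \<kappa> / (1 + norm xs)"
    have nx: "1 + norm xs > 0" using norm_ge_zero[of xs] by linarith
    have "(1 + norm xs) * \<kappa>' = \<kappa>" using nx by (simp add: \<kappa>'_def)
    then have \<kappa>'_eq: "\<kappa>' + norm xs * \<kappa>' = \<kappa>" by (simp only: distrib_right mult_1_left)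
    have \<kappa>': "\<kappa>' > 0" using \<kappa> nx by (simp add: \<kappa>'_def)
    have "(\<Union>x\<in>V. ball x d) \<subseteq> U"
    proof
      fix y assume "y \<in> (\<Union>x\<in>V. ball x d)"
      then obtain x where "dist z x \<le> d" "dist x y < d" by (auto simp: V_def)
      then show "y \<in> U" using dist_triangle[of z y x] by (simp add: U_def)
    qed
    moreover have "V \<subseteq> U" unfolding U_def V_def using d(1) by (intro subset_cball) simp
    ultimately have V: "V \<in> EI U" using d(1) by (auto simp: EI_def)
    have "Theta_dagger \<phi>1 \<phi>2 U = 0" using b(2)[of "2 * d"] d(1) d2(2) by (simp add: firmly_quasi_lsc_on_def U_def)
    moreover have "Lim (at_right 0) (diamond_sup \<phi>1 \<phi>2 U V) = (INF \<eta>\<in>{0<..}. diamond_sup \<phi>1 \<phi>2 U V \<eta>)"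
      by (rule tendsto_Lim[OF _ tendsto_diamond_sup]) simp
    ultimately have "(INF \<eta>\<in>{0<..}. diamond_sup \<phi>1 \<phi>2 U V \<eta>) \<le> 0"
      using SUP_upper[OF V, of "\<lambda>V. Lim (at_right 0) (diamond_sup \<phi>1 \<phi>2 U V)"] by (simp add: Theta_dagger_def)
    also have "0 < ereal \<kappa>'" using \<kappa>' by simp
    finally obtain \<eta> where \<eta>: "\<eta> > 0" "diamond_sup \<phi>1 \<phi>2 U V \<eta> < ereal \<kappa>'" by (auto simp: INF_less_iff)
    have "ereal (a + blinfun_apply xs (x2 - z) - e * d - \<kappa>) \<le> \<phi>1 x1 + \<phi>2 x2"
      if x: "x1 \<in> V" "x2 \<in> V" "norm (x1 - x2) < \<eta>" for x1 x2
    proof (cases "\<phi>1 x1 = \<infinity> \<or> \<phi>2 x2 = \<infinity>")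
      case True
      then have "\<phi>1 x1 + \<phi>2 x2 = \<infinity>" using proper by auto
      then show ?thesis by (simp only: ereal_less_eq(1))
    next
      case False
      then obtain b1 b2 where b12: "\<phi>1 x1 = ereal b1" "\<phi>2 x2 = ereal b2"
        using proper by (metis ereal_cases)
      let ?A = "{diamond \<phi>1 \<phi>2 U x1 x2 | x1 x2. x1 \<in> edom \<phi>1 \<inter> V \<and> x2 \<in> edom \<phi>2 \<inter> V \<and> dist x1 x2 < \<eta>}"
      have "diamond \<phi>1 \<phi>2 U x1 x2 \<in> ?A"
        by (intro CollectI exI[of _ x1] exI[of _ x2]) (use x b12 in \<open>simp add: edom_def dist_norm\<close>)
      then have "diamond \<phi>1 \<phi>2 U x1 x2 \<le> diamond_sup \<phi>1 \<phi>2 U V \<eta>"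
        unfolding diamond_sup_def Sup0_def by (auto intro: Sup_upper)
      also note \<eta>(2)
      finally obtain x where xU: "x \<in> U"
        and "Max {ereal (dist x x1), ereal (dist x x2), \<phi>1 x + \<phi>2 x - \<phi>1 x1 - \<phi>2 x2} < ereal \<kappa>'"
        unfolding diamond_def INF_less_iff by blast
      then have near: "dist x x2 < \<kappa>'" and val: "\<phi>1 x + \<phi>2 x - ereal b1 - ereal b2 < ereal \<kappa>'"
        by (simp_all add: b12)
      have "norm (x - z) \<le> 2 * d" using xU by (simp add: U_def dist_norm norm_minus_commute)
      then have low: "ereal (a + xs (x - z) - e/2 * norm (x - z)) \<le> \<phi>1 x + \<phi>2 x" and en: "e/2 * norm (x - z) \<le> e * d"
        using ds(2)[of x] d2(1) mult_left_mono[of "norm (x - z)" "2 * d" "e/2"] e by auto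
      have "xs (x2 - z) - xs (x - z) \<le> norm xs * \<kappa>'"
      proof -
        have "xs (x2 - z) - xs (x - z) = xs (x2 - x)" by (simp add: blinfun.diff_right)
        also have "\<dots> \<le> norm xs * norm (x2 - x)" using norm_blinfun[of xs "x2 - x"] by simp
        also have "\<dots> \<le> norm xs * \<kappa>'" using near by (intro mult_left_mono) (simp_all add: dist_norm norm_minus_commute)
        finally show ?thesis .
      qed
      moreover obtain r where r: "\<phi>1 x + \<phi>2 x = ereal r"
        using low val by (cases "\<phi>1 x + \<phi>2 x") auto
      then have "a + xs (x - z) - e/2 * norm (x - z) \<le> r" "r - b1 - b2 < \<kappa>'" using low val by simp_all
      ultimately have "a + xs (x2 - z) - e * d - \<kappa> \<le> b1 + b2" using en \<kappa>'_eq by linarith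
      then show ?thesis by (simp add: b12)
    qed
    then show ?thesis using \<eta>(1) unfolding V_def by blast
  qed
  moreover have "min ds b / 3 > 0" using ds(1) b(1) by simp
  ultimately show "\<exists>d0>0. \<forall>d. 0 < d \<and> d \<le> d0 \<longrightarrow>
     (\<forall>\<kappa>>0. \<exists>\<eta>>0. \<forall>x1\<in>cball z d. \<forall>x2\<in>cball z d. norm (x1 - x2) < \<eta> \<longrightarrow>
       ereal (a + blinfun_apply xs (x2 - z) - e * d - \<kappa>) \<le> \<phi>1 x1 + \<phi>2 x2)" by blast
qed

text \<open>A sequence of pairs violating the bound would have a weak limit in the ball at which the subgradient inequality for
the sum fails. The limit need not be close to the pairs in norm, which is why the bound involves the radius
\<open>d\<close> and not the distance to \<open>z\<close>.\<close>

lemma decoupled_bound_weak: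
  fixes \<phi>1 \<phi>2 :: "'a::real_normed_vector \<Rightarrow> ereal"
  assumes proper: "\<forall>x. \<phi>1 x \<noteq> - \<infinity>" "\<forall>x. \<phi>2 x \<noteq> - \<infinity>"
    and z: "\<phi>1 z + \<phi>2 z = ereal a" and xs: "xs \<in> frechet_subdiff (\<lambda>x. \<phi>1 x + \<phi>2 x) z"
    and weak: "pairwise_weakly_lsc \<phi>1 \<phi>2"
  shows "decoupled_bound \<phi>1 \<phi>2 z xs a"
  unfolding decoupled_bound_def
proof (intro allI impI)
  fix e :: real assume e: "e > 0"
  obtain ds where ds: "ds > 0"
    "\<And>u. norm (u - z) < ds \<Longrightarrow> ereal (a + xs (u - z) - e * norm (u - z)) \<le> \<phi>1 u + \<phi>2 u"
    using frechet_subdiffD[OF xs z e] by blast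
  have "\<exists>\<eta>>0. \<forall>x1\<in>cball z d. \<forall>x2\<in>cball z d. norm (x1 - x2) < \<eta> \<longrightarrow>
       ereal (a + blinfun_apply xs (x2 - z) - e * d - \<kappa>) \<le> \<phi>1 x1 + \<phi>2 x2"
    if d: "0 < d" "d \<le> ds / 2" and \<kappa>: "\<kappa> > 0" for d \<kappa>
  proof (rule ccontr)
    assume "\<not> ?thesis"
    then have "\<exists>x1 x2. x1 \<in> cball z d \<and> x2 \<in> cball z d \<and> norm (x1 - x2) < inverse (real (Suc n)) \<and>
      \<phi>1 x1 + \<phi>2 x2 < ereal (a + blinfun_apply xs (x2 - z) - e * d - \<kappa>)" for n
      by (meson inverse_positive_iff_positive not_le of_nat_0_less_iff zero_less_Suc)
    then obtain s1 s2 where s: "\<And>n. s1 n \<in> cball z d" "\<And>n. norm (s1 n - s2 n) < inverse (real (Suc n))"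
      "\<And>n. \<phi>1 (s1 n) + \<phi>2 (s2 n) < ereal (a + blinfun_apply xs (s2 n - z) - e * d - \<kappa>)" by metis
    have bnd: "\<forall>n. norm (s1 n) \<le> norm z + d"
    proof
      fix n show "norm (s1 n) \<le> norm z + d"
        using s(1)[of n] norm_triangle_sub[of "s1 n" z] by (simp add: dist_norm norm_minus_commute)
    qed
    have diff: "(\<lambda>n. s1 n - s2 n) \<longlonglongrightarrow> 0"
      by (rule Lim_null_comparison[OF _ LIMSEQ_inverse_real_of_nat]) (use s(2) in \<open>simp add: less_imp_le\<close>)
    obtain k x where k: "strict_mono (k :: nat \<Rightarrow> nat)" and x: "weakly_converges (s1 \<circ> k) x"
      and lim: "\<phi>1 x \<le> liminf (\<lambda>n. \<phi>1 (s1 (k n)))" "\<phi>2 x \<le> liminf (\<lambda>n. \<phi>2 (s2 (k n)))"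
      using weak bnd diff unfolding pairwise_weakly_lsc_def by blast
    have f1: "(\<lambda>n. f (s1 (k n))) \<longlonglongrightarrow> f x" for f :: "'a \<Rightarrow>\<^sub>L real"
      using x by (simp add: weakly_converges_def)
    have "norm (x - z) \<le> d"
    proof -
      obtain F :: "'a \<Rightarrow>\<^sub>L real" where F: "norm F \<le> 1" "F (x - z) = norm (x - z)" by (rule norming_functional)
      have "(\<lambda>n. F (s1 (k n)) - F z) \<longlonglongrightarrow> F x - F z" by (intro tendsto_diff f1 tendsto_const)
      then have "(\<lambda>n. F (s1 (k n) - z)) \<longlonglongrightarrow> norm (x - z)" using F(2) by (simp add: blinfun.diff_right)
      moreover have "F (s1 (k n) - z) \<le> d" for n
        using norm_blinfun[of F "s1 (k n) - z"] mult_right_mono[OF F(1) norm_ge_zero[of "s1 (k n) - z"]] s(1)[of "k n"]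
        by (simp add: dist_norm norm_minus_commute)
      ultimately show ?thesis using LIMSEQ_le_const2 by blast
    qed
    then have low: "ereal (a + xs (x - z) - e * d) \<le> \<phi>1 x + \<phi>2 x"
    proof -
      have "ereal (a + xs (x - z) - e * norm (x - z)) \<le> \<phi>1 x + \<phi>2 x"
        using \<open>norm (x - z) \<le> d\<close> d ds(1) by (intro ds(2)) linarith
      moreover have "e * norm (x - z) \<le> e * d" using \<open>norm (x - z) \<le> d\<close> e by (intro mult_left_mono) auto
      then have "ereal (a + xs (x - z) - e * d) \<le> ereal (a + xs (x - z) - e * norm (x - z))" by simp
      ultimately show ?thesis by (rule order_trans[rotated])
    qed
    have "ereal (a + xs (x - z) - e * d - \<kappa>) < ereal (a + xs (x - z) - e * d)" using \<kappa> by simp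
    then have "ereal (a + xs (x - z) - e * d - \<kappa>) < \<phi>1 x + \<phi>2 x" using low by (rule less_le_trans)
    then obtain c1 c2 where c: "ereal c1 < \<phi>1 x" "ereal c2 < \<phi>2 x" "a + xs (x - z) - e * d - \<kappa> < c1 + c2"
      using ereal_less_add_split proper by blast
    have "\<forall>\<^sub>F n in sequentially. ereal c1 < \<phi>1 (s1 (k n))" "\<forall>\<^sub>F n in sequentially. ereal c2 < \<phi>2 (s2 (k n))"
      using less_le_trans[OF c(1) lim(1)] less_le_trans[OF c(2) lim(2)] by (auto dest: less_LiminfD)
    then have "\<forall>\<^sub>F n in sequentially. c1 + c2 \<le> a + xs (s2 (k n) - z) - e * d - \<kappa>"
    proof eventually_elim
      case (elim n)
      have "ereal c1 + ereal c2 \<le> \<phi>1 (s1 (k n)) + \<phi>2 (s2 (k n))" using elim by (intro add_mono) auto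
      also note s(3)[of "k n"]
      finally show ?case by simp
    qed
    moreover have "(\<lambda>n. a + xs (s2 (k n) - z) - e * d - \<kappa>) \<longlonglongrightarrow> a + xs (x - z) - e * d - \<kappa>"
    proof -
      have "(\<lambda>n. xs (s1 (k n) - s2 (k n))) \<longlonglongrightarrow> xs 0"
        using LIMSEQ_subseq_LIMSEQ[OF diff k] by (intro blinfun.tendsto tendsto_const) (simp add: o_def)
      then have "(\<lambda>n. xs (s1 (k n)) - xs (s1 (k n) - s2 (k n)) - xs z) \<longlonglongrightarrow> xs x - xs 0 - xs z"
        by (intro tendsto_diff f1 tendsto_const)
      then have "(\<lambda>n. xs (s2 (k n) - z)) \<longlonglongrightarrow> xs (x - z)" by (simp add: blinfun.diff_right)
      then show ?thesis by (intro tendsto_diff tendsto_add tendsto_const)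
    qed
    ultimately have "c1 + c2 \<le> a + xs (x - z) - e * d - \<kappa>" by (intro tendsto_lowerbound) auto
    then show False using c(3) by simp
  qed
  moreover have "ds / 2 > 0" using ds(1) by simp
  ultimately show "\<exists>d0>0. \<forall>d. 0 < d \<and> d \<le> d0 \<longrightarrow>
     (\<forall>\<kappa>>0. \<exists>\<eta>>0. \<forall>x1\<in>cball z d. \<forall>x2\<in>cball z d. norm (x1 - x2) < \<eta> \<longrightarrow>
       ereal (a + blinfun_apply xs (x2 - z) - e * d - \<kappa>) \<le> \<phi>1 x1 + \<phi>2 x2)" by blast
qed

section \<open>The fuzzy sum rule\<close>

lemma lsc_sum_sublevel_sequentially:
  fixes \<phi>1 \<phi>2 :: "'a::metric_space \<Rightarrow> ereal"
  assumes proper: "\<forall>x. \<phi>1 x \<noteq> - \<infinity>" "\<forall>x. \<phi>2 x \<noteq> - \<infinity>" and l: "lsc \<phi>1" "lsc \<phi>2"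
    and u: "u1 \<longlonglongrightarrow> x1" "u2 \<longlonglongrightarrow> x2" and G: "G \<longlonglongrightarrow> (t :: real)"
    and le: "\<And>n. \<phi>1 (u1 n) + \<phi>2 (u2 n) + ereal (G n) \<le> ereal c"
  shows "\<phi>1 x1 + \<phi>2 x2 + ereal t \<le> ereal c"
proof (rule ccontr)
  assume "\<not> ?thesis"
  then have "ereal (c - t) < \<phi>1 x1 + \<phi>2 x2"
    using proper by (cases "\<phi>1 x1"; cases "\<phi>2 x2") auto
  then obtain c1 c2 where c: "ereal c1 < \<phi>1 x1" "ereal c2 < \<phi>2 x2" "c - t < c1 + c2"
    using ereal_less_add_split proper by blast
  have "\<forall>\<^sub>F n in sequentially. ereal c1 < \<phi>1 (u1 n)" "\<forall>\<^sub>F n in sequentially. ereal c2 < \<phi>2 (u2 n)"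
    using less_le_trans[OF c(1) lsc_sequentially[OF l(1) u(1)]] less_le_trans[OF c(2) lsc_sequentially[OF l(2) u(2)]]
    by (auto dest: less_LiminfD)
  then have "\<forall>\<^sub>F n in sequentially. c1 + c2 + G n \<le> c"
  proof eventually_elim
    case (elim n)
    have "ereal c1 + ereal c2 + ereal (G n) \<le> \<phi>1 (u1 n) + \<phi>2 (u2 n) + ereal (G n)"
      using elim by (intro add_mono) auto
    also note le[of n]
    finally show ?case by simp
  qed
  moreover have "(\<lambda>n. c1 + c2 + G n) \<longlonglongrightarrow> c1 + c2 + t" by (intro tendsto_add tendsto_const G)
  ultimately have "c1 + c2 + t \<le> c" by (intro tendsto_upperbound) auto
  then show False using c(3) by simp
qed

lemma lsc_lower_bound_near:
  assumes "lsc \<phi>" "\<phi> z = ereal a" "e > 0"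
  obtains d where "d > 0" "\<forall>u. dist u z < d \<longrightarrow> ereal (a - e) \<le> \<phi> u"
proof -
  have "ereal (a - e) < \<phi> z" using assms(2,3) by simp
  moreover from this have "ereal (a - e) < Liminf (at z) \<phi>" using assms(1) less_le_trans unfolding lsc_def by blast
  then have "\<forall>\<^sub>F y in at z. ereal (a - e) < \<phi> y" by (rule less_LiminfD)
  ultimately have "\<forall>\<^sub>F y in nhds z. ereal (a - e) < \<phi> y" by (simp add: eventually_nhds_conv_at)
  then show ?thesis using that unfolding eventually_nhds_metric by (meson less_imp_le)
qed

text \<open>The function to be minimized over \<open>B \<times> B\<close>, where \<open>B\<close> is the part of \<open>Y\<close> in the ball of radius \<open>d\<close>, is
\<open>\<phi>1 x1 + \<phi>2 x2 - xs (x2 - z) + m * g (x1 - z) + r * g (x1 - x2)\<close>, normalized to vanish at \<open>(z, z)\<close>. The choice of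
\<open>r\<close> makes \<open>x1\<close> and \<open>x2\<close> close to each other. The term with \<open>m = 16 * e1 / d\<close> exceeds the error \<open>e1 * d\<close> of the
decoupled bound if \<open>norm (x1 - z) \<ge> 3/4 * d\<close>, so the minimizer is interior; its derivative is at most
\<open>m * d = 16 * e1 = \<epsilon> / 8\<close>, and the perturbing series contributes at most \<open>\<epsilon> / 16\<close> for each variable.\<close>

lemma penalized_minimum:
  fixes \<phi>1 \<phi>2 :: "'a::banach \<Rightarrow> ereal" and g :: "'a \<Rightarrow> real"
  assumes proper: "\<forall>x. \<phi>1 x \<noteq> - \<infinity>" "\<forall>x. \<phi>2 x \<noteq> - \<infinity>" and l: "lsc \<phi>1" "lsc \<phi>2"
    and a: "\<phi>1 z = ereal a1" "\<phi>2 z = ereal a2"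
    and Y: "subspace Y" "closed Y" "z \<in> Y"
    and g: "\<forall>x. (norm x)\<^sup>2 / 8 \<le> g x" "\<forall>x. g x \<le> (norm x)\<^sup>2 / 4"
      "\<forall>x h. g (x + h) - g x \<le> (norm (x + h) + 1) * norm h"
    and gd: "\<forall>x\<in>Y. \<exists>p. norm p \<le> norm x \<and> superdiff_on Y g x p"
    and dec: "decoupled_bound \<phi>1 \<phi>2 z xs (a1 + a2)" and \<epsilon>: "\<epsilon> > 0"
  obtains x1 x2 b1 b2 p1 p2 where "x1 \<in> Y" "x2 \<in> Y" "norm (x1 - z) < \<epsilon>" "norm (x2 - z) < \<epsilon>"
    "\<phi>1 x1 = ereal b1" "\<phi>2 x2 = ereal b2" "\<bar>b1 - a1\<bar> < \<epsilon>" "\<bar>b2 - a2\<bar> < \<epsilon>" "norm (p1 + p2 - xs) \<le> \<epsilon> / 2"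
    "joint_subgradient_on Y \<phi>1 \<phi>2 x1 x2 p1 p2"
proof -
  have g0: "g 0 = 0" using g(1,2)[rule_format, of 0] by simp
  have gpos: "0 \<le> g x" for x using g(1)[rule_format, of x] zero_le_power2[of "norm x"] by linarith
  have g_diff: "\<bar>g x - g y\<bar> \<le> (norm x + norm y + 1) * norm (x - y)" for x y
  proof -
    have "g x - g y \<le> (norm x + 1) * norm (x - y)" using g(3)[rule_format, of y "x - y"] by simp
    moreover have "g y - g x \<le> (norm y + 1) * norm (x - y)" using g(3)[rule_format, of x "y - x"] by (simp add: norm_minus_commute)
    moreover have "(norm x + 1) * norm (x - y) \<le> (norm x + norm y + 1) * norm (x - y)"
      "(norm y + 1) * norm (x - y) \<le> (norm x + norm y + 1) * norm (x - y)" by (intro mult_right_mono; simp)+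
    ultimately show ?thesis by linarith
  qed
  have g_cont: "isCont g x" for x
    unfolding isCont_def
  proof (rule LIM_zero_cancel, rule Lim_null_comparison)
    show "\<forall>\<^sub>F y in at x. norm (g y - g x) \<le> (norm y + norm x + 1) * norm (y - x)" using g_diff by simp
    have "((\<lambda>y. (norm y + norm x + 1) * norm (y - x)) \<longlongrightarrow> (norm x + norm x + 1) * norm (x - x)) (at x)"
      by (intro tendsto_intros)
    then show "((\<lambda>y. (norm y + norm x + 1) * norm (y - x)) \<longlongrightarrow> 0) (at x)" by simp
  qed
  have g_lim: "((\<lambda>n. g (v n)) \<longlongrightarrow> g w) F" if "(v \<longlongrightarrow> w) F" for v w and F :: "'c filter"
    using isCont_tendsto_compose[OF g_cont that] .
  define e1 where "e1 = \<epsilon> / 128"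
  have e1: "e1 > 0" using \<epsilon> by (simp add: e1_def)
  obtain d0 where d0: "d0 > 0" "\<forall>d. 0 < d \<and> d \<le> d0 \<longrightarrow>
     (\<forall>\<kappa>>0. \<exists>\<eta>>0. \<forall>x1\<in>cball z d. \<forall>x2\<in>cball z d. norm (x1 - x2) < \<eta> \<longrightarrow>
       ereal (a1 + a2 + blinfun_apply xs (x2 - z) - e1 * d - \<kappa>) \<le> \<phi>1 x1 + \<phi>2 x2)"
    using dec[unfolded decoupled_bound_def, THEN spec, THEN mp, OF e1] by (elim exE conjE) (rule that)
  have \<epsilon>4: "\<epsilon> / 4 > 0" using \<epsilon> by simp
  obtain d1 where d1: "d1 > 0" "\<forall>u. dist u z < d1 \<longrightarrow> ereal (a1 - \<epsilon>/4) \<le> \<phi>1 u" by (rule lsc_lower_bound_near[OF l(1) a(1) \<epsilon>4])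
  obtain d2 where d2: "d2 > 0" "\<forall>u. dist u z < d2 \<longrightarrow> ereal (a2 - \<epsilon>/4) \<le> \<phi>2 u" by (rule lsc_lower_bound_near[OF l(2) a(2) \<epsilon>4])
  have nx: "norm xs + 1 > 0" using norm_ge_zero[of xs] by linarith
  define d where "d = Min {d0, d1 / 2, d2 / 2, \<epsilon> / 2, \<epsilon> / 4 / (norm xs + 1)}"
  have d: "d > 0" "d \<le> d0" "d < d1" "d < d2" "d < \<epsilon>" "norm xs * d \<le> \<epsilon>/4"
  proof -
    show "d > 0" using d0(1) d1(1) d2(1) \<epsilon> nx by (simp add: d_def)
    have le: "d \<le> d0" "d \<le> d1 / 2" "d \<le> d2 / 2" "d \<le> \<epsilon> / 2" "d \<le> \<epsilon> / 4 / (norm xs + 1)"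
      unfolding d_def by (rule Min_le; simp)+
    then show "d \<le> d0" "d < d1" "d < d2" "d < \<epsilon>" using d1(1) d2(1) \<epsilon> by auto
    have "(norm xs + 1) * d \<le> \<epsilon> / 4" using le(5) nx by (simp only: pos_le_divide_eq mult.commute)
    then show "norm xs * d \<le> \<epsilon>/4" using \<open>d > 0\<close> by (simp only: distrib_right)
  qed
  \<comment> \<open>Less than the surplus \<open>(9/8 - 1) * e1 * d\<close> that the term with \<open>m\<close> has if \<open>norm (x1 - z) \<ge> 3/4 * d\<close>.\<close>
  define \<kappa> where "\<kappa> = e1 * d / 16"
  have \<kappa>: "\<kappa> > 0" using e1 d(1) by (simp add: \<kappa>_def)
  obtain \<eta>0 where \<eta>0: "\<eta>0 > 0" "\<forall>x1\<in>cball z d. \<forall>x2\<in>cball z d. norm (x1 - x2) < \<eta>0 \<longrightarrow>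
       ereal (a1 + a2 + blinfun_apply xs (x2 - z) - e1 * d - \<kappa>) \<le> \<phi>1 x1 + \<phi>2 x2"
    using d0(2)[THEN spec, THEN mp, OF conjI[OF d(1,2)], THEN spec, THEN mp, OF \<kappa>] by (elim exE conjE) (rule that)
  define \<eta> where "\<eta> = min \<eta>0 (d / 4)"
  have \<eta>: "\<eta> > 0" "\<eta> \<le> \<eta>0" "\<eta> \<le> d / 4" using \<eta>0(1) d(1) by (auto simp: \<eta>_def)
  define m where "m = 16 * e1 / d"
  define r where "r = 16 * \<epsilon> / \<eta>\<^sup>2"
  have m: "m > 0" using e1 d(1) by (simp add: m_def)
  have r: "r > 0" using \<epsilon> \<eta>(1) by (simp add: r_def)
  define G where "G w = m * g (fst w - z) + r * g (fst w - snd w) - (a1 + a2 + blinfun_apply xs (snd w - z))" for w :: "'a \<times> 'a"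
  define B where "B = Y \<inter> cball z d"
  define M where "M = {w. fst w \<in> B \<and> snd w \<in> B \<and> \<phi>1 (fst w) + \<phi>2 (snd w) + ereal (G w) \<le> 0}"
  define F where "F w = real_of_ereal (\<phi>1 (fst w)) + real_of_ereal (\<phi>2 (snd w)) + G w" for w
  have Bnorm: "norm (u - z) \<le> d" "u \<in> Y" if "u \<in> B" for u using that by (auto simp: B_def dist_norm norm_minus_commute)
  have low1: "ereal (a1 - \<epsilon>/4) \<le> \<phi>1 u" and low2: "ereal (a2 - \<epsilon>/4) \<le> \<phi>2 u" if "u \<in> B" for u
    using d1(2) d2(2) Bnorm(1)[OF that] d(3,4) by (auto simp: dist_norm)
  have xs_le: "\<bar>xs (u - z)\<bar> \<le> \<epsilon>/4" if "u \<in> B" for u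
    using norm_blinfun[of xs "u - z"] mult_left_mono[OF Bnorm(1)[OF that] norm_ge_zero[of xs]] d(6) by simp
  have real: "\<phi>1 (fst w) = ereal (real_of_ereal (\<phi>1 (fst w)))" "\<phi>2 (snd w) = ereal (real_of_ereal (\<phi>2 (snd w)))" "F w \<le> 0"
    if w: "w \<in> M" for w
  proof -
    have "\<phi>1 (fst w) + \<phi>2 (snd w) + ereal (G w) \<le> 0" using w by (simp add: M_def)
    then obtain b1 b2 where b: "\<phi>1 (fst w) = ereal b1" "\<phi>2 (snd w) = ereal b2"
      using proper by (cases "\<phi>1 (fst w)"; cases "\<phi>2 (snd w)") auto
    then show "\<phi>1 (fst w) = ereal (real_of_ereal (\<phi>1 (fst w)))" "\<phi>2 (snd w) = ereal (real_of_ereal (\<phi>2 (snd w)))" by simp_all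
    show "F w \<le> 0" using w b by (simp add: M_def F_def)
  qed
  have F_eq: "\<phi>1 (fst w) + \<phi>2 (snd w) + ereal (G w) = ereal (F w)" if "w \<in> M" for w
    using real(1,2)[OF that] unfolding F_def by (metis plus_ereal.simps(1))
  have F_low: "- \<epsilon> \<le> F w" if w: "w \<in> M" for w
  proof -
    have B: "fst w \<in> B" "snd w \<in> B" using w by (auto simp: M_def)
    have "a1 - \<epsilon>/4 \<le> real_of_ereal (\<phi>1 (fst w))" "a2 - \<epsilon>/4 \<le> real_of_ereal (\<phi>2 (snd w))"
      using low1[OF B(1)] low2[OF B(2)] real(1,2)[OF w] by (metis ereal_less_eq(3))+
    moreover have "0 \<le> m * g (fst w - z)" "0 \<le> r * g (fst w - snd w)" using m r gpos by simp_all
    moreover have "xs (snd w - z) \<le> \<epsilon>/4" using xs_le[OF B(2)] by linarith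
    ultimately show ?thesis unfolding F_def G_def using \<epsilon> by linarith
  qed
  \<comment> \<open>Only the sublevel set \<open>M\<close> of \<open>(z, z)\<close> matters; \<open>F\<close> is real-valued and lower semicontinuous on it.\<close>
  have limit: "w \<in> M" "F w \<le> c" if u: "\<forall>n::nat. u n \<in> M \<and> F (u n) \<le> c" "u \<longlonglongrightarrow> w" and c: "c \<le> 0" for u w c
  proof -
    have fs: "(\<lambda>n. fst (u n)) \<longlonglongrightarrow> fst w" "(\<lambda>n. snd (u n)) \<longlonglongrightarrow> snd w"
      using tendsto_fst[OF u(2)] tendsto_snd[OF u(2)] .
    have clB: "closed B" unfolding B_def by (intro closed_Int Y(2) closed_cball)
    have uB: "fst (u n) \<in> B" "snd (u n) \<in> B" for n using u(1) by (simp_all add: M_def)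
    have wB: "fst w \<in> B" "snd w \<in> B"
      by (rule closed_sequentially[OF clB uB(1) fs(1)], rule closed_sequentially[OF clB uB(2) fs(2)])
    have "(\<lambda>n. G (u n)) \<longlonglongrightarrow> G w"
      unfolding G_def by (intro tendsto_diff tendsto_add tendsto_mult tendsto_const g_lim blinfun.tendsto fs)
    from lsc_sum_sublevel_sequentially[OF proper l fs this, of c]
    have le: "\<phi>1 (fst w) + \<phi>2 (snd w) + ereal (G w) \<le> ereal c" using u(1) F_eq by simp
    also have "\<dots> \<le> 0" using c by simp
    finally show wM: "w \<in> M" using wB by (simp add: M_def)
    show "F w \<le> c" using le F_eq[OF wM] by simp
  qed
  have M_closed: "closed M"
    unfolding closed_sequential_limits
  proof (intro allI impI, elim conjE)
    fix u w assume "\<forall>n. u n \<in> M" and lim: "u \<longlonglongrightarrow> w"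
    then have "\<forall>n. u n \<in> M \<and> F (u n) \<le> 0" using real(3) by simp
    then show "w \<in> M" using lim by (rule limit(1)) simp
  qed
  have zM: "(z, z) \<in> M" and Fz: "F (z, z) = 0" using Y(3) d(1) a by (simp_all add: M_def B_def G_def F_def g0)
  \<comment> \<open>The subgradients of each of the two series are bounded by \<open>\<mu>0 * (2 * d) = \<epsilon> / 16\<close>.\<close>
  define \<mu>0 where "\<mu>0 = \<epsilon> / (32 * d)"
  have \<mu>0: "\<mu>0 > 0" using \<epsilon> d(1) by (simp add: \<mu>0_def)
  define \<mu> where "\<mu> i = \<mu>0 * (1/2)^Suc i" for i
  have "\<mu> sums \<mu>0" using sums_mult[OF power_half_series, of \<mu>0] by (simp only: \<mu>_def[abs_def] mult_1_right)
  then have \<mu>: "\<And>i. \<mu> i > 0" "summable \<mu>" "suminf \<mu> = \<mu>0"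
    using \<mu>0 by (simp_all add: \<mu>_def sums_iff)
  define \<rho> where "\<rho> v w = g (fst v - fst w) + g (snd v - snd w)" for v w :: "'a \<times> 'a"
  have \<rho>_low: "1/8 * (dist v w)\<^sup>2 \<le> \<rho> v w" for v w
  proof -
    have "(dist v w)\<^sup>2 = (norm (fst v - fst w))\<^sup>2 + (norm (snd v - snd w))\<^sup>2"
      by (simp add: dist_prod_def dist_norm)
    then show ?thesis using g(1)[rule_format, of "fst v - fst w"] g(1)[rule_format, of "snd v - snd w"] by (simp add: \<rho>_def)
  qed
  have diff_le: "norm (u - v) \<le> 2 * d" if "u \<in> B" "v \<in> B" for u v
    using norm_triangle_ineq4[of "u - z" "v - z"] Bnorm(1)[OF that(1)] Bnorm(1)[OF that(2)] by simp
  have gB: "g (u - v) \<le> d\<^sup>2" if "u \<in> B" "v \<in> B" for u v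
  proof -
    have "(norm (u - v))\<^sup>2 \<le> (2 * d)\<^sup>2" using diff_le[OF that] by (rule power_mono) simp
    then show ?thesis using g(2)[rule_format, of "u - v"] by (simp add: power_mult_distrib)
  qed
  obtain w zs where w: "w \<in> M" and zs: "\<forall>i::nat. zs i \<in> M"
    and wz: "F w + (\<Sum>i. \<mu> i * \<rho> w (zs i)) \<le> F (z, z)"
    and wmin: "\<forall>v\<in>M. F w + (\<Sum>i. \<mu> i * \<rho> w (zs i)) \<le> F v + (\<Sum>i. \<mu> i * \<rho> v (zs i))"
  proof (rule Borwein_Preiss[OF M_closed zM, where \<rho> = \<rho> and c = "1/8" and \<mu> = \<mu> and R = "2 * d\<^sup>2" and m = "- \<epsilon>" and F = F])
    show "F v \<le> c" if "\<forall>n. u n \<in> M \<and> F (u n) \<le> c" "u \<longlonglongrightarrow> v" for u v c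
    proof -
      have "\<forall>n. u n \<in> M \<and> F (u n) \<le> min c 0" using that(1) real(3) by simp
      from limit(2)[OF this that(2)] show ?thesis by simp
    qed
    show "- \<epsilon> \<le> F v" if "v \<in> M" for v by (rule F_low[OF that])
    show "0 \<le> \<rho> v v'" "\<rho> v v = 0" for v v' by (simp_all add: \<rho>_def gpos g0)
    show "continuous_on UNIV (\<lambda>v. \<rho> v v')" for v'
      unfolding \<rho>_def continuous_on_def by (intro ballI tendsto_add g_lim tendsto_diff tendsto_fst tendsto_snd tendsto_ident_at tendsto_const)
    show "\<rho> v v' \<le> 2 * d\<^sup>2" if "v \<in> M" "v' \<in> M" for v v'
      using gB[of "fst v" "fst v'"] gB[of "snd v" "snd v'"] that by (simp add: M_def \<rho>_def)
  qed (use \<rho>_low \<mu> in auto)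
  define x1 where "x1 = fst w"
  define x2 where "x2 = snd w"
  define b1 where "b1 = real_of_ereal (\<phi>1 x1)"
  define b2 where "b2 = real_of_ereal (\<phi>2 x2)"
  have xB: "x1 \<in> B" "x2 \<in> B" using w by (auto simp: M_def x1_def x2_def)
  have zsB: "fst (zs i) \<in> B" "snd (zs i) \<in> B" for i using zs by (auto simp: M_def)
  have b: "\<phi>1 x1 = ereal b1" "\<phi>2 x2 = ereal b2" using real(1,2)[OF w] by (simp_all add: b1_def b2_def x1_def x2_def)
  have b_low: "a1 - \<epsilon>/4 \<le> b1" "a2 - \<epsilon>/4 \<le> b2" using low1[OF xB(1)] low2[OF xB(2)] b by simp_all
  have Fw: "b1 + b2 + m * g (x1 - z) + r * g (x1 - x2) \<le> a1 + a2 + xs (x2 - z)"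
    using real(3)[OF w] by (simp add: F_def G_def b1_def b2_def x1_def x2_def)
  have mg: "0 \<le> m * g (x1 - z)" and rg: "0 \<le> r * g (x1 - x2)" using m r gpos by simp_all
  have xs2: "xs (x2 - z) \<le> \<epsilon>/4" using xs_le[OF xB(2)] by linarith
  have close: "norm (x1 - x2) < \<eta>"
  proof -
    have "r * g (x1 - x2) \<le> \<epsilon>" using Fw mg xs2 b_low \<epsilon> by linarith
    moreover have "r * ((norm (x1 - x2))\<^sup>2 / 8) \<le> r * g (x1 - x2)" using g(1) r by (intro mult_left_mono) auto
    ultimately have "16 * \<epsilon> / \<eta>\<^sup>2 * ((norm (x1 - x2))\<^sup>2 / 8) \<le> \<epsilon>" unfolding r_def by linarith
    then have "2 * (norm (x1 - x2))\<^sup>2 \<le> \<eta>\<^sup>2" using \<epsilon> \<eta>(1) by (simp add: field_simps)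
    moreover have "0 < \<eta>\<^sup>2" using \<eta>(1) by simp
    ultimately have "(norm (x1 - x2))\<^sup>2 < \<eta>\<^sup>2" using zero_le_power2[of "norm (x1 - x2)"] by linarith
    then show ?thesis by (rule power2_less_imp_less) (use \<eta>(1) in simp)
  qed
  have in1: "norm (x1 - z) < 3/4 * d"
  proof (rule ccontr)
    assume "\<not> ?thesis"
    then have "(3/4 * d)\<^sup>2 \<le> (norm (x1 - z))\<^sup>2" using d(1) by (intro power_mono) auto
    then have "(3/4 * d)\<^sup>2 / 8 \<le> g (x1 - z)" using g(1)[rule_format, of "x1 - z"] by linarith
    then have "m * ((3/4 * d)\<^sup>2 / 8) \<le> m * g (x1 - z)" using m by (intro mult_left_mono) auto
    moreover have "m * ((3/4 * d)\<^sup>2 / 8) = 9/8 * (e1 * d)" using d(1) by (simp add: m_def power2_eq_square)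
    moreover have "a1 + a2 + xs (x2 - z) - e1 * d - \<kappa> \<le> b1 + b2"
      using \<eta>0(2)[rule_format, of x1 x2] xB close \<eta>(2) b by (simp add: B_def)
    moreover have "e1 * d > 0" using e1 d(1) by simp
    ultimately show False using Fw rg unfolding \<kappa>_def by linarith
  qed
  have in2: "norm (x2 - z) < d"
  proof -
    have "norm (x2 - z) \<le> norm (x1 - z) + norm (x1 - x2)"
      using norm_triangle_ineq4[of "x1 - z" "x1 - x2"] by simp
    then show ?thesis using in1 close \<eta>(3) by linarith
  qed
  obtain pa where pa: "norm pa \<le> norm (x1 - z)" "superdiff_on Y g (x1 - z) pa"
    using gd subspace_diff[OF Y(1) Bnorm(2)[OF xB(1)] Y(3)] by blast
  \<comment> \<open>The derivative of the penalty, whose norm is not controlled; it cancels in \<open>p1 + p2\<close>.\<close>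
  obtain pb where pb: "superdiff_on Y g (x1 - x2) pb"
    using gd subspace_diff[OF Y(1) Bnorm(2)[OF xB(1)] Bnorm(2)[OF xB(2)]] by blast
  have series: "\<exists>q. superdiff_on Y (\<lambda>u. \<Sum>i. \<mu> i * g (u - v i)) x q \<and> norm q \<le> \<mu>0 * (2 * d)"
    if x: "x \<in> B" and v: "\<And>i. v i \<in> B" for x v
  proof -
    have "\<forall>i. \<exists>p. norm p \<le> norm (x - v i) \<and> superdiff_on Y g (x - v i) p"
      using gd subspace_diff[OF Y(1) Bnorm(2)[OF x] Bnorm(2)[OF v]] by blast
    then obtain p where p: "\<And>i. norm (p i) \<le> norm (x - v i)" "\<And>i. superdiff_on Y g (x - v i) (p i)" by metis
    have gp: "\<forall>x. 0 \<le> g x" using gpos by blast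
    note S = superdiff_on_series[where a = v and p = p and R = "2 * d" and x = x and \<mu> = \<mu> and Y = Y and g = g, OF gp g(2,3) p(2) order_trans[OF p(1) diff_le[OF x v]] diff_le[OF x v] \<mu>(1,2)]
    show ?thesis using S \<mu>(3) by auto
  qed
  obtain s1 where s1: "superdiff_on Y (\<lambda>u. \<Sum>i. \<mu> i * g (u - fst (zs i))) x1 s1" "norm s1 \<le> \<mu>0 * (2 * d)"
    using series[of x1 "\<lambda>i. fst (zs i)", OF xB(1) zsB(1)] by blast
  obtain s2 where s2: "superdiff_on Y (\<lambda>u. \<Sum>i. \<mu> i * g (u - snd (zs i))) x2 s2" "norm s2 \<le> \<mu>0 * (2 * d)"
    using series[of x2 "\<lambda>i. snd (zs i)", OF xB(2) zsB(2)] by blast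
  define P1 where "P1 u = (\<Sum>i. \<mu> i * g (u - fst (zs i)))" for u
  define P2 where "P2 u = (\<Sum>i. \<mu> i * g (u - snd (zs i)))" for u
  have sumg: "summable (\<lambda>i. \<mu> i * g (u - v i))" if u: "u \<in> B" and v: "\<And>i. v i \<in> B" for u v
  proof (rule summable_comparison_test')
    show "summable (\<lambda>i. \<mu> i * d\<^sup>2)" using \<mu>(2) by (rule summable_mult2)
    show "norm (\<mu> i * g (u - v i)) \<le> \<mu> i * d\<^sup>2" for i
      using gB[OF u v[of i]] \<mu>(1)[of i] gpos[of "u - v i"] by (simp add: abs_mult)
  qed
  have P: "(\<Sum>i. \<mu> i * \<rho> (u1, u2) (zs i)) = P1 u1 + P2 u2" if "u1 \<in> B" "u2 \<in> B" for u1 u2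
    using suminf_add[OF sumg[of u1 "\<lambda>i. fst (zs i)", OF that(1) zsB(1)] sumg[of u2 "\<lambda>i. snd (zs i)", OF that(2) zsB(2)]]
    by (simp add: P1_def P2_def \<rho>_def distrib_left)
  have Pnonneg: "0 \<le> P1 u" "0 \<le> P2 u" if "u \<in> B" for u
    unfolding P1_def P2_def
    using suminf_nonneg[OF sumg[of u "\<lambda>i. fst (zs i)", OF that zsB(1)]]
      suminf_nonneg[OF sumg[of u "\<lambda>i. snd (zs i)", OF that zsB(2)]] \<mu>(1) gpos by (simp_all add: less_imp_le)
  have w_eq: "w = (x1, x2)" by (simp add: x1_def x2_def)
  have minimal: "b1 + b2 + G (x1, x2) + P1 x1 + P2 x2 \<le> c1 + c2 + G (u1, u2) + P1 u1 + P2 u2"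
    if u: "u1 \<in> B" "u2 \<in> B" and c: "\<phi>1 u1 = ereal c1" "\<phi>2 u2 = ereal c2" for u1 u2 c1 c2
  proof -
    have L: "F w + (\<Sum>i. \<mu> i * \<rho> w (zs i)) = b1 + b2 + G (x1, x2) + P1 x1 + P2 x2"
      using P[OF xB] by (simp add: w_eq F_def b1_def b2_def)
    show ?thesis
    proof (cases "c1 + c2 + G (u1, u2) \<le> 0")
      case True
      then have "(u1, u2) \<in> M" using u c by (simp add: M_def)
      from bspec[OF wmin this] show ?thesis unfolding L P[OF u] using c by (simp add: F_def)
    next
      case False
      \<comment> \<open>Outside \<open>M\<close> the unperturbed value already exceeds the minimum.\<close>
      then show ?thesis using wz Pnonneg(1)[OF u(1)] Pnonneg(2)[OF u(2)] unfolding L Fz by linarith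
    qed
  qed
  define p1 where "p1 = - (m *\<^sub>R pa + r *\<^sub>R pb + s1)"
  define p2 where "p2 = xs + r *\<^sub>R pb - s2"
  have Np: "norm (p1 + p2 - xs) \<le> \<epsilon> / 2"
  proof -
    have "p1 + p2 - xs = - (m *\<^sub>R pa + s1 + s2)" by (simp add: p1_def p2_def)
    then have "norm (p1 + p2 - xs) \<le> norm (m *\<^sub>R pa) + norm s1 + norm s2"
      using norm_triangle_ineq[of "m *\<^sub>R pa + s1" s2] norm_triangle_ineq[of "m *\<^sub>R pa" s1] by (simp only: norm_minus_cancel)
    moreover have "norm (m *\<^sub>R pa) \<le> \<epsilon> / 8"
    proof -
      have "norm (m *\<^sub>R pa) \<le> m * d" using pa(1) Bnorm(1)[OF xB(1)] m by simp
      also have "m * d = \<epsilon> / 8" using d(1) by (simp add: m_def e1_def)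
      finally show ?thesis .
    qed
    moreover have "\<mu>0 * (2 * d) = \<epsilon> / 16" using d(1) by (simp add: \<mu>0_def)
    ultimately show ?thesis using s1(2) s2(2) \<epsilon> by linarith
  qed
  have sub: "joint_subgradient_on Y \<phi>1 \<phi>2 x1 x2 p1 p2"
    unfolding joint_subgradient_on_def b1_def[symmetric] b2_def[symmetric]
  proof (intro allI impI)
    fix e :: real assume e: "e > 0"
    define e' where "e' = e / (m + r + 1)"
    have mr: "m + r + 1 > 0" using m r by linarith
    have e': "e' > 0" "(m + r + 1) * e' = e" using e mr by (simp_all add: e'_def)
    obtain da where da: "da > 0" "\<forall>h\<in>Y. norm h < da \<longrightarrow> g (x1 - z + h) \<le> g (x1 - z) + blinfun_apply pa h + e' * norm h"
      by (rule superdiff_onE[OF pa(2) e'(1)])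
    obtain db where db: "db > 0" "\<forall>h\<in>Y. norm h < db \<longrightarrow> g (x1 - x2 + h) \<le> g (x1 - x2) + blinfun_apply pb h + e' * norm h"
      by (rule superdiff_onE[OF pb e'(1)])
    obtain dc where dc: "dc > 0" "\<forall>h\<in>Y. norm h < dc \<longrightarrow> P1 (x1 + h) \<le> P1 x1 + blinfun_apply s1 h + e' * norm h"
      by (rule superdiff_onE[OF s1(1)[folded P1_def] e'(1)])
    obtain dd where dd: "dd > 0" "\<forall>h\<in>Y. norm h < dd \<longrightarrow> P2 (x2 + h) \<le> P2 x2 + blinfun_apply s2 h + e' * norm h"
      by (rule superdiff_onE[OF s2(1)[folded P2_def] e'(1)])
    define \<delta> where "\<delta> = Min {da, db / 2, dc, dd, d - norm (x1 - z), d - norm (x2 - z)}"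
    have \<delta>: "\<delta> > 0" using da(1) db(1) dc(1) dd(1) in1 in2 d(1) by (simp add: \<delta>_def)
    have \<delta>_le: "\<delta> \<le> da" "\<delta> \<le> db / 2" "\<delta> \<le> dc" "\<delta> \<le> dd" "\<delta> \<le> d - norm (x1 - z)" "\<delta> \<le> d - norm (x2 - z)"
      unfolding \<delta>_def by (rule Min_le; simp)+
    have main: "p1 (u1 - x1) + p2 (u2 - x2) \<le> real_of_ereal (\<phi>1 u1) + real_of_ereal (\<phi>2 u2)
        - (b1 + b2) + e * (norm (u1 - x1) + norm (u2 - x2))"
      if u: "u1 \<in> Y" "u2 \<in> Y" and fin: "\<bar>\<phi>1 u1\<bar> \<noteq> \<infinity>" "\<bar>\<phi>2 u2\<bar> \<noteq> \<infinity>" and n: "norm (u1 - x1) < \<delta>" "norm (u2 - x2) < \<delta>" for u1 u2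
    proof -
      define h1 where "h1 = u1 - x1"
      define h2 where "h2 = u2 - x2"
      have h: "h1 \<in> Y" "h2 \<in> Y" "h1 - h2 \<in> Y"
        unfolding h1_def h2_def using u Bnorm(2)[OF xB(1)] Bnorm(2)[OF xB(2)] by (intro subspace_diff[OF Y(1)]; simp)+
      have hn: "norm h1 < \<delta>" "norm h2 < \<delta>" "norm (h1 - h2) \<le> norm h1 + norm h2"
        using n norm_triangle_ineq4[of h1 h2] by (simp_all add: h1_def h2_def)
      have "norm (u1 - z) \<le> norm (x1 - z) + norm h1" "norm (u2 - z) \<le> norm (x2 - z) + norm h2"
        using norm_triangle_ineq[of "x1 - z" h1] norm_triangle_ineq[of "x2 - z" h2] by (simp_all add: h1_def h2_def)
      then have uB: "u1 \<in> B" "u2 \<in> B" using u hn \<delta>_le(5,6) by (auto simp: B_def dist_norm norm_minus_commute)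
      have min: "b1 + b2 + G (x1, x2) + P1 x1 + P2 x2 \<le> real_of_ereal (\<phi>1 u1) + real_of_ereal (\<phi>2 u2) + G (u1, u2) + P1 u1 + P2 u2"
        by (rule minimal[OF uB]) (use fin in \<open>auto simp: ereal_real\<close>)
      have "g (u1 - z) \<le> g (x1 - z) + pa h1 + e' * norm h1"
        using da(2)[rule_format, OF h(1)] hn(1) \<delta>_le(1) by (simp add: h1_def)
      then have A: "m * g (u1 - z) \<le> m * (g (x1 - z) + pa h1 + e' * norm h1)" using m by (intro mult_left_mono) auto
      have "norm (h1 - h2) < db" using hn \<delta>_le(2) by linarith
      then have "g (x1 - x2 + (h1 - h2)) \<le> g (x1 - x2) + pb (h1 - h2) + e' * norm (h1 - h2)" using db(2) h(3) by blast
      moreover have "x1 - x2 + (h1 - h2) = u1 - u2" by (simp add: h1_def h2_def)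
      moreover have "e' * norm (h1 - h2) \<le> e' * (norm h1 + norm h2)" using e'(1) hn(3) by (intro mult_left_mono) auto
      ultimately have "g (u1 - u2) \<le> g (x1 - x2) + pb (h1 - h2) + e' * (norm h1 + norm h2)" by simp
      then have Bb: "r * g (u1 - u2) \<le> r * (g (x1 - x2) + pb (h1 - h2) + e' * (norm h1 + norm h2))" using r by (intro mult_left_mono) auto
      have C: "P1 u1 \<le> P1 x1 + s1 h1 + e' * norm h1"
        using dc(2)[rule_format, OF h(1)] hn(1) \<delta>_le(3) by (simp add: h1_def)
      have Dd: "P2 u2 \<le> P2 x2 + s2 h2 + e' * norm h2"
        using dd(2)[rule_format, OF h(2)] hn(2) \<delta>_le(4) by (simp add: h2_def)
      have xsd: "xs (u2 - z) = xs (x2 - z) + xs h2" by (simp add: h2_def blinfun.diff_right)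
      have ph: "p1 h1 + p2 h2 = xs h2 - m * pa h1 - r * pb (h1 - h2) - s1 h1 - s2 h2"
        by (simp add: p1_def p2_def blinfun.add_left blinfun.diff_left blinfun.minus_left blinfun.scaleR_left blinfun.diff_right algebra_simps)
      have err: "m * (e' * norm h1) + r * (e' * (norm h1 + norm h2)) + e' * norm h1 + e' * norm h2 \<le> e * (norm h1 + norm h2)"
      proof -
        have "e * (norm h1 + norm h2) = m * (e' * norm h1) + r * (e' * (norm h1 + norm h2)) + e' * norm h1 + e' * norm h2 + m * (e' * norm h2)"
          unfolding e'(2)[symmetric] by (simp add: algebra_simps)
        moreover have "0 \<le> m * (e' * norm h2)" using m e'(1) by simp
        ultimately show ?thesis by linarith
      qed
      have GG: "G (u1, u2) = m * g (u1 - z) + r * g (u1 - u2) - (a1 + a2) - xs (u2 - z)"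
        "G (x1, x2) = m * g (x1 - z) + r * g (x1 - x2) - (a1 + a2) - xs (x2 - z)" by (simp_all add: G_def)
      have "p1 h1 + p2 h2 \<le> real_of_ereal (\<phi>1 u1) + real_of_ereal (\<phi>2 u2) - (b1 + b2) + e * (norm h1 + norm h2)"
        using min A Bb C Dd err unfolding GG xsd ph distrib_left[of m] distrib_left[of r] by linarith
      then show ?thesis by (simp add: h1_def h2_def)
    qed
    show "\<exists>d>0. \<forall>u1\<in>Y. \<forall>u2\<in>Y. \<bar>\<phi>1 u1\<bar> \<noteq> \<infinity> \<longrightarrow> \<bar>\<phi>2 u2\<bar> \<noteq> \<infinity> \<longrightarrow> norm (u1 - x1) < d \<longrightarrow> norm (u2 - x2) < d \<longrightarrow>
      blinfun_apply p1 (u1 - x1) + blinfun_apply p2 (u2 - x2) \<le> real_of_ereal (\<phi>1 u1) + real_of_ereal (\<phi>2 u2)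
        - (b1 + b2) + e * (norm (u1 - x1) + norm (u2 - x2))"
      by (intro exI[of _ \<delta>] conjI ballI impI \<delta> main)
  qed
  have nxz: "norm (x1 - z) < \<epsilon>" "norm (x2 - z) < \<epsilon>" using in1 in2 d(1,5) by linarith+
  have ba: "\<bar>b1 - a1\<bar> < \<epsilon>" "\<bar>b2 - a2\<bar> < \<epsilon>" using b_low Fw mg rg xs2 \<epsilon> by linarith+
  show ?thesis by (rule that[OF Bnorm(2)[OF xB(1)] Bnorm(2)[OF xB(2)] nxz b ba Np sub])
qed

theorem theorem7p1:
  fixes \<phi>1 \<phi>2 :: "'a::banach \<Rightarrow> ereal" and xbar :: 'a
  assumes "asplund_space TYPE('a)"
    and "\<forall>x. \<phi>1 x \<noteq> -\<infinity>" and "\<forall>x. \<phi>2 x \<noteq> -\<infinity>"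
    and "lsc \<phi>1" and "lsc \<phi>2"
    and "xbar \<in> edom \<phi>1 \<inter> edom \<phi>2"
    and "firmly_quasi_lsc_near \<phi>1 \<phi>2 xbar
         \<or> (reflexive_space TYPE('a) \<and> weakly_seq_lsc \<phi>1 \<and> weakly_seq_lsc \<phi>2)
         \<or> finite_dim_space TYPE('a)"
  shows "\<forall>xs \<in> frechet_subdiff (\<lambda>x. \<phi>1 x + \<phi>2 x) xbar. \<forall>\<epsilon>::real. \<epsilon> > 0 \<longrightarrow>
           (\<exists>x1 x2 :: 'a.
              norm (x1 - xbar) < \<epsilon> \<and> norm (x2 - xbar) < \<epsilon> \<and>
              \<bar>\<phi>1 x1 - \<phi>1 xbar\<bar> < ereal \<epsilon> \<and> \<bar>\<phi>2 x2 - \<phi>2 xbar\<bar> < ereal \<epsilon> \<and>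
              edist_set xs (frechet_subdiff \<phi>1 x1 + frechet_subdiff \<phi>2 x2) < ereal \<epsilon>)"
proof (intro ballI allI impI)
  fix xs and \<epsilon> :: real
  assume xs: "xs \<in> frechet_subdiff (\<lambda>x. \<phi>1 x + \<phi>2 x) xbar" and \<epsilon>: "\<epsilon> > 0"
  note proper = assms(2,3) and l = assms(4,5)
  obtain a1 a2 where a: "\<phi>1 xbar = ereal a1" "\<phi>2 xbar = ereal a2"
    using assms(6) proper unfolding edom_def by (cases "\<phi>1 xbar"; cases "\<phi>2 xbar") auto
  have sum: "\<phi>1 xbar + \<phi>2 xbar = ereal (a1 + a2)" by (simp add: a)
  have dec: "decoupled_bound \<phi>1 \<phi>2 xbar xs (a1 + a2)"
    using assms(7)
  proof (elim disjE conjE)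
    assume "firmly_quasi_lsc_near \<phi>1 \<phi>2 xbar"
    then show ?thesis by (rule decoupled_bound_firm[OF proper sum xs])
  next
    assume "reflexive_space TYPE('a)" "weakly_seq_lsc \<phi>1" "weakly_seq_lsc \<phi>2"
    then show ?thesis by (intro decoupled_bound_weak[OF proper sum xs] pairwise_weakly_lsc_reflexive)
  next
    assume "finite_dim_space TYPE('a)"
    then show ?thesis by (intro decoupled_bound_weak[OF proper sum xs] pairwise_weakly_lsc_finite_dim l)
  qed
  have e2: "\<epsilon> / 2 > 0" using \<epsilon> by simp
  have D0: "countable {xbar}" "{xbar} \<noteq> {}" by simp_all
  obtain D where D: "countable D" "{xbar} \<subseteq> D" "subspace (closure D)"
    and det: "\<forall>x1\<in>closure D. \<forall>x2\<in>closure D. \<forall>p1 p2. \<bar>\<phi>1 x1\<bar> \<noteq> \<infinity> \<longrightarrow> \<bar>\<phi>2 x2\<bar> \<noteq> \<infinity> \<longrightarrow> norm (p1 + p2 - xs) \<le> \<epsilon> / 2 \<longrightarrow>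
      joint_subgradient_on (closure D) \<phi>1 \<phi>2 x1 x2 p1 p2 \<longrightarrow>
      (\<exists>q1 q2. norm (q1 + q2 - xs) \<le> \<epsilon> / 2 \<and> q1 \<in> frechet_subdiff \<phi>1 x1 \<and> q2 \<in> frechet_subdiff \<phi>2 x2)"
    by (rule separable_determination[OF proper e2 D0])
  define Y where "Y = closure D"
  have Y: "subspace Y" "closed Y" "xbar \<in> Y" "D \<subseteq> Y" using D closure_subset[of D] by (auto simp: Y_def)
  have Y_le: "Y \<subseteq> closure D" by (simp add: Y_def)
  obtain g :: "'a \<Rightarrow> real" where g: "\<forall>x. (norm x)\<^sup>2 / 8 \<le> g x" "\<forall>x. g x \<le> (norm x)\<^sup>2 / 4"
    "\<forall>x h. g (x + h) - g x \<le> (norm (x + h) + 1) * norm h"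
    "\<forall>x\<in>Y. \<exists>p. norm p \<le> norm x \<and> (\<forall>e>0. \<exists>d>0. \<forall>h\<in>Y. norm h < d \<longrightarrow> g (x + h) \<le> g x + blinfun_apply p h + e * norm h)"
    by (rule smooth_gauge_exists[OF assms(1) D(1) Y(4) Y(1) Y_le])
  obtain x1 x2 b1 b2 p1 p2 where x: "x1 \<in> Y" "x2 \<in> Y" "norm (x1 - xbar) < \<epsilon>" "norm (x2 - xbar) < \<epsilon>"
    and b: "\<phi>1 x1 = ereal b1" "\<phi>2 x2 = ereal b2" "\<bar>b1 - a1\<bar> < \<epsilon>" "\<bar>b2 - a2\<bar> < \<epsilon>" and p: "norm (p1 + p2 - xs) \<le> \<epsilon> / 2"
    and sub: "joint_subgradient_on Y \<phi>1 \<phi>2 x1 x2 p1 p2"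
    by (rule penalized_minimum[OF proper l a Y(1-3) g(1-3) g(4)[folded superdiff_on_def] dec \<epsilon>])
  have "\<bar>\<phi>1 x1\<bar> \<noteq> \<infinity>" "\<bar>\<phi>2 x2\<bar> \<noteq> \<infinity>" using b by simp_all
  then have "\<exists>q1 q2. norm (q1 + q2 - xs) \<le> \<epsilon> / 2 \<and> q1 \<in> frechet_subdiff \<phi>1 x1 \<and> q2 \<in> frechet_subdiff \<phi>2 x2"
    using det[THEN bspec, OF x(1)[unfolded Y_def], THEN bspec, OF x(2)[unfolded Y_def], THEN spec, THEN spec, of p1 p2] p sub by (simp add: Y_def)
  then obtain q1 q2 where q: "norm (q1 + q2 - xs) \<le> \<epsilon> / 2" "q1 \<in> frechet_subdiff \<phi>1 x1" "q2 \<in> frechet_subdiff \<phi>2 x2" by blast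
  have "q1 + q2 \<in> frechet_subdiff \<phi>1 x1 + frechet_subdiff \<phi>2 x2" using q(2,3) by (rule set_plus_intro)
  then have "edist_set xs (frechet_subdiff \<phi>1 x1 + frechet_subdiff \<phi>2 x2) \<le> ereal (dist xs (q1 + q2))"
    unfolding edist_set_def by (rule INF_lower)
  also have "\<dots> < ereal \<epsilon>" using q(1) \<epsilon> by (simp add: dist_norm norm_minus_commute)
  finally show "\<exists>x1 x2. norm (x1 - xbar) < \<epsilon> \<and> norm (x2 - xbar) < \<epsilon> \<and>
      \<bar>\<phi>1 x1 - \<phi>1 xbar\<bar> < ereal \<epsilon> \<and> \<bar>\<phi>2 x2 - \<phi>2 xbar\<bar> < ereal \<epsilon> \<and>
      edist_set xs (frechet_subdiff \<phi>1 x1 + frechet_subdiff \<phi>2 x2) < ereal \<epsilon>"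
    using x(3,4) b a by (intro exI[of _ x1] exI[of _ x2]) simp
qed

end
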